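(* Let $\xi$ and $h$ be arbitrary. Let $k\ge0$ and let $\mu_0$ be an optimizer (i.e. minimizer) of $\mathcal{P}$ over $\mathcal{M}_d^k$. If $$\inf_{\mu\in\mathcal{M}_d^{k+1}}\mathcal{P}(\mu)=\mathcal{P}(\mu_0),$$ then $\mu_0$ is the Parisi measure.
   Context: Let $\beta>0$, $h\in\mathbb{R}$, and let $(\gamma_p)_{p\ge2}$ be a nonnegative sequence, not identically zero, decaying fast enough (e.g. $\sum_{p\ge2}2^p\gamma_p^2<\infty$). Set $\xi(s)=\sum_{p\ge2}\beta^2\gamma_p^2s^p$ for $s\in[-1,1]$. Let $\mathcal{M}$ be the set of all Borel probability measures on $[0,1]$; for $\mu\in\mathcal{M}$ let $\alpha_\mu(s)=\mu([0,s])$. For an integer $k\ge0$, $\mathcal{M}_d^k$ is the set of atomic probability measures on $[0,1]$ having no more than $k+1$ atoms (so $\mathcal{M}_d^0$ is the set of Dirac measures). For $\mu\in\mathcal{M}$, $\Phi_\mu$ denotes the (weak) solution on $[0,1]\times\mathbb{R}$ of the Parisi PDE $$\partial_s\Phi_\mu(s,x)=-\frac{\xi''(s)}{2}\Bigl(\partial_{xx}\Phi_\mu(s,x)+\alpha_\mu(s)(\partial_x\Phi_\mu(s,x))^2\Bigr),\qquad \Phi_\mu(1,x)=\log\cosh x.$$ (For $\mu$ with finitely many atoms it is explicit by the Hopf-Cole transformation: if $\alpha_\mu=m$ on $[a,b)$, then $\Phi_\mu(s,x)=\frac1m\log\mathbb{E}\exp m\Phi_\mu(b,x+z\sqrt{\xi'(b)-\xi'(s)})$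 for $s\in[a,b)$ with $z$ standard Gaussian, read as $\mathbb{E}\Phi_\mu(b,\cdot)$ if $m=0$; for general $\mu$ it is the limit along atomic measures $\mu_n$ with $\int_0^1|\alpha_{\mu_n}-\alpha_\mu|ds\to0$.) The Parisi functional is $\mathcal{P}(\mu)=\log2+\Phi_\mu(0,h)-\frac12\int_0^1\alpha_\mu(s)s\xi''(s)\,ds$. It is strictly convex on $\mathcal{M}$ and has a unique minimizer over $\mathcal{M}$, called the Parisi measure. *)

theory Defs
  imports "HOL-Probability.Probability"
begin

definition xi :: "real \<Rightarrow> (nat \<Rightarrow> real) \<Rightarrow> real \<Rightarrow> real" where
  "xi \<beta> \<gamma> s = (\<Sum>p. \<beta>\<^sup>2 * (\<gamma> (p + 2))\<^sup>2 * s ^ (p + 2))"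

text \<open>If \<open>\<Sum>p. 2 ^ p * (\<gamma> p)\<^sup>2\<close> converges, the series for \<open>\<xi>\<close> has radius of convergence
  at least 2, so the two-sided derivatives below exist on all of \<open>{0..1}\<close>.\<close>

definition xi' :: "real \<Rightarrow> (nat \<Rightarrow> real) \<Rightarrow> real \<Rightarrow> real" where
  "xi' \<beta> \<gamma> = deriv (xi \<beta> \<gamma>)"

definition xi'' :: "real \<Rightarrow> (nat \<Rightarrow> real) \<Rightarrow> real \<Rightarrow> real" where
  "xi'' \<beta> \<gamma> = deriv (xi' \<beta> \<gamma>)"

definition prob_measures :: "real measure set" where
  "prob_measures = {\<mu>. prob_space \<mu> \<and> sets \<mu> = sets (restrict_space borel {0..1})}"

definition cdf01 :: "real measure \<Rightarrow> real \<Rightarrow> real" where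
  "cdf01 \<mu> s = measure \<mu> {0..s}"

definition atoms :: "real measure \<Rightarrow> real set" where
  "atoms \<mu> = {q \<in> {0..1}. measure \<mu> {q} > 0}"

definition finitely_atomic :: "real measure set" where
  "finitely_atomic = {\<mu> \<in> prob_measures. finite (atoms \<mu>) \<and> measure \<mu> (atoms \<mu>) = 1}"

definition atomic_measures :: "nat \<Rightarrow> real measure set" where
  "atomic_measures k = {\<mu> \<in> finitely_atomic. card (atoms \<mu>) \<le> k + 1}"

definition std_gaussian :: "real measure" where
  "std_gaussian = density lborel std_normal_density"

definition hopf_cole_step :: "real \<Rightarrow> real \<Rightarrow> (real \<Rightarrow> real) \<Rightarrow> real \<Rightarrow> real" where
  "hopf_cole_step m v f x =
     (if m = 0 then (LINT z|std_gaussian. f (x + z * sqrt v))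
      else 1 / m * ln (LINT z|std_gaussian. exp (m * f (x + z * sqrt v))))"

text \<open>The list contains, in increasing order, the right endpoints of the successive intervals
  to the right of \<open>s\<close> on which \<open>\<alpha>\<close> is constant; its last element is 1 (it is empty for \<open>s = 1\<close>).\<close>

fun hopf_cole ::
  "real \<Rightarrow> (nat \<Rightarrow> real) \<Rightarrow> (real \<Rightarrow> real) \<Rightarrow> real list \<Rightarrow> real \<Rightarrow> real \<Rightarrow> real" where
  "hopf_cole \<beta> \<gamma> \<alpha> [] s x = ln (cosh x)"
| "hopf_cole \<beta> \<gamma> \<alpha> (b # bs) s x =
     hopf_cole_step (\<alpha> s) (xi' \<beta> \<gamma> b - xi' \<beta> \<gamma> s) (\<lambda>y. hopf_cole \<beta> \<gamma> \<alpha> bs b y) x"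

definition Phi_atomic ::
  "real \<Rightarrow> (nat \<Rightarrow> real) \<Rightarrow> real measure \<Rightarrow> real \<Rightarrow> real \<Rightarrow> real" where
  "Phi_atomic \<beta> \<gamma> \<mu> s x =
     hopf_cole \<beta> \<gamma> (cdf01 \<mu>) (sorted_list_of_set {q \<in> atoms \<mu> \<union> {1}. s < q}) s x"

text \<open>The Parisi PDE solution: the Hopf-Cole formula for finitely atomic measures, and otherwise
  the common limit along all sequences of finitely atomic measures whose distribution functions
  converge in \<open>L\<^sup>1\<close> on the unit interval.\<close>

definition Phi ::
  "real \<Rightarrow> (nat \<Rightarrow> real) \<Rightarrow> real measure \<Rightarrow> real \<Rightarrow> real \<Rightarrow> real" where
  "Phi \<beta> \<gamma> \<mu> s x =
     (if \<mu> \<in> finitely_atomic then Phi_atomic \<beta> \<gamma> \<mu> s x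
      else (THE L. \<forall>\<nu> :: nat \<Rightarrow> real measure.
              (\<forall>n. \<nu> n \<in> finitely_atomic) \<longrightarrow>
              (\<lambda>n. LINT r:{0..1}|lborel. \<bar>cdf01 (\<nu> n) r - cdf01 \<mu> r\<bar>) \<longlonglongrightarrow> 0 \<longrightarrow>
              (\<lambda>n. Phi_atomic \<beta> \<gamma> (\<nu> n) s x) \<longlonglongrightarrow> L))"

definition parisi_functional ::
  "real \<Rightarrow> (nat \<Rightarrow> real) \<Rightarrow> real \<Rightarrow> real measure \<Rightarrow> real" where
  "parisi_functional \<beta> \<gamma> h \<mu> =
     ln 2 + Phi \<beta> \<gamma> \<mu> 0 h
       - 1 / 2 * (LINT s:{0..1}|lborel. cdf01 \<mu> s * s * xi'' \<beta> \<gamma> s)"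

definition is_parisi_measure ::
  "real \<Rightarrow> (nat \<Rightarrow> real) \<Rightarrow> real \<Rightarrow> real measure \<Rightarrow> bool" where
  "is_parisi_measure \<beta> \<gamma> h \<mu> \<longleftrightarrow>
     is_arg_min (parisi_functional \<beta> \<gamma> h) (\<lambda>\<nu>. \<nu> \<in> prob_measures) \<mu> \<and>
     (\<forall>\<nu>. is_arg_min (parisi_functional \<beta> \<gamma> h) (\<lambda>\<nu>. \<nu> \<in> prob_measures) \<nu> \<longrightarrow> \<nu> = \<mu>)"

end

theory Submission
  imports Defs
begin

text \<open>
  By the Hopf-Cole formula \<open>\<Phi>(0, h)\<close> is the value of a control problem: it is the supremum over controls
  \<open>u\<close> of \<open>E[ln cosh (h + \<integral> \<xi>'' \<alpha> u ds + \<integral> \<surd>\<xi>'' dB) - \<integral> \<xi>'' \<alpha> u\<^sup>2 ds / 2]\<close>. Inserting the optimal control of \<open>\<mu>\<close>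
  into the problem of \<open>\<nu>\<close> and using the convexity of \<open>ln cosh\<close> gives
  \<open>\<Phi>\<^sub>\<nu>(0, h) \<ge> \<Phi>\<^sub>\<mu>(0, h) + \<integral> \<xi>'' (\<alpha>\<^sub>\<nu> - \<alpha>\<^sub>\<mu>) G\<^sub>\<mu> ds / 2\<close> with \<open>G\<^sub>\<mu>(s) = E[(\<partial>\<^sub>x\<Phi>\<^sub>\<mu>(s, X\<^sub>s))\<^sup>2]\<close>. Stochastic calculus is
  avoided: on a short time step the optimal diffusion is replaced by the Gaussian law tilted by
  \<open>exp (m \<Phi>)\<close>, the trial measure for \<open>\<nu>\<close> is a translate of it in the Gibbs variational principle, and the
  errors are \<open>O(\<delta>\<^sup>3\<^sup>/\<^sup>2)\<close> per step, so they vanish as the partition is refined.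

  The inequality applied at the perturbed measures \<open>(1 - \<theta>) \<mu>\<^sub>0 + \<theta> \<delta>\<^sub>q\<close>, which have at most one atom more
  than \<open>\<mu>\<^sub>0\<close>, turns the hypothesis into \<open>\<integral> \<xi>'' (1\<^sub>{\<^sub>s\<^sub>\<ge>\<^sub>q\<^sub>} - \<alpha>\<^sub>0) (G\<^sub>0 - s) ds \<ge> 0\<close> as \<open>\<theta> \<rightarrow> 0\<close>. Averaging over \<open>q\<close>
  and applying the inequality at \<open>\<mu>\<^sub>0\<close> shows that \<open>\<mu>\<^sub>0\<close> minimizes the functional over atomic measures, hence over all
  measures by approximation. Uniqueness comes from the quadratic term lost to convexity, which is bounded
  below through the tail integrals of \<open>\<xi>'' (\<alpha>\<^sub>\<nu> - \<alpha>\<^sub>0)\<close> and the strict monotonicity of \<open>G\<^sub>0\<close>.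
\<close>

section \<open>Gaussian integration of exponentially bounded functions\<close>

text \<open>The lower bound is a subgradient inequality: its slope is the energy of the base flow,
  and it gives no upper bound on \<Phi> of a perturbed measure. Minimality of \<mu>0 is therefore
  exploited with the perturbed measure as base and \<mu>0 as target. The slope is then the energy of
  the perturbed flow, which is why the energy must be shown to be continuous as \<theta> tends to 0.
  One additional atom is just enough to admit every direction from \<mu>0 towards a Dirac measure.

  Two obstacles shape the estimates. The entropy of a step enters the comparison divided by the
  level of the target, so the errors are uniform only if that level stays away from 0; a general
  target is first replaced by its maximum with 1/n. Moreover the error constant must not grow as the
  partition is refined. It depends on a smoothness constant of \<Phi> that counts the jumps of the
  base level and not the partition points, because steps with equal level compose. The strict gain
  is kept linear in a free parameter t, which can be fixed after all limits have been taken.\<close>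

lemma sets_std_gaussian [measurable_cong, simp]: "sets std_gaussian = sets borel"
  by (simp add: std_gaussian_def)

lemma space_std_gaussian [simp]: "space std_gaussian = UNIV"
  by (simp add: std_gaussian_def)

interpretation gauss: prob_space std_gaussian
  unfolding std_gaussian_def by (rule prob_space_normal_density) simp

text \<open>All integrands below live in this class: it is an algebra, it contains
  \<open>exp (m * f x)\<close> for Lipschitz \<open>f\<close>, and Gaussian smoothing does not leave
  it. Integrability questions are settled by membership.\<close>

definition exp_bounded :: "(real \<Rightarrow> real) \<Rightarrow> bool" where
  "exp_bounded g \<longleftrightarrow> g \<in> borel_measurable borel \<and> (\<exists>C a. 0 \<le> C \<and> 0 \<le> a \<and> (\<forall>x. \<bar>g x\<bar> \<le> C * exp (a * \<bar>x\<bar>)))"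

lemma exp_boundedI:
  assumes "g \<in> borel_measurable borel" "\<And>x. \<bar>g x\<bar> \<le> C * exp (a * \<bar>x\<bar>)"
  shows "exp_bounded g"
proof -
  have "\<bar>g x\<bar> \<le> \<bar>C\<bar> * exp (\<bar>a\<bar> * \<bar>x\<bar>)" for x
  proof -
    have "\<bar>g x\<bar> \<le> C * exp (a * \<bar>x\<bar>)" by fact
    also have "\<dots> \<le> \<bar>C\<bar> * exp (\<bar>a\<bar> * \<bar>x\<bar>)"
      by (intro mult_mono) (auto intro: mult_right_mono)
    finally show ?thesis .
  qed
  then show ?thesis unfolding exp_bounded_def using assms(1)
    by (intro conjI exI[of _ "\<bar>C\<bar>"] exI[of _ "\<bar>a\<bar>"]) auto
qed

lemma exp_bounded_measurable [measurable_dest]: "exp_bounded g \<Longrightarrow> g \<in> borel_measurable borel"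
  by (simp add: exp_bounded_def)

named_theorems exp_bounded_intros

lemma exp_bounded_bounded:
  assumes "g \<in> borel_measurable borel" "\<And>x. \<bar>g x\<bar> \<le> C"
  shows "exp_bounded g"
  by (rule exp_boundedI[of _ C 0]) (use assms in auto)

lemma exp_bounded_const [exp_bounded_intros]: "exp_bounded (\<lambda>_. c)"
  by (rule exp_bounded_bounded[of _ "\<bar>c\<bar>"]) auto

lemma exp_bounded_ident [exp_bounded_intros]: "exp_bounded (\<lambda>x. x)"
proof (rule exp_boundedI[of _ 1 1])
  show "\<bar>x\<bar> \<le> 1 * exp (1 * \<bar>x\<bar>)" for x :: real
    using exp_ge_add_one_self[of "\<bar>x\<bar>"] by (simp del: exp_ge_add_one_self)
qed simp

lemma exp_bounded_add [exp_bounded_intros]: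
  assumes "exp_bounded f" "exp_bounded g"
  shows "exp_bounded (\<lambda>x. f x + g x)"
proof -
  obtain C a where C: "0 \<le> C" "0 \<le> a" "\<And>x. \<bar>f x\<bar> \<le> C * exp (a * \<bar>x\<bar>)"
    using assms(1) unfolding exp_bounded_def by blast
  obtain D b where D: "0 \<le> D" "0 \<le> b" "\<And>x. \<bar>g x\<bar> \<le> D * exp (b * \<bar>x\<bar>)"
    using assms(2) unfolding exp_bounded_def by blast
  show ?thesis
  proof (rule exp_boundedI[of _ "C + D" "a + b"])
    fix x
    have "\<bar>f x + g x\<bar> \<le> C * exp (a * \<bar>x\<bar>) + D * exp (b * \<bar>x\<bar>)"
      using C(3)[of x] D(3)[of x] by linarith
    also have "\<dots> \<le> C * exp ((a + b) * \<bar>x\<bar>) + D * exp ((a + b) * \<bar>x\<bar>)"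
      using C D by (intro add_mono mult_left_mono) (auto intro: mult_right_mono)
    finally show "\<bar>f x + g x\<bar> \<le> (C + D) * exp ((a + b) * \<bar>x\<bar>)"
      by (simp add: algebra_simps)
  qed (use assms in measurable)
qed

lemma exp_bounded_mult [exp_bounded_intros]:
  assumes "exp_bounded f" "exp_bounded g"
  shows "exp_bounded (\<lambda>x. f x * g x)"
proof -
  obtain C a where C: "0 \<le> C" "0 \<le> a" "\<And>x. \<bar>f x\<bar> \<le> C * exp (a * \<bar>x\<bar>)"
    using assms(1) unfolding exp_bounded_def by blast
  obtain D b where D: "0 \<le> D" "0 \<le> b" "\<And>x. \<bar>g x\<bar> \<le> D * exp (b * \<bar>x\<bar>)"
    using assms(2) unfolding exp_bounded_def by blast
  show ?thesis
  proof (rule exp_boundedI[of _ "C * D" "a + b"])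
    fix x
    have "\<bar>f x * g x\<bar> \<le> (C * exp (a * \<bar>x\<bar>)) * (D * exp (b * \<bar>x\<bar>))"
      unfolding abs_mult using C D by (intro mult_mono) auto
    then show "\<bar>f x * g x\<bar> \<le> (C * D) * exp ((a + b) * \<bar>x\<bar>)"
      by (simp add: algebra_simps exp_add)
  qed (use assms in measurable)
qed

lemma exp_bounded_uminus [exp_bounded_intros]: "exp_bounded f \<Longrightarrow> exp_bounded (\<lambda>x. - f x)"
  using exp_bounded_mult[OF exp_bounded_const[of "-1"], of f] by simp

lemma exp_bounded_diff [exp_bounded_intros]:
  "exp_bounded f \<Longrightarrow> exp_bounded g \<Longrightarrow> exp_bounded (\<lambda>x. f x - g x)"
  using exp_bounded_add[OF _ exp_bounded_uminus, of f g] by simp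

lemma exp_bounded_abs [exp_bounded_intros]:
  assumes "exp_bounded f" shows "exp_bounded (\<lambda>x. \<bar>f x\<bar>)"
proof -
  obtain C a where "0 \<le> C" "0 \<le> a" "\<And>x. \<bar>f x\<bar> \<le> C * exp (a * \<bar>x\<bar>)"
    using assms(1) unfolding exp_bounded_def by blast
  then show ?thesis by (intro exp_boundedI[of _ C a]) (use assms in auto)
qed

lemma exp_bounded_power [exp_bounded_intros]:
  "exp_bounded f \<Longrightarrow> exp_bounded (\<lambda>x. f x ^ n)"
  by (induction n) (auto intro: exp_bounded_intros)

lemma exp_bounded_sum [exp_bounded_intros]:
  "(\<And>i. i \<in> I \<Longrightarrow> exp_bounded (f i)) \<Longrightarrow> exp_bounded (\<lambda>x. \<Sum>i\<in>I. f i x)"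
  by (induction I rule: infinite_finite_induct) (auto intro: exp_bounded_intros)

lemma exp_bounded_exp_lipschitz:
  assumes "\<And>x y. \<bar>f x - f y\<bar> \<le> L * \<bar>x - y\<bar>" "f \<in> borel_measurable borel"
  shows "exp_bounded (\<lambda>x. exp (m * f x))"
proof (rule exp_boundedI[of _ "exp \<bar>m * f 0\<bar>" "\<bar>m\<bar> * L"])
  fix x
  have "m * f x = m * f 0 + m * (f x - f 0)" by (simp add: algebra_simps)
  also have "\<dots> \<le> \<bar>m * f 0\<bar> + \<bar>m\<bar> * (L * \<bar>x\<bar>)"
  proof (intro add_mono)
    have "m * (f x - f 0) \<le> \<bar>m\<bar> * \<bar>f x - f 0\<bar>" by (simp add: abs_mult[symmetric])
    also have "\<dots> \<le> \<bar>m\<bar> * (L * \<bar>x\<bar>)" using assms(1)[of x 0] by (intro mult_left_mono) auto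
    finally show "m * (f x - f 0) \<le> \<bar>m\<bar> * (L * \<bar>x\<bar>)" .
  qed auto
  finally show "\<bar>exp (m * f x)\<bar> \<le> exp \<bar>m * f 0\<bar> * exp (\<bar>m\<bar> * L * \<bar>x\<bar>)"
    by (simp add: exp_add[symmetric] mult.assoc)
qed (use assms in measurable)

lemma exp_bounded_exp_abs [exp_bounded_intros]: "exp_bounded (\<lambda>x. exp (m * \<bar>x\<bar>))"
  by (rule exp_bounded_exp_lipschitz[of _ 1]) auto

lemma exp_bounded_exp_linear [exp_bounded_intros]: "exp_bounded (\<lambda>x. exp (m * x))"
  by (rule exp_bounded_exp_lipschitz[of _ 1]) auto

lemma exp_bounded_affine:
  assumes "exp_bounded g"
  shows "exp_bounded (\<lambda>z. g (x + z * b))"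
proof -
  obtain C a where C: "0 \<le> C" "0 \<le> a" "\<And>x. \<bar>g x\<bar> \<le> C * exp (a * \<bar>x\<bar>)"
    using assms(1) unfolding exp_bounded_def by blast
  show ?thesis
  proof (rule exp_boundedI[of _ "C * exp (a * \<bar>x\<bar>)" "a * \<bar>b\<bar>"])
    fix z
    have "\<bar>g (x + z * b)\<bar> \<le> C * exp (a * \<bar>x + z * b\<bar>)" by (rule C)
    also have "\<dots> \<le> C * exp (a * (\<bar>x\<bar> + \<bar>z\<bar> * \<bar>b\<bar>))"
      using C(1,2) abs_triangle_ineq[of x "z * b"]
      by (intro mult_left_mono) (auto simp: abs_mult intro: mult_left_mono)
    finally show "\<bar>g (x + z * b)\<bar> \<le> C * exp (a * \<bar>x\<bar>) * exp (a * \<bar>b\<bar> * \<bar>z\<bar>)"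
      by (simp add: exp_add[symmetric] algebra_simps)
  qed (use exp_bounded_measurable[OF assms] in measurable)
qed

lemma exp_bounded_shift: "exp_bounded g \<Longrightarrow> exp_bounded (\<lambda>z. g (z + s))"
  using exp_bounded_affine[of g s 1] by (simp add: add.commute)

section \<open>Integrability, translation and convolution of Gaussian laws\<close>

lemma std_normal_density_mult_exp:
  "std_normal_density x * exp (a * x) = exp (a\<^sup>2 / 2) * normal_density a 1 x"
  by (simp add: normal_density_def exp_add[symmetric] power2_eq_square field_simps)

lemma integrable_gauss_exp_abs: "integrable std_gaussian (\<lambda>z. exp (a * \<bar>z\<bar>))"
proof -
  have 1: "integrable std_gaussian (\<lambda>z. exp (b * z))" for b
    unfolding std_gaussian_def
    by (subst integrable_density) (auto simp: std_normal_density_mult_exp normal_density_nonneg)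
  have 2: "integrable std_gaussian (\<lambda>z. exp (a * z) + exp (- a * z))"
    by (intro Bochner_Integration.integrable_add 1)
  show ?thesis
  proof (rule Bochner_Integration.integrable_bound[OF 2])
    show "AE z in std_gaussian. norm (exp (a * \<bar>z\<bar>)) \<le> norm (exp (a * z) + exp (- a * z))"
    proof (rule AE_I2)
      fix z :: real
      have "norm (exp (a * z) + exp (- a * z)) = exp (a * z) + exp (- a * z)"
        unfolding real_norm_def by (intro abs_of_nonneg add_nonneg_nonneg exp_ge_zero)
      then show "norm (exp (a * \<bar>z\<bar>)) \<le> norm (exp (a * z) + exp (- a * z))"
        by (auto simp: abs_if)
    qed
  qed simp
qed

lemma exp_bounded_integrable:
  assumes "exp_bounded g" shows "integrable std_gaussian g"
proof -
  obtain C a where C: "0 \<le> C" "0 \<le> a" "\<And>x. \<bar>g x\<bar> \<le> C * exp (a * \<bar>x\<bar>)"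
    using assms(1) unfolding exp_bounded_def by blast
  show ?thesis
    by (rule Bochner_Integration.integrable_bound[where f="\<lambda>z. C * exp (a * \<bar>z\<bar>)"])
      (use C assms in \<open>auto intro!: integrable_gauss_exp_abs\<close>)
qed

text \<open>The Cameron-Martin formula: the exponential weight is the quotient of the Gaussian
  densities at \<open>z + s\<close> and \<open>z\<close>. It supplies the translated trial laws of
  the variational principle.\<close>

lemma gauss_integral_shift:
  assumes "exp_bounded g"
  shows "(LINT z|std_gaussian. g z) = (LINT z|std_gaussian. g (z + s) * exp (- s * z - s\<^sup>2 / 2))"
proof -
  have [measurable]: "g \<in> borel_measurable borel" using assms by measurable
  have "(LINT z|std_gaussian. g z) = (LINT z|lborel. std_normal_density z * g z)"
    unfolding std_gaussian_def by (subst integral_density) (auto simp: normal_density_nonneg)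
  also have "\<dots> = (LINT z|lborel. std_normal_density (s + 1 * z) * g (s + 1 * z))"
    by (subst lborel_integral_real_affine[of 1 _ s]) auto
  also have "\<dots> = (LINT z|lborel. std_normal_density z * (g (z + s) * exp (- s * z - s\<^sup>2 / 2)))"
  proof (rule Bochner_Integration.integral_cong[OF refl])
    fix z
    have "std_normal_density (s + 1 * z) = std_normal_density z * exp (- s * z - s\<^sup>2 / 2)"
      by (simp add: normal_density_def exp_add[symmetric] power2_eq_square field_simps)
    then show "std_normal_density (s + 1 * z) * g (s + 1 * z)
        = std_normal_density z * (g (z + s) * exp (- s * z - s\<^sup>2 / 2))"
      by (simp add: add.commute)
  qed
  also have "\<dots> = (LINT z|std_gaussian. g (z + s) * exp (- s * z - s\<^sup>2 / 2))"
    unfolding std_gaussian_def by (subst integral_density) (auto simp: normal_density_nonneg)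
  finally show ?thesis .
qed

lemma distr_std_gaussian:
  assumes "0 < v"
  shows "distr std_gaussian borel (\<lambda>z. z * sqrt v) = density lborel (normal_density 0 (sqrt v))"
proof -
  have "distributed std_gaussian lborel (\<lambda>z. z) std_normal_density"
    unfolding distributed_def std_gaussian_def
    by (auto intro!: distr_cong[THEN trans, OF refl _ _ distr_id2])
  from gauss.normal_density_affine[OF this, of "sqrt v" 0] assms
  have "distributed std_gaussian lborel (\<lambda>z. sqrt v * z) (normal_density 0 (sqrt v))" by simp
  moreover have "distr std_gaussian borel (\<lambda>z. z * sqrt v) = distr std_gaussian lborel (\<lambda>z. sqrt v * z)"
    by (rule distr_cong) (auto simp: mult.commute)
  ultimately show ?thesis by (simp add: distributed_def)
qed

text \<open>Variances of independent centered Gaussians add up. Both semigroup properties of a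
  Hopf-Cole step, for the value and for the tilted expectation, come from here.\<close>

lemma gauss_semigroup:
  assumes g: "exp_bounded g" and "0 < a" "0 < b"
  shows "(LINT z|std_gaussian. (LINT w|std_gaussian. g (x + z * sqrt a + w * sqrt b)))
    = (LINT z|std_gaussian. g (x + z * sqrt (a + b)))"
proof -
  have [measurable]: "g \<in> borel_measurable borel" using g by measurable
  define N where "N v = density lborel (normal_density 0 (sqrt v))" for v
  have setsN [measurable_cong]: "sets (N v) = sets borel" for v by (simp add: N_def)
  have int: "(LINT z|std_gaussian. h (z * sqrt v)) = (LINT y|N v. h y)"
    if "0 < v" "h \<in> borel_measurable borel" for v and h :: "real \<Rightarrow> real"
    unfolding N_def distr_std_gaussian[OF that(1), symmetric]
    by (subst integral_distr) (use that in auto)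
  have intable: "integrable (N v) h" if "0 < v" "exp_bounded h" for v h
    unfolding N_def distr_std_gaussian[OF that(1), symmetric]
    using exp_bounded_integrable[OF exp_bounded_affine[OF that(2), of 0 "sqrt v"]] that(2)
    by (subst integrable_distr_eq) auto
  have fin: "finite_measure (N v)" if "0 < v" for v
    unfolding N_def using prob_space_normal_density[of "sqrt v" 0] that
    by (simp add: prob_space.finite_measure)
  have conv: "N a \<star> N b = N (a + b)"
  proof -
    have "N a \<star> N b = density lborel (\<lambda>x. \<integral>\<^sup>+y. ennreal (normal_density 0 (sqrt a) (x - y)) *
        ennreal (normal_density 0 (sqrt b) y) \<partial>lborel)"
      using fin[OF \<open>0 < a\<close>] fin[OF \<open>0 < b\<close>] unfolding N_def by (intro convolution_density) auto
    also have "\<dots> = N (a + b)"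
      using conv_normal_density_zero_mean[of "sqrt a" "sqrt b"] assms
      by (simp add: ennreal_mult'[symmetric] normal_density_nonneg N_def)
    finally show ?thesis .
  qed
  interpret A: finite_measure "N a" by (rule fin) fact
  interpret B: finite_measure "N b" by (rule fin) fact
  interpret P: pair_sigma_finite "N a" "N b" ..
  have g': "exp_bounded (\<lambda>y. g (x + y))" using exp_bounded_shift[OF g, of x] by (simp add: add.commute)
  have "integrable (N (a + b)) (\<lambda>y. g (x + y))" using g' assms by (intro intable) auto
  then have i2: "integrable (N a \<Otimes>\<^sub>M N b) (\<lambda>(y, y'). g (x + y + y'))"
    unfolding conv[symmetric] convolution_def
    by (subst (asm) integrable_distr_eq) (auto simp: case_prod_beta' add.assoc)
  have "(LINT z|std_gaussian. (LINT w|std_gaussian. g (x + z * sqrt a + w * sqrt b)))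
      = (LINT z|std_gaussian. (LINT y'|N b. g (x + z * sqrt a + y')))"
    by (subst int[OF \<open>0 < b\<close>, of "\<lambda>y. g (_ + y)"]) auto
  also have "\<dots> = (LINT y|N a. (LINT y'|N b. g (x + y + y')))"
    by (subst int[OF \<open>0 < a\<close>, of "\<lambda>y. LINT y'|N b. g (x + y + y')"])
       (auto intro!: B.borel_measurable_lebesgue_integral)
  also have "\<dots> = (LINT p|(N a \<Otimes>\<^sub>M N b). (case p of (y, y') \<Rightarrow> g (x + y + y')))"
    using P.integral_fst'[OF i2] by simp
  also have "\<dots> = (LINT y|(N a \<star> N b). g (x + y))"
    unfolding convolution_def by (subst integral_distr) (auto simp: case_prod_beta' add.assoc)
  also have "\<dots> = (LINT z|std_gaussian. g (x + z * sqrt (a + b)))"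
    unfolding conv by (subst int[where h="\<lambda>y. g (x + y)"]) (use assms in auto)
  finally show ?thesis .
qed

lemma exp_bounded_gauss_smooth:
  assumes "exp_bounded g"
  shows "exp_bounded (\<lambda>x. LINT z|std_gaussian. g (x + z * b))"
proof -
  have [measurable]: "g \<in> borel_measurable borel" using assms by measurable
  obtain C a where C: "0 \<le> C" "0 \<le> a" "\<And>x. \<bar>g x\<bar> \<le> C * exp (a * \<bar>x\<bar>)"
    using assms(1) unfolding exp_bounded_def by blast
  show ?thesis
  proof (rule exp_boundedI[of _ "C * (LINT z|std_gaussian. exp ((a * \<bar>b\<bar>) * \<bar>z\<bar>))" a])
    fix x
    have "\<bar>LINT z|std_gaussian. g (x + z * b)\<bar> \<le> (LINT z|std_gaussian. \<bar>g (x + z * b)\<bar>)"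
      by (rule integral_abs_bound)
    also have "\<dots> \<le> (LINT z|std_gaussian. (C * exp (a * \<bar>x\<bar>)) * exp ((a * \<bar>b\<bar>) * \<bar>z\<bar>))"
    proof (rule integral_mono)
      fix z
      have "\<bar>g (x + z * b)\<bar> \<le> C * exp (a * \<bar>x + z * b\<bar>)" by (rule C)
      also have "\<dots> \<le> C * exp (a * (\<bar>x\<bar> + \<bar>z\<bar> * \<bar>b\<bar>))"
        using C(1,2) abs_triangle_ineq[of x "z * b"]
        by (intro mult_left_mono) (auto simp: abs_mult intro: mult_left_mono)
      finally show "\<bar>g (x + z * b)\<bar> \<le> (C * exp (a * \<bar>x\<bar>)) * exp ((a * \<bar>b\<bar>) * \<bar>z\<bar>)"
        by (simp add: exp_add[symmetric] algebra_simps)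
    qed (auto intro!: exp_bounded_integrable exp_bounded_intros exp_bounded_affine assms)
    finally show "\<bar>LINT z|std_gaussian. g (x + z * b)\<bar>
        \<le> C * (LINT z|std_gaussian. exp ((a * \<bar>b\<bar>) * \<bar>z\<bar>)) * exp (a * \<bar>x\<bar>)"
      by (simp add: ac_simps)
  qed simp
qed

section \<open>The Hopf-Cole step and its tilted expectation\<close>

lemma gauss_integral_pos:
  assumes "exp_bounded g" "\<And>z. 0 < g z"
  shows "0 < (LINT z|std_gaussian. g z)"
proof -
  have "(LINT z|std_gaussian. g z) \<noteq> 0"
  proof
    assume "(LINT z|std_gaussian. g z) = 0"
    then have "AE z in std_gaussian. g z = 0"
      using integral_nonneg_eq_0_iff_AE[OF exp_bounded_integrable[OF assms(1)]] assms(2)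
      by (auto simp: less_imp_le)
    then have "AE z in std_gaussian. False" by eventually_elim (use assms(2) in \<open>metis less_irrefl\<close>)
    then show False by simp
  qed
  moreover have "0 \<le> (LINT z|std_gaussian. g z)"
    by (intro integral_nonneg_AE) (auto intro: less_imp_le assms)
  ultimately show ?thesis by simp
qed

lemma gauss_integral_mono:
  assumes "exp_bounded f" "exp_bounded g" "\<And>z. f z \<le> g z"
  shows "(LINT z|std_gaussian. f z) \<le> (LINT z|std_gaussian. g z)"
  by (intro integral_mono exp_bounded_integrable assms)

definition lip1 :: "(real \<Rightarrow> real) \<Rightarrow> bool" where
  "lip1 f \<longleftrightarrow> (\<forall>x y. \<bar>f x - f y\<bar> \<le> \<bar>x - y\<bar>)"

lemma lip1D: "lip1 f \<Longrightarrow> \<bar>f x - f y\<bar> \<le> \<bar>x - y\<bar>"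
  by (simp add: lip1_def)

lemma lipschitz_borel:
  fixes f :: "real \<Rightarrow> real"
  assumes "\<And>x y. \<bar>f x - f y\<bar> \<le> L * \<bar>x - y\<bar>"
  shows "f \<in> borel_measurable borel"
proof -
  have "L \<ge> 0" using assms[of 1 0] by simp
  then have "L-lipschitz_on UNIV f"
    by (intro lipschitz_onI) (use assms in \<open>auto simp: dist_real_def\<close>)
  then show ?thesis
    by (intro borel_measurable_continuous_onI lipschitz_on_continuous_on)
qed

lemma lip1_measurable [measurable_dest]: "lip1 f \<Longrightarrow> f \<in> borel_measurable borel"
  by (rule lipschitz_borel[of _ 1]) (simp add: lip1_def)

lemma exp_bounded_exp_lip1: "lip1 f \<Longrightarrow> exp_bounded (\<lambda>x. exp (m * f x))"
  by (rule exp_bounded_exp_lipschitz[of _ 1]) (auto simp: lip1_def intro!: lip1_measurable)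

lemma exp_bounded_exp_lip1_affine: "lip1 f \<Longrightarrow> exp_bounded (\<lambda>z. exp (m * f (x + z * b)))"
  by (rule exp_bounded_affine[OF exp_bounded_exp_lip1])

lemma exp_bounded_lip1:
  assumes "lip1 f" shows "exp_bounded f"
proof -
  have "exp_bounded (\<lambda>x. f x - f 0)"
  proof (rule exp_boundedI[of _ 1 1])
    fix x
    have "\<bar>f x - f 0\<bar> \<le> \<bar>x\<bar>" using lip1D[OF assms, of x 0] by simp
    also have "\<dots> \<le> exp \<bar>x\<bar>" using exp_ge_add_one_self[of "\<bar>x\<bar>"] by (simp del: exp_ge_add_one_self)
    finally show "\<bar>f x - f 0\<bar> \<le> 1 * exp (1 * \<bar>x\<bar>)" by simp
  qed (use lip1_measurable[OF assms] in measurable)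
  from exp_bounded_add[OF this exp_bounded_const[of "f 0"]] show ?thesis by simp
qed

text \<open>For \<open>m \<noteq> 0\<close> the exponential of
  \<open>m * hopf_cole_step m v f x\<close> is the partition function, so \<open>tilt\<close> is the
  normalized Gibbs density with weight \<open>exp (m * f)\<close> relative to the Gaussian; for
  \<open>m = 0\<close> it is 1. The expectation \<open>twist\<close> under this law is one
  transition of the optimally controlled diffusion.\<close>

definition tilt :: "real \<Rightarrow> real \<Rightarrow> (real \<Rightarrow> real) \<Rightarrow> real \<Rightarrow> real \<Rightarrow> real" where
  "tilt m v f x z = exp (m * (f (x + z * sqrt v) - hopf_cole_step m v f x))"

definition twist :: "real \<Rightarrow> real \<Rightarrow> (real \<Rightarrow> real) \<Rightarrow> (real \<Rightarrow> real) \<Rightarrow> real \<Rightarrow> real" where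
  "twist m v f g x = (LINT z|std_gaussian. g (x + z * sqrt v) * tilt m v f x z)"

lemma tilt_pos: "0 < tilt m v f x z" by (simp add: tilt_def)

lemma exp_bounded_tilt [exp_bounded_intros]:
  assumes "lip1 f" shows "exp_bounded (tilt m v f x)"
proof -
  have "exp_bounded (\<lambda>z. exp (- m * hopf_cole_step m v f x) * exp (m * f (x + z * sqrt v)))"
    by (intro exp_bounded_intros exp_bounded_exp_lip1_affine[OF assms])
  then show ?thesis by (simp add: tilt_def[abs_def] exp_add[symmetric] algebra_simps)
qed

lemma exp_bounded_twist_integrand:
  assumes "lip1 f" "exp_bounded g"
  shows "exp_bounded (\<lambda>z. g (x + z * sqrt v) * tilt m v f x z)"
  by (rule exp_bounded_mult[OF exp_bounded_affine[OF assms(2)] exp_bounded_tilt[OF assms(1)]])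

lemma integrable_twist:
  assumes "lip1 f" "exp_bounded g"
  shows "integrable std_gaussian (\<lambda>z. g (x + z * sqrt v) * tilt m v f x z)"
  by (intro exp_bounded_integrable exp_bounded_twist_integrand assms)

lemma exp_hopf_cole_step:
  assumes "lip1 f"
  shows "exp (m * hopf_cole_step m v f x) = (if m = 0 then 1 else (LINT z|std_gaussian. exp (m * f (x + z * sqrt v))))"
proof -
  have "0 < (LINT z|std_gaussian. exp (m * f (x + z * sqrt v)))"
    by (intro gauss_integral_pos exp_bounded_exp_lip1_affine[OF assms]) auto
  then show ?thesis by (simp add: hopf_cole_step_def)
qed

lemma integral_tilt: "lip1 f \<Longrightarrow> (LINT z|std_gaussian. tilt m v f x z) = 1"
proof -
  assume f: "lip1 f"
  show ?thesis
  proof (cases "m = 0")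
    case True then show ?thesis by (simp add: tilt_def gauss.prob_space[simplified])
  next
    case False
    have "(LINT z|std_gaussian. tilt m v f x z)
        = (LINT z|std_gaussian. exp (m * f (x + z * sqrt v)) / exp (m * hopf_cole_step m v f x))"
      by (simp add: tilt_def right_diff_distrib exp_diff)
    also have "\<dots> = 1"
      using exp_hopf_cole_step[OF f, of m v x] False by simp (metis exp_not_eq_zero divide_self)
    finally show ?thesis .
  qed
qed

context
  fixes f :: "real \<Rightarrow> real"
  assumes f: "lip1 f"
begin

lemma twist_const: "twist m v f (\<lambda>_. k) x = k"
  by (simp add: twist_def integral_tilt[OF f])

lemma twist_add: "exp_bounded g \<Longrightarrow> exp_bounded h \<Longrightarrow>
    twist m v f (\<lambda>u. g u + h u) x = twist m v f g x + twist m v f h x"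
  by (simp add: twist_def distrib_right integrable_twist[OF f])

lemma twist_cmult: "twist m v f (\<lambda>u. k * g u) x = k * twist m v f g x"
  by (simp add: twist_def mult.assoc)

lemma twist_diff: "exp_bounded g \<Longrightarrow> exp_bounded h \<Longrightarrow>
    twist m v f (\<lambda>u. g u - h u) x = twist m v f g x - twist m v f h x"
  by (simp add: twist_def left_diff_distrib integrable_twist[OF f])

lemma twist_sum: "(\<And>i. i \<in> I \<Longrightarrow> exp_bounded (g i)) \<Longrightarrow>
    twist m v f (\<lambda>u. \<Sum>i\<in>I. g i u) x = (\<Sum>i\<in>I. twist m v f (g i) x)"
  by (induction I rule: infinite_finite_induct)
     (simp_all add: twist_add exp_bounded_sum twist_const)

lemma twist_mono: "exp_bounded g \<Longrightarrow> exp_bounded h \<Longrightarrow> (\<And>u. g u \<le> h u) \<Longrightarrow>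
    twist m v f g x \<le> twist m v f h x"
  unfolding twist_def
  by (intro gauss_integral_mono exp_bounded_twist_integrand f mult_right_mono less_imp_le[OF tilt_pos])

lemma twist_pos: "exp_bounded g \<Longrightarrow> (\<And>u. 0 < g u) \<Longrightarrow> 0 < twist m v f g x"
  unfolding twist_def
  by (intro gauss_integral_pos exp_bounded_twist_integrand f mult_pos_pos tilt_pos)

lemma twist_abs_le:
  assumes "exp_bounded g" "\<And>u. \<bar>g u\<bar> \<le> k"
  shows "\<bar>twist m v f g x\<bar> \<le> k"
proof -
  have "twist m v f g x \<le> twist m v f (\<lambda>_. k) x"
    by (rule twist_mono) (use assms in \<open>auto intro!: exp_bounded_intros simp: abs_le_iff\<close>)
  moreover have "twist m v f (\<lambda>_. - k) x \<le> twist m v f g x"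
    by (rule twist_mono) (use assms in \<open>auto intro!: exp_bounded_intros simp: abs_le_iff minus_le_iff\<close>)
  ultimately show ?thesis by (simp add: twist_const)
qed

lemma exp_bounded_twist:
  assumes "lip1 (hopf_cole_step m v f)" "exp_bounded g"
  shows "exp_bounded (twist m v f g)"
proof -
  have "exp_bounded (\<lambda>x. exp (- m * hopf_cole_step m v f x) *
      (LINT z|std_gaussian. g (x + z * sqrt v) * exp (m * f (x + z * sqrt v))))"
    using assms(2)
    by (intro exp_bounded_intros exp_bounded_exp_lip1[OF assms(1)] exp_bounded_exp_lip1[OF f]
        exp_bounded_gauss_smooth[of "\<lambda>u. g u * exp (m * f u)"])
  moreover have "twist m v f g x = exp (- m * hopf_cole_step m v f x) *
      (LINT z|std_gaussian. g (x + z * sqrt v) * exp (m * f (x + z * sqrt v)))" for x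
    unfolding twist_def tilt_def
    by (subst integral_mult_right_zero[symmetric])
       (simp add: exp_add[symmetric] right_diff_distrib mult.left_commute[of _ "g _"] add.commute)
  ultimately show ?thesis by presburger
qed

text \<open>The tangent line of \<open>exp\<close> at the tilted mean of \<open>g\<close> lies below
  \<open>exp\<close>; integrating it gives Jensen's inequality.\<close>

lemma twist_jensen_exp:
  assumes "exp_bounded g" "exp_bounded (\<lambda>u. exp (g u))"
  shows "exp (twist m v f g x) \<le> twist m v f (\<lambda>u. exp (g u)) x"
proof -
  define k where "k = twist m v f g x"
  have "twist m v f (\<lambda>u. exp k * (1 - k) + exp k * g u) x \<le> twist m v f (\<lambda>u. exp (g u)) x"
  proof (rule twist_mono)
    fix u
    have "exp k * (1 + (g u - k)) \<le> exp k * exp (g u - k)"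
      by (intro mult_left_mono exp_ge_add_one_self) auto
    then show "exp k * (1 - k) + exp k * g u \<le> exp (g u)"
      by (simp add: exp_diff algebra_simps)
  qed (intro exp_bounded_intros assms)+
  moreover have "twist m v f (\<lambda>u. exp k * (1 - k) + exp k * g u) x = exp k"
    by (subst twist_add) (auto intro!: exp_bounded_intros assms
      simp: twist_const twist_cmult k_def[symmetric] algebra_simps)
  ultimately show ?thesis by (simp add: k_def)
qed

lemma twist_variance:
  assumes "exp_bounded g"
  shows "twist m v f (\<lambda>u. (g u - twist m v f g x)\<^sup>2) x = twist m v f (\<lambda>u. (g u)\<^sup>2) x - (twist m v f g x)\<^sup>2"
proof -
  define k where "k = twist m v f g x"
  have "twist m v f (\<lambda>u. (g u - k)\<^sup>2) x = twist m v f (\<lambda>u. (g u)\<^sup>2 - (2 * k) * g u + k\<^sup>2) x"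
    by (simp add: power2_diff algebra_simps)
  also have "\<dots> = twist m v f (\<lambda>u. (g u)\<^sup>2) x - (2 * k) * k + k\<^sup>2"
    using assms by (simp add: twist_add twist_diff twist_const twist_cmult exp_bounded_intros k_def)
  finally show ?thesis unfolding k_def[symmetric] by (simp add: power2_eq_square)
qed

lemma twist_square_le:
  assumes "exp_bounded g"
  shows "(twist m v f g x)\<^sup>2 \<le> twist m v f (\<lambda>u. (g u)\<^sup>2) x"
proof -
  have "twist m v f (\<lambda>_. 0) x \<le> twist m v f (\<lambda>u. (g u - twist m v f g x)\<^sup>2) x"
    by (rule twist_mono) (auto intro!: exp_bounded_intros assms)
  then show ?thesis by (simp add: twist_variance[OF assms] twist_const)
qed

end

section \<open>Contraction and the variational principle for one step\<close>

lemma hopf_cole_step_lip1: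
  assumes f: "lip1 f" and "0 \<le> m"
  shows "lip1 (hopf_cole_step m v f)"
proof -
  have *: "hopf_cole_step m v f x \<le> hopf_cole_step m v f y + \<bar>x - y\<bar>" for x y
  proof -
    have le: "f (x + w) \<le> f (y + w) + \<bar>x - y\<bar>" for w
      using lip1D[OF f, of "x + w" "y + w"] by auto
    show ?thesis
    proof (cases "m = 0")
      case True
      have "(LINT z|std_gaussian. f (x + z * sqrt v)) \<le> (LINT z|std_gaussian. f (y + z * sqrt v) + \<bar>x - y\<bar>)"
        by (intro gauss_integral_mono exp_bounded_intros exp_bounded_affine[OF exp_bounded_lip1[OF f]] le)
      also have "\<dots> = (LINT z|std_gaussian. f (y + z * sqrt v)) + \<bar>x - y\<bar>"
        by (subst Bochner_Integration.integral_add)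
           (auto intro!: exp_bounded_integrable exp_bounded_affine[OF exp_bounded_lip1[OF f]] simp: gauss.prob_space[simplified])
      finally show ?thesis using True by (simp add: hopf_cole_step_def)
    next
      case False
      then have "0 < m" using assms by simp
      have "exp (m * hopf_cole_step m v f x) = (LINT z|std_gaussian. exp (m * f (x + z * sqrt v)))"
        using False by (simp add: exp_hopf_cole_step[OF f])
      also have "\<dots> \<le> (LINT z|std_gaussian. exp (m * \<bar>x - y\<bar>) * exp (m * f (y + z * sqrt v)))"
        using le \<open>0 < m\<close>
        by (intro gauss_integral_mono exp_bounded_intros exp_bounded_exp_lip1_affine[OF f])
           (auto simp: exp_add[symmetric] distrib_left[symmetric] add.commute[of "\<bar>x - y\<bar>"])
      also have "\<dots> = exp (m * (hopf_cole_step m v f y + \<bar>x - y\<bar>))"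
        using False by (simp add: exp_hopf_cole_step[OF f] distrib_left exp_add)
      finally show ?thesis using \<open>0 < m\<close> by simp
    qed
  qed
  show ?thesis unfolding lip1_def
  proof (intro allI)
    fix x y
    show "\<bar>hopf_cole_step m v f x - hopf_cole_step m v f y\<bar> \<le> \<bar>x - y\<bar>"
      using *[of x y] *[of y x] by (simp add: abs_minus_commute abs_le_iff)
  qed
qed

lemma lip1_shift: "lip1 f \<Longrightarrow> lip1 (\<lambda>u. f (u + d))"
  unfolding lip1_def by (metis add_diff_cancel_right)

text \<open>The Gibbs variational principle, with the tilted law translated by \<open>s\<close> as trial measure.\<close>

lemma hopf_cole_step_ge_twist:
  assumes f: "lip1 f" and F: "lip1 F" and "0 < m1" "0 < v"
  shows "hopf_cole_step m1 v F (x + d) \<ge> twist m v f (\<lambda>u. F (u + (d + s))) x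
    - 1 / m1 * (m * (twist m v f f x - hopf_cole_step m v f x)
        + s * twist m v f (\<lambda>u. u - x) x / v + s\<^sup>2 / (2 * v))"
proof -
  define T where "T = hopf_cole_step m v f x"
  \<comment> \<open>\<open>Y\<close> is \<open>m1 * F\<close> minus the logarithm of the trial
    density relative to the Gaussian: the term with \<open>m\<close> undoes the tilt, the last two
    terms come from the translation by \<open>s\<close>. Its tilted mean is the energy minus entropy
    of the trial law.\<close>
  define Y where "Y u = m1 * F (u + (d + s)) - m * (f u - T) - (s / v) * (u - x) - s\<^sup>2 / (2 * v)" for u
  have F': "lip1 (\<lambda>u. F (u + (d + s)))" by (rule lip1_shift[OF F])
  have eb [exp_bounded_intros]: "exp_bounded (\<lambda>u. m1 * F (u + (d + s)))" "exp_bounded (\<lambda>u. m * (f u - T))"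
    "exp_bounded (\<lambda>u. s / v * (u - x))" "exp_bounded (\<lambda>u. u - x)"
    by (intro exp_bounded_intros exp_bounded_lip1[OF f] exp_bounded_lip1[OF F'])+
  have ebY: "exp_bounded Y" unfolding Y_def by (intro exp_bounded_diff eb exp_bounded_const)
  have ebexpY: "exp_bounded (\<lambda>u. exp (Y u))"
  proof -
    have "exp_bounded (\<lambda>u. exp (m1 * F (u + (d + s))) * exp (- m * f u) * exp (- (s / v) * u)
        * exp (m * T + (s / v) * x - s\<^sup>2 / (2 * v)))"
      by (intro exp_bounded_intros exp_bounded_exp_lip1[OF f] exp_bounded_exp_lip1[OF F'])
    moreover have "Y u = m1 * F (u + (d + s)) + - m * f u + - (s / v) * u + (m * T + (s / v) * x - s\<^sup>2 / (2 * v))" for u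
      by (simp add: Y_def right_diff_distrib)
    ultimately show ?thesis by (simp only: exp_add)
  qed
  have "exp (m1 * hopf_cole_step m1 v F (x + d)) = (LINT z|std_gaussian. exp (m1 * F (x + d + z * sqrt v)))"
    using assms by (simp add: exp_hopf_cole_step)
  also have "\<dots> = (LINT z|std_gaussian. exp (m1 * F (x + d + (z + s / sqrt v) * sqrt v))
      * exp (- (s / sqrt v) * z - (s / sqrt v)\<^sup>2 / 2))"
    by (rule gauss_integral_shift) (rule exp_bounded_affine[OF exp_bounded_exp_lip1[OF F]])
  also have "\<dots> = twist m v f (\<lambda>u. exp (Y u)) x"
    unfolding twist_def
  proof (rule Bochner_Integration.integral_cong[OF refl])
    fix z
    have "(s / sqrt v)\<^sup>2 = s\<^sup>2 / v" "(z + s / sqrt v) * sqrt v = z * sqrt v + s"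
      using \<open>0 < v\<close> by (auto simp: power_divide field_simps)
    moreover have "s / sqrt v * z = s / v * (z * sqrt v)"
      using \<open>0 < v\<close> by (simp add: field_simps)
    ultimately show "exp (m1 * F (x + d + (z + s / sqrt v) * sqrt v))
      * exp (- (s / sqrt v) * z - (s / sqrt v)\<^sup>2 / 2) = exp (Y (x + z * sqrt v)) * tilt m v f x z"
      by (simp add: exp_add[symmetric] Y_def tilt_def T_def[symmetric] ac_simps)
  qed
  also have "\<dots> \<ge> exp (twist m v f Y x)"
    by (rule twist_jensen_exp[OF f ebY ebexpY])
  finally have "twist m v f Y x \<le> m1 * hopf_cole_step m1 v F (x + d)" by simp
  moreover have "twist m v f Y x = m1 * twist m v f (\<lambda>u. F (u + (d + s))) x - m * (twist m v f f x - T)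
      - (s / v) * twist m v f (\<lambda>u. u - x) x - s\<^sup>2 / (2 * v)"
    unfolding Y_def
    by (simp only: twist_diff[OF f] twist_cmult[OF f] twist_const[OF f] eb exp_bounded_diff
        exp_bounded_const exp_bounded_ident exp_bounded_lip1[OF f])
  ultimately show ?thesis using \<open>0 < m1\<close> by (simp add: T_def field_simps)
qed

text \<open>The Gaussian itself, neither tilted nor translated, serves as trial law.\<close>

lemma hopf_cole_step_ge_mean:
  assumes f: "lip1 f" and "0 \<le> m" "0 < v"
  shows "(LINT z|std_gaussian. f (x + z * sqrt v)) \<le> hopf_cole_step m v f x"
proof (cases "m = 0")
  case False
  then have "0 < m" using assms by simp
  from hopf_cole_step_ge_twist[OF f f this \<open>0 < v\<close>, where m=0 and d=0 and s=0 and x=x]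
  show ?thesis by (simp add: twist_def tilt_def)
qed (simp add: hopf_cole_step_def)

text \<open>Differentiability with derivative \<open>c\<close> bounded by 1 and Lipschitz, in a derivative-free form.\<close>

definition c11 :: "real \<Rightarrow> (real \<Rightarrow> real) \<Rightarrow> (real \<Rightarrow> real) \<Rightarrow> bool" where
  "c11 L f c \<longleftrightarrow> (\<forall>x. \<bar>c x\<bar> \<le> 1) \<and> (\<forall>x y. \<bar>f y - f x - c x * (y - x)\<bar> \<le> L * (y - x)\<^sup>2)"

lemma c11_deriv:
  assumes "c11 L f c" shows "(f has_real_derivative c x) (at x)"
proof -
  have "((\<lambda>y. L * \<bar>y - x\<bar>) \<longlongrightarrow> L * \<bar>x - x\<bar>) (at x)" by (intro tendsto_intros)
  then have lim: "((\<lambda>y. L * \<bar>y - x\<bar>) \<longlongrightarrow> 0) (at x)" by simp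
  have "((\<lambda>y. (f y - f x) / (y - x) - c x) \<longlongrightarrow> 0) (at x)"
  proof (rule Lim_null_comparison[OF _ lim])
    show "\<forall>\<^sub>F y in at x. norm ((f y - f x) / (y - x) - c x) \<le> L * \<bar>y - x\<bar>"
      unfolding eventually_at_filter
    proof (intro always_eventually allI impI)
      fix y assume "y \<noteq> x"
      then have "norm ((f y - f x) / (y - x) - c x) = \<bar>f y - f x - c x * (y - x)\<bar> / \<bar>y - x\<bar>"
        by (simp add: diff_divide_distrib abs_divide[symmetric])
      also have "\<dots> \<le> L * (y - x)\<^sup>2 / \<bar>y - x\<bar>"
        using assms unfolding c11_def by (intro divide_right_mono) auto
      also have "\<dots> = L * \<bar>y - x\<bar>"
      proof -
        have "(y - x)\<^sup>2 = \<bar>y - x\<bar> * \<bar>y - x\<bar>" by (simp add: power2_eq_square)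
        then show ?thesis using \<open>y \<noteq> x\<close> by (simp del: abs_mult_self_eq)
      qed
      finally show "norm ((f y - f x) / (y - x) - c x) \<le> L * \<bar>y - x\<bar>" .
    qed
  qed
  then show ?thesis
    by (simp add: has_field_derivative_iff LIM_zero_iff)
qed

lemma c11_lip1:
  assumes "c11 L f c" shows "lip1 f"
  unfolding lip1_def
proof (intro allI)
  fix x y
  have "\<bar>f x - f y\<bar> \<le> 1 * \<bar>x - y\<bar>"
    using field_differentiable_bound[of UNIV f c 1 x y] c11_deriv[OF assms] assms
    by (simp add: c11_def)
  then show "\<bar>f x - f y\<bar> \<le> \<bar>x - y\<bar>" by simp
qed

text \<open>Expanding from \<open>x\<close> to \<open>y\<close> and back, the increments of
  \<open>f\<close> cancel and only the difference of the slopes remains, bounded by the two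
  remainders.\<close>

lemma c11_deriv_lipschitz:
  assumes "c11 L f c" shows "\<bar>c x - c y\<bar> \<le> 2 * L * \<bar>x - y\<bar>"
proof (cases "x = y")
  case False
  have "(c x - c y) * (y - x) = - (f x - f y - c y * (x - y)) - (f y - f x - c x * (y - x))"
    by (simp add: algebra_simps)
  then have "\<bar>(c x - c y) * (y - x)\<bar> \<le> \<bar>- (f x - f y - c y * (x - y))\<bar> + \<bar>f y - f x - c x * (y - x)\<bar>"
    using abs_triangle_ineq4[of "- (f x - f y - c y * (x - y))" "f y - f x - c x * (y - x)"] by simp
  also have "\<dots> = \<bar>f x - f y - c y * (x - y)\<bar> + \<bar>f y - f x - c x * (y - x)\<bar>"
    by (simp only: abs_minus_cancel)
  also have "\<dots> \<le> L * (x - y)\<^sup>2 + L * (y - x)\<^sup>2"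
    using assms unfolding c11_def by (intro add_mono) auto
  also have "\<dots> = (2 * L * \<bar>x - y\<bar>) * \<bar>y - x\<bar>"
  proof -
    have "(x - y)\<^sup>2 = \<bar>x - y\<bar> * \<bar>x - y\<bar>" by (simp add: power2_eq_square)
    then show ?thesis unfolding power2_commute[of y x] abs_minus_commute[of y x] by simp
  qed
  finally show ?thesis using False by (simp add: abs_mult)
qed simp

lemma c11_deriv_bound: "c11 L f c \<Longrightarrow> \<bar>c x\<bar> \<le> 1" by (simp add: c11_def)

lemma c11_deriv_measurable: "c11 L f c \<Longrightarrow> c \<in> borel_measurable borel"
  by (rule lipschitz_borel) (rule c11_deriv_lipschitz)

lemma c11_exp_bounded: "c11 L f c \<Longrightarrow> exp_bounded c"
  by (rule exp_bounded_bounded[of _ 1]) (auto simp: c11_deriv_measurable c11_deriv_bound)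

section \<open>Smoothness and relative entropy of one step\<close>

lemma exp_le_quadratic:
  assumes "\<bar>t\<bar> \<le> 1" shows "exp t \<le> 1 + t + (t::real)\<^sup>2"
proof (cases "0 \<le> t")
  case True then show ?thesis using exp_bound[of t] assms by simp
next
  case False
  have "exp t = 1 / exp (-t)" by (simp add: exp_minus field_simps)
  also have "\<dots> \<le> 1 / (1 - t + t\<^sup>2 / 2)"
    using exp_lower_Taylor_quadratic[of "-t"] False
    by (intro divide_left_mono) (auto intro!: mult_pos_pos add_pos_nonneg)
  also have "\<dots> \<le> 1 + t + t\<^sup>2"
  proof -
    have "1 \<le> (1 + t + t\<^sup>2) * (1 - t + t\<^sup>2 / 2)"
    proof -
      have "(1 + t + t\<^sup>2) * (1 - t + t\<^sup>2 / 2) = 1 + t\<^sup>2 / 2 * (1 - t + t\<^sup>2)"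
        by (simp add: field_simps power2_eq_square)
      moreover have "0 \<le> t\<^sup>2 / 2 * (1 - t + t\<^sup>2)" using False by simp
      ultimately show ?thesis by linarith
    qed
    moreover have "0 < 1 - t + t\<^sup>2 / 2" using False by (intro add_pos_nonneg) auto
    ultimately show ?thesis by (simp add: divide_le_eq)
  qed
  finally show ?thesis .
qed

context
  fixes L :: real and f c :: "real \<Rightarrow> real" and m v :: real
  assumes c11: "c11 L f c" and L: "1 \<le> L" and m: "0 \<le> m" "m \<le> 1" and v: "0 < v"
begin

private lemma f: "lip1 f" by (rule c11_lip1[OF c11])

private lemmas eb_f = exp_bounded_lip1[OF f] exp_bounded_lip1[OF lip1_shift[OF f]] c11_exp_bounded[OF c11]

private lemma increment_ge: "c u * h - L * h\<^sup>2 \<le> f (u + h) - f u"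
  and increment_le: "f (u + h) - f u \<le> c u * h + L * h\<^sup>2"
proof -
  have "\<bar>f (u + h) - f u - c u * ((u + h) - u)\<bar> \<le> L * ((u + h) - u)\<^sup>2"
    using c11 unfolding c11_def by blast
  then show "c u * h - L * h\<^sup>2 \<le> f (u + h) - f u" "f (u + h) - f u \<le> c u * h + L * h\<^sup>2"
    by (auto simp: abs_le_iff)
qed

private lemma hopf_cole_step_increment:
  "exp (m * (hopf_cole_step m v f (x + h) - hopf_cole_step m v f x))
    = twist m v f (\<lambda>u. exp (m * (f (u + h) - f u))) x"
  if "m \<noteq> 0"
proof -
  have "exp (m * (hopf_cole_step m v f (x + h) - hopf_cole_step m v f x))
      = exp (- m * hopf_cole_step m v f x) * (LINT z|std_gaussian. exp (m * f (x + h + z * sqrt v)))"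
    using exp_hopf_cole_step[OF f, of m v "x + h"] that
    by (simp add: right_diff_distrib exp_diff exp_minus field_simps)
  also have "\<dots> = twist m v f (\<lambda>u. exp (m * (f (u + h) - f u))) x"
    unfolding twist_def
    by (subst integral_mult_right_zero[symmetric], rule Bochner_Integration.integral_cong[OF refl])
       (simp add: tilt_def exp_add[symmetric] algebra_simps)
  finally show ?thesis .
qed

text \<open>The increment of the step over \<open>h\<close> is the logarithm, divided by
  \<open>m\<close>, of the tilted mean of \<open>exp (m * (f (u + h) - f u))\<close>. Jensen gives
  the lower bound with the old constant; the upper bound pays for the second order of the
  exponential, at most \<open>m * h^2\<close>, and this is the 1 added to \<open>L\<close>.\<close>

lemma c11_step: "c11 (L + 1) (hopf_cole_step m v f) (twist m v f c)"
  unfolding c11_def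
proof (intro conjI allI)
  show c0: "\<bar>twist m v f c x\<bar> \<le> 1" for x
    by (rule twist_abs_le[OF f]) (use c11 in \<open>auto simp: c11_exp_bounded c11_deriv_bound\<close>)
  fix x y :: real
  define h where "h = y - x"
  define T where "T = hopf_cole_step m v f"
  define c0 where "c0 = twist m v f c x"
  have y: "y = x + h" by (simp add: h_def)
  have lipT: "lip1 T" unfolding T_def by (rule hopf_cole_step_lip1[OF f m(1)])
  have tw: "twist m v f (\<lambda>u. c u * h + k) x = h * c0 + k" for k
    by (simp add: twist_add[OF f] twist_cmult[OF f, of _ _ h] twist_const[OF f] exp_bounded_intros
        c11_exp_bounded[OF c11] c0_def mult.commute[of _ h])
  have tw1: "h * c0 - L * h\<^sup>2 \<le> twist m v f (\<lambda>u. f (u + h) - f u) x"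
    using tw[of "- (L * h\<^sup>2)"] increment_ge[of _ h]
    by (subst tw[of "- (L * h\<^sup>2)", simplified, symmetric], intro twist_mono[OF f])
       (auto intro!: exp_bounded_intros eb_f)
  have "\<bar>T (x + h) - T x - c0 * h\<bar> \<le> (L + 1) * h\<^sup>2"
  proof (cases "\<bar>h\<bar> \<le> 1")
    \<comment> \<open>For large \<open>h\<close> the Lipschitz bounds suffice, since 2 is at most
      \<open>L + 1\<close>. The expansion in the other case needs the exponent to lie in the range
      of \<open>exp_le_quadratic\<close>.\<close>
    case False
    have "\<bar>T (x + h) - T x - c0 * h\<bar> \<le> \<bar>T (x + h) - T x\<bar> + \<bar>c0 * h\<bar>" by linarith
    also have "\<dots> \<le> \<bar>h\<bar> + 1 * \<bar>h\<bar>"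
      using lip1D[OF lipT, of "x + h" x] c0[of x] unfolding abs_mult c0_def
      by (intro add_mono mult_right_mono) auto
    also have "\<dots> \<le> 2 * h\<^sup>2"
      using False mult_mono[of 1 "\<bar>h\<bar>" "\<bar>h\<bar>" "\<bar>h\<bar>"] by (simp add: power2_eq_square)
    also have "\<dots> \<le> (L + 1) * h\<^sup>2" using L by (intro mult_right_mono) auto
    finally show ?thesis .
  next
    case h1: True
    show ?thesis
    proof (cases "m = 0")
      case True
      have eq: "T (x + h) - T x = twist m v f (\<lambda>u. f (u + h) - f u) x"
        unfolding T_def twist_def hopf_cole_step_def using True
        by (simp add: tilt_def, subst Bochner_Integration.integral_diff[symmetric])
          (auto intro!: exp_bounded_integrable exp_bounded_affine[OF exp_bounded_lip1[OF f]] simp: ac_simps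
            exp_bounded_affine[OF eb_f(2), of h, simplified ac_simps])
      have "twist m v f (\<lambda>u. f (u + h) - f u) x \<le> h * c0 + L * h\<^sup>2"
        using increment_le[of _ h]
        by (subst tw[symmetric], intro twist_mono[OF f]) (auto intro!: exp_bounded_intros eb_f)
      with tw1 eq zero_le_power2[of h] show ?thesis
        unfolding abs_le_iff distrib_right mult.commute[of c0] mult_1 by linarith
    next
      case False
      then have mpos: "0 < m" using m by simp
      have eb1: "exp_bounded (\<lambda>u. exp (m * (f (u + h) - f u)))"
      proof -
        have "exp_bounded (\<lambda>u. exp (m * f (u + h)) * exp (- m * f u))"
          by (intro exp_bounded_intros exp_bounded_exp_lip1[OF f] exp_bounded_exp_lip1[OF lip1_shift[OF f]])
        then show ?thesis by (simp add: exp_add[symmetric] right_diff_distrib)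
      qed
      have lower: "m * (T (x + h) - T x) \<ge> m * (h * c0 - L * h\<^sup>2)"
      proof -
        have "exp (m * (T (x + h) - T x)) \<ge> exp (twist m v f (\<lambda>u. m * (f (u + h) - f u)) x)"
          unfolding T_def hopf_cole_step_increment[OF False]
          by (rule twist_jensen_exp[OF f _ eb1]) (intro exp_bounded_intros eb_f)
        then have "m * (T (x + h) - T x) \<ge> m * twist m v f (\<lambda>u. f (u + h) - f u) x"
          by (simp add: twist_cmult[OF f])
        moreover have "m * (h * c0 - L * h\<^sup>2) \<le> m * twist m v f (\<lambda>u. f (u + h) - f u) x"
          using tw1 m by (intro mult_left_mono) auto
        ultimately show ?thesis by linarith
      qed
      have upper: "m * (T (x + h) - T x) \<le> m * (h * c0 + (L + 1) * h\<^sup>2)"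
      proof -
        \<comment> \<open>The factor \<open>E\<close> takes up the Taylor remainder of
          \<open>f\<close>, so that only the linear part of the exponent is expanded.\<close>
        define E where "E = exp (m * L * h\<^sup>2)"
        have pt: "exp (m * (f (u + h) - f u)) \<le> E * ((c u * h) * m + (1 + m\<^sup>2 * h\<^sup>2))" for u
        proof -
          have ch: "\<bar>c u * h\<bar> \<le> \<bar>h\<bar>"
            using c11_deriv_bound[OF c11, of u] by (simp add: abs_mult mult_left_le_one_le)
          then have t1: "\<bar>m * (c u * h)\<bar> \<le> 1"
            using m h1 mult_mono[of m 1 "\<bar>c u * h\<bar>" 1] by (simp add: abs_mult)
          have "(c u * h)\<^sup>2 \<le> h\<^sup>2" using ch by (simp add: abs_le_square_iff)
          then have t2: "(m * (c u * h))\<^sup>2 \<le> m\<^sup>2 * h\<^sup>2"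
            unfolding power_mult_distrib[of m] by (intro mult_left_mono) auto
          have "exp (m * (f (u + h) - f u)) \<le> exp (m * (c u * h + L * h\<^sup>2))"
            using increment_le[of u h] m by (simp add: mult_left_mono)
          also have "\<dots> = E * exp (m * (c u * h))"
            by (simp add: E_def exp_add[symmetric] algebra_simps)
          also have "\<dots> \<le> E * (1 + m * (c u * h) + (m * (c u * h))\<^sup>2)"
            using exp_le_quadratic[OF t1] by (intro mult_left_mono) (auto simp: E_def)
          also have "\<dots> \<le> E * (1 + m * (c u * h) + m\<^sup>2 * h\<^sup>2)"
            using t2 by (intro mult_left_mono) (auto simp: E_def)
          finally show ?thesis by (simp add: algebra_simps)
        qed
        have "exp (m * (T (x + h) - T x)) = twist m v f (\<lambda>u. exp (m * (f (u + h) - f u))) x"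
          unfolding T_def by (rule hopf_cole_step_increment[OF False])
        also have "\<dots> \<le> twist m v f (\<lambda>u. E * ((c u * h) * m + (1 + m\<^sup>2 * h\<^sup>2))) x"
          by (intro twist_mono[OF f] eb1 exp_bounded_intros eb_f pt)
        also have "\<dots> = E * (m * (h * c0) + (1 + m\<^sup>2 * h\<^sup>2))"
          using tw[of 0]
          by (simp add: twist_cmult[OF f] twist_add[OF f] twist_const[OF f] exp_bounded_intros eb_f
              mult.commute[of _ m])
        also have "\<dots> \<le> E * exp (m * (h * c0) + m\<^sup>2 * h\<^sup>2)"
          using exp_ge_add_one_self[of "m * (h * c0) + m\<^sup>2 * h\<^sup>2"]
          by (intro mult_left_mono) (auto simp: E_def simp del: exp_ge_add_one_self)
        also have "\<dots> = exp (m * (h * c0 + L * h\<^sup>2 + m * h\<^sup>2))"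
          by (simp add: E_def exp_add[symmetric] algebra_simps power2_eq_square)
        finally have "m * (T (x + h) - T x) \<le> m * (h * c0 + L * h\<^sup>2 + m * h\<^sup>2)" by simp
        also have "\<dots> \<le> m * (h * c0 + L * h\<^sup>2 + 1 * h\<^sup>2)"
          using m by (intro mult_left_mono add_left_mono mult_right_mono) auto
        finally show ?thesis by (simp add: algebra_simps)
      qed
      have "h * c0 - L * h\<^sup>2 \<le> T (x + h) - T x" "T (x + h) - T x \<le> h * c0 + (L + 1) * h\<^sup>2"
        using lower upper mpos by auto
      with zero_le_power2[of h] show ?thesis
        unfolding abs_le_iff distrib_right mult.commute[of c0] mult_1 by linarith
    qed
  qed
  then show "\<bar>hopf_cole_step m v f y - hopf_cole_step m v f x - twist m v f c x * (y - x)\<bar> \<le> (L + 1) * (y - x)\<^sup>2"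
    unfolding h_def T_def c0_def by simp
qed

text \<open>This is Gaussian integration by parts, obtained by comparing slopes instead of
  differentiating under the integral. A trial law translated by \<open>- h\<close> compensates the
  shift of the argument and bounds the step at \<open>x + h\<close> from below with slope
  \<open>b / (m * v)\<close>; \<open>c11_step\<close> bounds it from above with slope
  \<open>c0\<close>. As \<open>h\<close> may have either sign, the slopes agree.\<close>

lemma twist_displacement: "twist m v f (\<lambda>u. u - x) x = v * m * twist m v f c x"
proof (cases "m = 0")
  case True
  have "(LINT z|std_gaussian. z) = (LINT z|lborel. std_normal_density z * z ^ (2 * 0 + 1))"
    unfolding std_gaussian_def by (subst integral_density) (auto simp: normal_density_nonneg)
  also have "\<dots> = 0" by (rule integral_std_normal_moment_odd)
  finally show ?thesis using True by (simp add: twist_def tilt_def)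
next
  case False
  then have mpos: "0 < m" using m by simp
  define b where "b = twist m v f (\<lambda>u. u - x) x"
  define c0 where "c0 = twist m v f c x"
  define K where "K = L + 1 + 1 / (2 * m * v)"
  have K: "0 < K" using L mpos v by (simp add: K_def add_pos_nonneg)
  have main: "h * (b / (m * v) - c0) \<le> K * h\<^sup>2" for h
  proof -
    have "hopf_cole_step m v f (x + h) \<ge> twist m v f (\<lambda>u. f (u + (h + - h))) x
      - 1 / m * (m * (twist m v f f x - hopf_cole_step m v f x) + - h * b / v + (- h)\<^sup>2 / (2 * v))"
      unfolding b_def by (rule hopf_cole_step_ge_twist[OF f f mpos v])
    also have "twist m v f (\<lambda>u. f (u + (h + - h))) x
      - 1 / m * (m * (twist m v f f x - hopf_cole_step m v f x) + - h * b / v + (- h)\<^sup>2 / (2 * v))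
       = hopf_cole_step m v f x + h * b / (m * v) - h\<^sup>2 / (2 * m * v)"
      using mpos v by (simp add: field_simps)
    finally have 1: "hopf_cole_step m v f x + h * b / (m * v) - h\<^sup>2 / (2 * m * v) \<le> hopf_cole_step m v f (x + h)" .
    have "\<bar>hopf_cole_step m v f (x + h) - hopf_cole_step m v f x - c0 * ((x + h) - x)\<bar> \<le> (L + 1) * ((x + h) - x)\<^sup>2"
      using c11_step unfolding c11_def c0_def by blast
    then have "hopf_cole_step m v f (x + h) \<le> hopf_cole_step m v f x + c0 * h + (L + 1) * h\<^sup>2"
      by (simp add: abs_le_iff)
    with 1 show ?thesis by (simp add: K_def algebra_simps)
  qed
  define a where "a = b / (m * v) - c0"
  \<comment> \<open>The displacement \<open>a / (2 * K)\<close> is so small that the linear term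
    beats the quadratic one unless \<open>a = 0\<close>.\<close>
  have "a / (2 * K) * a \<le> K * (a / (2 * K))\<^sup>2" unfolding a_def by (rule main)
  then have "a\<^sup>2 \<le> a\<^sup>2 / 2" using K by (simp add: field_simps power2_eq_square)
  then have "a = 0" by simp
  then show ?thesis using mpos v by (simp add: a_def b_def c0_def field_simps)
qed

text \<open>The entropy of the tilted law is at least \<open>b^2 / (2 * v)\<close>, the entropy of
  the Gaussian with the same mean. The variational principle yields this for the function 0, whose
  value is 0, with the trial law moved back to mean \<open>x\<close>.\<close>

lemma gap_lower: "m * v * (twist m v f c x)\<^sup>2 / 2 \<le> twist m v f f x - hopf_cole_step m v f x"
proof (cases "m = 0")
  case True
  then show ?thesis by (simp add: twist_def tilt_def hopf_cole_step_def)
next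
  case False
  then have mpos: "0 < m" using m by simp
  define b where "b = twist m v f (\<lambda>u. u - x) x"
  have b: "b = v * m * twist m v f c x" unfolding b_def by (rule twist_displacement)
  have z: "lip1 (\<lambda>_. 0)" by (simp add: lip1_def)
  have "hopf_cole_step 1 v (\<lambda>_. 0) (x + 0) \<ge> twist m v f (\<lambda>u. 0) x
    - 1 / 1 * (m * (twist m v f f x - hopf_cole_step m v f x) + (- b) * b / v + (- b)\<^sup>2 / (2 * v))"
    unfolding b_def by (rule hopf_cole_step_ge_twist[OF f z _ v]) simp
  moreover have "hopf_cole_step 1 v (\<lambda>_. 0) (x + 0) = 0"
    by (simp add: hopf_cole_step_def gauss.prob_space[simplified])
  ultimately have "0 \<le> m * (twist m v f f x - hopf_cole_step m v f x) - b\<^sup>2 / (2 * v)"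
    using v by (simp add: twist_const[OF f] power2_eq_square field_simps)
  then have "m * (m * v * (twist m v f c x)\<^sup>2 / 2) \<le> m * (twist m v f f x - hopf_cole_step m v f x)"
    unfolding b using v by (simp add: power2_eq_square field_simps)
  then show ?thesis using mpos by simp
qed

end

text \<open>The normalization is bounded below by the Gaussian mean of \<open>f\<close>, and
  \<open>f\<close> is 1-Lipschitz, so \<open>f\<close> and \<open>x\<close> drop out. The bound is
  thus a common majorant for dominated convergence, and it exceeds 1 only by a term of order
  \<open>sqrt v\<close> for fixed \<open>z\<close>.\<close>

lemma tilt_le:
  assumes f: "lip1 f" and m: "0 \<le> m" "m \<le> 1" and v: "0 < v"
  shows "tilt m v f x z \<le> exp (sqrt v * (\<bar>z\<bar> + (LINT z|std_gaussian. \<bar>z\<bar>)))"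
proof -
  have "f x - (LINT z|std_gaussian. \<bar>z\<bar>) * sqrt v = (LINT z|std_gaussian. f x - \<bar>z\<bar> * sqrt v)"
    by (subst Bochner_Integration.integral_diff)
       (auto intro!: exp_bounded_integrable exp_bounded_intros simp: gauss.prob_space[simplified])
  also have "\<dots> \<le> (LINT z|std_gaussian. f (x + z * sqrt v))"
  proof (rule gauss_integral_mono)
    fix z
    have "\<bar>f x - f (x + z * sqrt v)\<bar> \<le> \<bar>z * sqrt v\<bar>" using lip1D[OF f, of x "x + z * sqrt v"] by simp
    also have "\<bar>z * sqrt v\<bar> = \<bar>z\<bar> * sqrt v" using v by (simp add: abs_mult)
    finally show "f x - \<bar>z\<bar> * sqrt v \<le> f (x + z * sqrt v)" by (simp add: abs_le_iff)
  qed (intro exp_bounded_intros exp_bounded_affine[OF exp_bounded_lip1[OF f]])+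
  also have "\<dots> \<le> hopf_cole_step m v f x" by (rule hopf_cole_step_ge_mean[OF f m(1) v])
  finally have 1: "f x - (LINT z|std_gaussian. \<bar>z\<bar>) * sqrt v \<le> hopf_cole_step m v f x" .
  have 2: "f (x + z * sqrt v) \<le> f x + \<bar>z\<bar> * sqrt v"
    using lip1D[OF f, of "x + z * sqrt v" x] v by (simp add: abs_mult abs_le_iff)
  have n: "0 \<le> sqrt v * (\<bar>z\<bar> + (LINT z|std_gaussian. \<bar>z\<bar>))"
    using v by (intro mult_nonneg_nonneg add_nonneg_nonneg integral_nonneg_AE) auto
  have "f (x + z * sqrt v) - hopf_cole_step m v f x \<le> sqrt v * (\<bar>z\<bar> + (LINT z|std_gaussian. \<bar>z\<bar>))"
    using 1 2 by (simp add: algebra_simps)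
  then have "m * (f (x + z * sqrt v) - hopf_cole_step m v f x) \<le> m * (sqrt v * (\<bar>z\<bar> + (LINT z|std_gaussian. \<bar>z\<bar>)))"
    using m by (intro mult_left_mono)
  also have "\<dots> \<le> 1 * (sqrt v * (\<bar>z\<bar> + (LINT z|std_gaussian. \<bar>z\<bar>)))"
    using m n by (intro mult_right_mono) auto
  finally show ?thesis by (simp add: tilt_def)
qed

lemma exp_le_cubic: "exp t \<le> 1 + t + t\<^sup>2 / 2 + \<bar>t\<bar> ^ 3 * exp \<bar>t\<bar>" for t :: real
proof -
  obtain s where s: "\<bar>s\<bar> \<le> \<bar>t\<bar>" "exp t = (\<Sum>k<3. t ^ k / fact k) + exp s / fact 3 * t ^ 3"
    using Maclaurin_exp_le[of t 3] by blast
  have "exp s / fact 3 * t ^ 3 \<le> \<bar>exp s / fact 3 * t ^ 3\<bar>" by (rule abs_ge_self)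
  also have "\<dots> = exp s / 6 * \<bar>t\<bar> ^ 3" by (simp add: abs_mult power_abs fact_numeral)
  also have "\<dots> \<le> exp \<bar>t\<bar> * \<bar>t\<bar> ^ 3"
  proof (rule mult_right_mono)
    have "exp s / 6 \<le> exp s" by simp
    also have "exp s \<le> exp \<bar>t\<bar>" using s(1) by simp
    finally show "exp s / 6 \<le> exp \<bar>t\<bar>" .
  qed simp
  finally show ?thesis unfolding s(2) by (simp add: eval_nat_numeral fact_numeral algebra_simps)
qed

text \<open>The gap is the relative entropy of the tilted law divided by \<open>m\<close>; to leading order it is the
  cost of a constant drift, and only the first-order smoothness of \<open>f\<close> enters the error.\<close>

lemma gap_upper:
  assumes L: "1 \<le> L"
  shows "\<exists>C\<ge>0. \<forall>f c m v x. c11 L f c \<longrightarrow> 0 \<le> m \<longrightarrow> m \<le> 1 \<longrightarrow> 0 < v \<longrightarrow> v \<le> V \<longrightarrow>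
    twist m v f f x - hopf_cole_step m v f x \<le> m * v * (twist m v f c x)\<^sup>2 / 2 + C * (v * sqrt v)"
proof -
  define \<mu> where "\<mu> = (LINT z|std_gaussian. \<bar>z\<bar>)"
  define B where "B z = exp (sqrt V * (\<bar>z\<bar> + \<mu>))" for z
  define M1 where "M1 = (LINT z|std_gaussian. \<bar>z\<bar> * B z)"
  define M2 where "M2 = (LINT z|std_gaussian. z\<^sup>2 * ((\<bar>z\<bar> + \<mu>) * B z))"
  define M3 where "M3 = (LINT z|std_gaussian. \<bar>z\<bar> ^ 3 * exp (sqrt V * \<bar>z\<bar>) * B z)"
  \<comment> \<open>Half of the cross term and of the square of the Taylor remainder of
    \<open>f\<close> is at most \<open>L + L^2\<close>; the 1 stands for the cubic remainder of
    \<open>exp\<close>. In \<open>C\<close> the three summands are the errors made in replacing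
    \<open>c x\<close> by the tilted mean, in the second moment, and in the third.\<close>
  define A where "A = L + L\<^sup>2 + 1"
  define C where "C = 2 * L * M1 + M2 / 2 + A * M3"
  have \<mu>: "0 \<le> \<mu>" unfolding \<mu>_def by (intro integral_nonneg_AE) auto
  have ebB: "exp_bounded B"
  proof -
    have "exp_bounded (\<lambda>z. exp (sqrt V * \<mu>) * exp (sqrt V * \<bar>z\<bar>))" by (intro exp_bounded_intros)
    then show ?thesis by (simp add: B_def[abs_def] exp_add[symmetric] algebra_simps)
  qed
  note ebi = exp_bounded_intros ebB
  have B0: "0 < B z" for z by (simp add: B_def)
  have M0: "0 \<le> M1" "0 \<le> M2" "0 \<le> M3"
    unfolding M1_def M2_def M3_def using \<mu> less_imp_le[OF B0]
    by (auto intro!: integral_nonneg_AE mult_nonneg_nonneg AE_I2)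
  have A0: "0 \<le> A" using L by (simp add: A_def)
  have C0: "0 \<le> C" using M0 A0 L by (simp add: C_def)
  have z2: "(LINT z|std_gaussian. z\<^sup>2) = 1"
  proof -
    have "(LINT z|std_gaussian. z\<^sup>2) = (LINT z|lborel. std_normal_density z * z ^ (2 * 1))"
      unfolding std_gaussian_def by (subst integral_density) (auto simp: normal_density_nonneg)
    also have "\<dots> = 1" by (subst integral_std_normal_moment_even) (simp add: fact_numeral)
    finally show ?thesis .
  qed
  have "twist m v f f x - hopf_cole_step m v f x \<le> m * v * (twist m v f c x)\<^sup>2 / 2 + C * (v * sqrt v)"
    if c11: "c11 L f c" and m: "0 \<le> m" "m \<le> 1" and v: "0 < v" "v \<le> V" for f c m v x
  proof (cases "m = 0")
    case True
    then show ?thesis using C0 v by (simp add: twist_def tilt_def hopf_cole_step_def)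
  next
    case False
    then have mpos: "0 < m" using m by simp
    have f: "lip1 f" by (rule c11_lip1[OF c11])
    define T where "T = hopf_cole_step m v f x"
    define g where "g u = f u - f x" for u
    define k where "k = c x"
    define c0 where "c0 = twist m v f c x"
    have ebg: "exp_bounded g" unfolding g_def by (intro exp_bounded_intros exp_bounded_lip1[OF f])
    have ebexpg: "exp_bounded (\<lambda>u. exp (- m * g u))"
    proof -
      have "lip1 g" using f by (simp add: lip1_def g_def)
      then show ?thesis by (rule exp_bounded_exp_lip1)
    qed
    have ebw: "exp_bounded (\<lambda>u. exp \<bar>u - x\<bar>)"
    proof -
      have "lip1 (\<lambda>u. \<bar>u - x\<bar>)" unfolding lip1_def by auto
      from exp_bounded_exp_lip1[OF this, of 1] show ?thesis by simp
    qed
    note ebi' = exp_bounded_intros ebg ebexpg ebw c11_exp_bounded[OF c11] exp_bounded_lip1[OF f]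
    have tilt_B: "tilt m v f x z \<le> B z" for z
    proof -
      have "tilt m v f x z \<le> exp (sqrt v * (\<bar>z\<bar> + \<mu>))" unfolding \<mu>_def by (rule tilt_le[OF f m v(1)])
      also have "\<dots> \<le> B z" unfolding B_def using v \<mu> by (auto intro!: mult_right_mono)
      finally show ?thesis .
    qed
    have w1: "twist m v f (\<lambda>u. \<bar>u - x\<bar>) x \<le> sqrt v * M1"
      unfolding twist_def M1_def
    proof (subst integral_mult_right_zero[symmetric], rule gauss_integral_mono)
      show "exp_bounded (\<lambda>z. \<bar>x + z * sqrt v - x\<bar> * tilt m v f x z)"
        by (intro exp_bounded_intros exp_bounded_tilt f)
      show "exp_bounded (\<lambda>z. sqrt v * (\<bar>z\<bar> * B z))" by (intro ebi)
      show "\<bar>x + z * sqrt v - x\<bar> * tilt m v f x z \<le> sqrt v * (\<bar>z\<bar> * B z)" for z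
        using mult_left_mono[OF tilt_B[of z], of "sqrt v * \<bar>z\<bar>"] v by (simp add: abs_mult ac_simps)
    qed
    \<comment> \<open>The coefficient of \<open>v\<close> must be exactly 1, as it produces the
      leading term. Hence the density is estimated here by 1 plus a term of order
      \<open>sqrt v\<close>, and not merely by \<open>B\<close>.\<close>
    have w2: "twist m v f (\<lambda>u. (u - x)\<^sup>2) x \<le> v + v * sqrt v * M2"
    proof -
      have "twist m v f (\<lambda>u. (u - x)\<^sup>2) x \<le> (LINT z|std_gaussian. v * z\<^sup>2 + (v * sqrt v) * (z\<^sup>2 * ((\<bar>z\<bar> + \<mu>) * B z)))"
        unfolding twist_def
      proof (rule gauss_integral_mono)
        show "exp_bounded (\<lambda>z. (x + z * sqrt v - x)\<^sup>2 * tilt m v f x z)"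
          by (intro exp_bounded_intros exp_bounded_tilt f)
        show "exp_bounded (\<lambda>z. v * z\<^sup>2 + v * sqrt v * (z\<^sup>2 * ((\<bar>z\<bar> + \<mu>) * B z)))" by (intro ebi)
        fix z
        define t where "t = sqrt v * (\<bar>z\<bar> + \<mu>)"
        have t0: "0 \<le> t" using v \<mu> by (simp add: t_def)
        have "tilt m v f x z \<le> exp t" unfolding \<mu>_def t_def by (rule tilt_le[OF f m v(1)])
        also have "exp t \<le> 1 + t * exp t"
        proof -
          have "(1 - t) * exp t \<le> exp (- t) * exp t"
            using exp_ge_add_one_self[of "- t"] by (intro mult_right_mono) auto
          then show ?thesis by (simp add: exp_add[symmetric] algebra_simps)
        qed
        also have "\<dots> \<le> 1 + t * B z"
          unfolding B_def t_def using v \<mu> by (intro add_left_mono mult_left_mono) (auto intro!: mult_right_mono)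
        finally have "z\<^sup>2 * v * tilt m v f x z \<le> z\<^sup>2 * v * (1 + t * B z)"
          using v by (intro mult_left_mono) auto
        then show "(x + z * sqrt v - x)\<^sup>2 * tilt m v f x z \<le> v * z\<^sup>2 + v * sqrt v * (z\<^sup>2 * ((\<bar>z\<bar> + \<mu>) * B z))"
          using v by (simp add: power_mult_distrib t_def algebra_simps)
      qed
      also have "\<dots> = v * (LINT z|std_gaussian. z\<^sup>2) + (v * sqrt v) * M2"
        unfolding M2_def
        by (subst Bochner_Integration.integral_add) (auto intro!: exp_bounded_integrable ebi)
      finally show ?thesis by (simp add: z2)
    qed
    have w3: "twist m v f (\<lambda>u. \<bar>u - x\<bar> ^ 3 * exp \<bar>u - x\<bar>) x \<le> v * sqrt v * M3"
      unfolding twist_def M3_def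
    proof (subst integral_mult_right_zero[symmetric], rule gauss_integral_mono)
      show "exp_bounded (\<lambda>z. \<bar>x + z * sqrt v - x\<bar> ^ 3 * exp \<bar>x + z * sqrt v - x\<bar> * tilt m v f x z)"
        by (rule exp_bounded_twist_integrand[OF f]) (intro ebi')
      show "exp_bounded (\<lambda>z. v * sqrt v * (\<bar>z\<bar> ^ 3 * exp (sqrt V * \<bar>z\<bar>) * B z))" by (intro ebi)
      fix z
      have e: "exp (\<bar>z\<bar> * sqrt v) \<le> exp (sqrt V * \<bar>z\<bar>)" using v by (simp add: mult.commute mult_left_mono)
      have s3: "sqrt v ^ 3 = v * sqrt v" using v by (simp add: power3_eq_cube)
      have "\<bar>x + z * sqrt v - x\<bar> ^ 3 * exp \<bar>x + z * sqrt v - x\<bar> * tilt m v f x z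
          = v * sqrt v * (\<bar>z\<bar> ^ 3 * exp (\<bar>z\<bar> * sqrt v) * tilt m v f x z)"
        using v by (simp add: abs_mult power_mult_distrib s3)
      also have "\<dots> \<le> v * sqrt v * (\<bar>z\<bar> ^ 3 * exp (sqrt V * \<bar>z\<bar>) * B z)"
        using v e tilt_B[of z] tilt_pos[of m v f x z]
        by (intro mult_left_mono[of _ _ "v * sqrt v"] mult_mono) (auto intro: less_imp_le)
      finally show "\<bar>x + z * sqrt v - x\<bar> ^ 3 * exp \<bar>x + z * sqrt v - x\<bar> * tilt m v f x z
          \<le> v * sqrt v * (\<bar>z\<bar> ^ 3 * exp (sqrt V * \<bar>z\<bar>) * B z)" .
    qed
    have gw: "\<bar>g u\<bar> \<le> \<bar>u - x\<bar>" for u unfolding g_def by (rule lip1D[OF f])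
    have k1: "\<bar>k\<bar> \<le> 1" "k\<^sup>2 \<le> 1"
      using c11_deriv_bound[OF c11, of x] unfolding k_def by (auto simp: abs_square_le_1)
    have c01: "\<bar>c0\<bar> \<le> 1" unfolding c0_def
      by (rule twist_abs_le[OF f]) (use c11 in \<open>auto simp: c11_exp_bounded c11_deriv_bound\<close>)
    \<comment> \<open>The Taylor expansion produces the slope at \<open>x\<close>, the claim has the
      tilted mean of the slope; the Lipschitz bound on \<open>c\<close> makes them differ by order
      \<open>sqrt v\<close>.\<close>
    have kc: "k\<^sup>2 \<le> c0\<^sup>2 + 4 * L * sqrt v * M1"
    proof -
      have "c0 - k = twist m v f (\<lambda>u. c u - k) x"
        by (simp add: c0_def twist_diff[OF f] twist_const[OF f] c11_exp_bounded[OF c11] exp_bounded_const)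
      also have "\<bar>\<dots>\<bar> \<le> twist m v f (\<lambda>u. 2 * L * \<bar>u - x\<bar>) x"
      proof -
        have pt: "\<bar>c u - k\<bar> \<le> 2 * L * \<bar>u - x\<bar>" for u unfolding k_def by (rule c11_deriv_lipschitz[OF c11])
        have "twist m v f (\<lambda>u. c u - k) x \<le> twist m v f (\<lambda>u. 2 * L * \<bar>u - x\<bar>) x"
          using pt by (intro twist_mono[OF f] ebi') (auto simp: abs_le_iff)
        moreover have "twist m v f (\<lambda>u. - (c u - k)) x \<le> twist m v f (\<lambda>u. 2 * L * \<bar>u - x\<bar>) x"
          using pt by (intro twist_mono[OF f] ebi') (auto simp: abs_le_iff)
        moreover have "twist m v f (\<lambda>u. - (c u - k)) x = - twist m v f (\<lambda>u. c u - k) x"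
          using twist_cmult[OF f, of m v "-1" "\<lambda>u. c u - k" x] by (simp only: mult_minus1)
        ultimately show ?thesis by (simp add: abs_le_iff)
      qed
      also have "\<dots> \<le> 2 * L * (sqrt v * M1)"
        using w1 L by (subst twist_cmult[OF f]) (intro mult_left_mono, auto)
      finally have d: "\<bar>c0 - k\<bar> \<le> 2 * L * (sqrt v * M1)" .
      have "k\<^sup>2 - c0\<^sup>2 = (k + c0) * (k - c0)" by (simp add: power2_eq_square algebra_simps)
      also have "\<dots> \<le> \<bar>k + c0\<bar> * \<bar>k - c0\<bar>" by (metis abs_ge_self abs_mult)
      also have "\<dots> \<le> 2 * (2 * L * (sqrt v * M1))"
        using d k1 c01 by (intro mult_mono) (auto simp: abs_minus_commute)
      finally show ?thesis by simp
    qed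
    \<comment> \<open>The reciprocal of the density has tilted mean 1. This bounds the step value
      from below by an exponential moment of \<open>- m * g\<close>, so the gap is controlled by
      \<open>exp (- m * g) - 1 + m * g\<close>, which starts at second order in
      \<open>g\<close>.\<close>
    have "1 = twist m v f (\<lambda>u. exp (- m * (f u - T))) x"
      by (simp add: twist_def tilt_def T_def exp_add[symmetric] gauss.prob_space[simplified])
    also have "\<dots> = twist m v f (\<lambda>u. exp (m * (T - f x)) * exp (- m * g u)) x"
      by (simp add: exp_add[symmetric] g_def algebra_simps)
    also have "\<dots> = exp (m * (T - f x)) * twist m v f (\<lambda>u. exp (- m * g u)) x"
      by (rule twist_cmult[OF f])
    finally have "twist m v f (\<lambda>u. exp (- m * g u)) x = exp (- (m * (T - f x)))"
      by (metis exp_minus inverse_unique)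
    also have "\<dots> \<ge> 1 - m * (T - f x)" using exp_ge_add_one_self[of "- (m * (T - f x))"] by simp
    finally have y: "1 - m * (T - f x) \<le> twist m v f (\<lambda>u. exp (- m * g u)) x" .
    have twf: "twist m v f f x = twist m v f g x + f x"
      unfolding g_def by (simp add: twist_diff[OF f] twist_const[OF f] exp_bounded_lip1[OF f] exp_bounded_const)
    have "m * (twist m v f f x - T) \<le> twist m v f (\<lambda>u. exp (- m * g u)) x - 1 + m * twist m v f g x"
      using y by (simp add: twf algebra_simps)
    also have "\<dots> = twist m v f (\<lambda>u. exp (- m * g u) - 1 + m * g u) x"
      by (simp add: twist_add[OF f] twist_diff[OF f] twist_const[OF f] twist_cmult[OF f] ebi' ebexpg[simplified])
    also have "\<dots> \<le> twist m v f (\<lambda>u. m * (m * k\<^sup>2 / 2 * (u - x)\<^sup>2 + A * (\<bar>u - x\<bar> ^ 3 * exp \<bar>u - x\<bar>))) x"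
    proof (rule twist_mono[OF f])
      fix u
      define w where "w = u - x"
      define W where "W = \<bar>w\<bar> ^ 3 * exp \<bar>w\<bar>"
      have W0: "0 \<le> W" by (simp add: W_def)
      have g2: "(g u)\<^sup>2 \<le> k\<^sup>2 * w\<^sup>2 + (2 * L + L\<^sup>2) * W"
      proof -
        define r where "r = g u - k * w"
        have r: "\<bar>r\<bar> \<le> L * w\<^sup>2" using c11 unfolding c11_def r_def g_def k_def w_def by blast
        have "\<bar>k * w * r\<bar> \<le> 1 * \<bar>w\<bar> * (L * w\<^sup>2)"
          unfolding abs_mult using r k1 by (intro mult_mono) auto
        also have "1 * \<bar>w\<bar> * (L * w\<^sup>2) = L * \<bar>w\<bar> ^ 3" by (simp add: power2_eq_square power3_eq_cube)
        finally have 1: "k * w * r \<le> L * \<bar>w\<bar> ^ 3" by (simp only: abs_le_iff)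
        have "\<bar>r\<bar> ^ 2 \<le> (L * w\<^sup>2) ^ 2" using r by (intro power_mono) auto
        then have 2: "r\<^sup>2 \<le> L\<^sup>2 * (\<bar>w\<bar> ^ 3 * \<bar>w\<bar>)"
        proof -
          have "\<bar>w\<bar> ^ 3 * \<bar>w\<bar> = \<bar>w\<bar> ^ 4" by (simp add: power3_eq_cube power4_eq_xxxx)
          also have "\<dots> = (w\<^sup>2)\<^sup>2" by (simp add: power4_eq_xxxx power2_eq_square)
          finally show ?thesis using \<open>\<bar>r\<bar> ^ 2 \<le> (L * w\<^sup>2) ^ 2\<close> by (simp add: power_mult_distrib)
        qed
        have 3: "\<bar>w\<bar> ^ 3 \<le> W" unfolding W_def using mult_left_mono[of 1 "exp \<bar>w\<bar>" "\<bar>w\<bar> ^ 3"] by simp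
        have 4: "\<bar>w\<bar> ^ 3 * \<bar>w\<bar> \<le> W" unfolding W_def
          using exp_ge_add_one_self[of "\<bar>w\<bar>"] by (intro mult_left_mono) (auto simp del: exp_ge_add_one_self)
        have "(g u)\<^sup>2 = k\<^sup>2 * w\<^sup>2 + 2 * (k * w * r) + r\<^sup>2"
          by (simp add: r_def power2_eq_square algebra_simps)
        also have "\<dots> \<le> k\<^sup>2 * w\<^sup>2 + 2 * (L * W) + L\<^sup>2 * W"
        proof -
          have "0 \<le> L" "0 \<le> L\<^sup>2" using L by auto
          then show ?thesis using 1 2 mult_left_mono[OF 3, of L] mult_left_mono[OF 4, of "L\<^sup>2"] by linarith
        qed
        finally show ?thesis by (simp add: algebra_simps)
      qed
      have gu: "\<bar>g u\<bar> \<le> \<bar>w\<bar>" unfolding w_def by (rule gw)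
      have mg: "\<bar>- m * g u\<bar> \<le> m * \<bar>g u\<bar>" "m * \<bar>g u\<bar> \<le> \<bar>g u\<bar>"
        using m by (auto simp: abs_mult mult_left_le_one_le)
      have "\<bar>- m * g u\<bar> ^ 3 * exp \<bar>- m * g u\<bar> = m ^ 3 * \<bar>g u\<bar> ^ 3 * exp (m * \<bar>g u\<bar>)"
        using m by (simp add: abs_mult power_mult_distrib)
      also have "\<dots> \<le> m * \<bar>w\<bar> ^ 3 * exp \<bar>w\<bar>"
        using m mg(2) gu power_decreasing[of 1 3 m]
        by (intro mult_mono power_mono) auto
      finally have cub: "\<bar>- m * g u\<bar> ^ 3 * exp \<bar>- m * g u\<bar> \<le> m * W" by (simp add: W_def)
      have "exp (- m * g u) - 1 + m * g u \<le> (- m * g u)\<^sup>2 / 2 + m * W"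
        using exp_le_cubic[of "- m * g u"] cub by simp
      also have "\<dots> = m * (m * (g u)\<^sup>2 / 2 + W)" by (simp add: power2_eq_square algebra_simps)
      also have "\<dots> \<le> m * (m * (k\<^sup>2 * w\<^sup>2 + (2 * L + L\<^sup>2) * W) / 2 + W)"
        using g2 m by (intro mult_left_mono add_right_mono divide_right_mono) auto
      also have "\<dots> = m * (m * k\<^sup>2 / 2 * w\<^sup>2 + (m * ((2 * L + L\<^sup>2) / 2) + 1) * W)"
        by (simp add: algebra_simps)
      also have "\<dots> \<le> m * (m * k\<^sup>2 / 2 * w\<^sup>2 + A * W)"
      proof -
        have "m * ((2 * L + L\<^sup>2) / 2) \<le> 1 * ((2 * L + L\<^sup>2) / 2)"
          using m L by (intro mult_right_mono) auto
        also have "\<dots> \<le> L + L\<^sup>2" by simp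
        finally have "m * ((2 * L + L\<^sup>2) / 2) + 1 \<le> A" by (simp add: A_def)
        then show ?thesis using m W0 by (intro mult_left_mono add_left_mono mult_right_mono) auto
      qed
      finally show "exp (- m * g u) - 1 + m * g u
          \<le> m * (m * k\<^sup>2 / 2 * (u - x)\<^sup>2 + A * (\<bar>u - x\<bar> ^ 3 * exp \<bar>u - x\<bar>))"
        by (simp add: w_def W_def)
    qed (intro ebi')+
    also have "\<dots> = m * (m * k\<^sup>2 / 2 * twist m v f (\<lambda>u. (u - x)\<^sup>2) x
        + A * twist m v f (\<lambda>u. \<bar>u - x\<bar> ^ 3 * exp \<bar>u - x\<bar>) x)"
      by (simp only: twist_cmult[OF f] twist_add[OF f] ebi')
    finally have "twist m v f f x - T \<le> m * k\<^sup>2 / 2 * twist m v f (\<lambda>u. (u - x)\<^sup>2) x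
        + A * twist m v f (\<lambda>u. \<bar>u - x\<bar> ^ 3 * exp \<bar>u - x\<bar>) x"
      using mpos by simp
    also have "\<dots> \<le> m * k\<^sup>2 / 2 * (v + v * sqrt v * M2) + A * (v * sqrt v * M3)"
      using w2 w3 m A0 by (intro add_mono mult_left_mono) auto
    also have "\<dots> \<le> m * v * c0\<^sup>2 / 2 + C * (v * sqrt v)"
    proof -
      have vs: "0 \<le> v * sqrt v" using v by simp
      have 1: "m * k\<^sup>2 * v \<le> m * v * c0\<^sup>2 + 4 * L * M1 * (v * sqrt v)"
      proof -
        have "m * v * k\<^sup>2 \<le> m * v * (c0\<^sup>2 + 4 * L * sqrt v * M1)"
          using kc m v by (intro mult_left_mono) auto
        also have "\<dots> = m * v * c0\<^sup>2 + m * (4 * L * M1 * (v * sqrt v))" by (simp add: algebra_simps)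
        also have "\<dots> \<le> m * v * c0\<^sup>2 + 1 * (4 * L * M1 * (v * sqrt v))"
          using m L M0 vs by (intro add_left_mono mult_right_mono) auto
        finally show ?thesis by (simp add: ac_simps)
      qed
      have 2: "m * k\<^sup>2 * (v * sqrt v * M2) \<le> 1 * (v * sqrt v * M2)"
        using m k1 vs M0 mult_mono[of m 1 "k\<^sup>2" 1] by (intro mult_right_mono) auto
      show ?thesis using 1 2 by (simp add: C_def algebra_simps)
    qed
    finally show ?thesis by (simp add: T_def c0_def)
  qed
  then show ?thesis using C0 by blast
qed

section \<open>Composition of steps and dependence on the parameters\<close>

lemma hopf_cole_step_semigroup:
  assumes f: "lip1 f" and m: "0 \<le> m" and "0 < a" "0 < b"
  shows "hopf_cole_step m a (hopf_cole_step m b f) = hopf_cole_step m (a + b) f"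
proof
  fix x
  define f0 where "f0 = hopf_cole_step m b f"
  have f0: "lip1 f0" unfolding f0_def by (rule hopf_cole_step_lip1[OF f m])
  show "hopf_cole_step m a (hopf_cole_step m b f) x = hopf_cole_step m (a + b) f x"
  proof (cases "m = 0")
    case True
    then show ?thesis
      using gauss_semigroup[OF exp_bounded_lip1[OF f] assms(3,4), of x] by (simp add: hopf_cole_step_def)
  next
    case False
    have "exp (m * hopf_cole_step m a f0 x) = (LINT z|std_gaussian. exp (m * f0 (x + z * sqrt a)))"
      using False by (simp add: exp_hopf_cole_step[OF f0])
    also have "\<dots> = (LINT z|std_gaussian. LINT w|std_gaussian. exp (m * f (x + z * sqrt a + w * sqrt b)))"
      using False by (simp add: f0_def exp_hopf_cole_step[OF f])
    also have "\<dots> = exp (m * hopf_cole_step m (a + b) f x)"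
      using gauss_semigroup[OF exp_bounded_exp_lip1[OF f, of m] assms(3,4), of x] False
      by (simp add: exp_hopf_cole_step[OF f])
    finally show ?thesis using False by (simp add: f0_def)
  qed
qed

text \<open>The normalization of the inner tilt cancels against the weight of the outer one, leaving
  a single Gibbs weight on the sum of the two Gaussian increments. This is the Markov property
  inside an interval of constant level.\<close>

lemma twist_semigroup:
  assumes f: "lip1 f" and m: "0 \<le> m" and "0 < a" "0 < b" and g: "exp_bounded g"
  shows "twist m a (hopf_cole_step m b f) (twist m b f g) = twist m (a + b) f g"
proof
  fix x
  define f0 where "f0 = hopf_cole_step m b f"
  define k where "k = exp (- m * hopf_cole_step m (a + b) f x)"
  have "twist m a f0 (twist m b f g) x
      = (LINT z|std_gaussian. LINT w|std_gaussian. k * (g (x + z * sqrt a + w * sqrt b) * exp (m * f (x + z * sqrt a + w * sqrt b))))"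
    unfolding twist_def[of m a]
  proof (rule Bochner_Integration.integral_cong[OF refl])
    fix z
    show "twist m b f g (x + z * sqrt a) * tilt m a f0 x z
       = (LINT w|std_gaussian. k * (g (x + z * sqrt a + w * sqrt b) * exp (m * f (x + z * sqrt a + w * sqrt b))))"
      unfolding twist_def[of m b] f0_def
      by (subst integral_mult_left_zero[symmetric], rule Bochner_Integration.integral_cong[OF refl])
         (simp add: tilt_def k_def exp_add[symmetric] hopf_cole_step_semigroup[OF f m assms(3,4)] right_diff_distrib)
  qed
  also have "\<dots> = (LINT z|std_gaussian. k * (g (x + z * sqrt (a + b)) * exp (m * f (x + z * sqrt (a + b)))))"
    using gauss_semigroup[of "\<lambda>u. k * (g u * exp (m * f u))" a b x] assms
    by (simp add: exp_bounded_intros g exp_bounded_exp_lip1[OF f])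
  also have "\<dots> = twist m (a + b) f g x"
    unfolding twist_def
    by (rule Bochner_Integration.integral_cong[OF refl])
       (simp add: tilt_def k_def exp_add[symmetric] right_diff_distrib)
  finally show "twist m a (hopf_cole_step m b f) (twist m b f g) x = twist m (a + b) f g x" by (simp add: f0_def)
qed

text \<open>The delicate case is \<open>m = 0\<close> with \<open>M n > 0\<close>, where the two branches of the definition have to match.\<close>

lemma hopf_cole_step_tendsto:
  assumes F: "\<And>n. lip1 (F n)" and f: "lip1 f" and lim: "\<And>u. (\<lambda>n. F n u) \<longlonglongrightarrow> f u"
    and M: "\<And>n. 0 \<le> M n" "\<And>n. M n \<le> 1" "M \<longlonglongrightarrow> m" and v: "0 < v"
  shows "(\<lambda>n. hopf_cole_step (M n) v (F n) x) \<longlonglongrightarrow> hopf_cole_step m v f x"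
proof -
  have m: "0 \<le> m" "m \<le> 1" using M by (auto intro: LIMSEQ_le_const LIMSEQ_le_const2)
  obtain B where B: "\<And>n. \<bar>F n x\<bar> \<le> B"
    using convergent_imp_Bseq[OF convergentI[OF lim[of x]]] unfolding Bseq_def by auto
  define b where "b z = B + sqrt v * \<bar>z\<bar>" for z
  have Fb: "\<bar>F n (x + z * sqrt v)\<bar> \<le> b z" for n z
  proof -
    have "\<bar>F n (x + z * sqrt v) - F n x\<bar> \<le> \<bar>z * sqrt v\<bar>" using lip1D[OF F[of n], of "x + z * sqrt v" x] by simp
    moreover have "\<bar>z * sqrt v\<bar> = sqrt v * \<bar>z\<bar>" using v by (simp add: abs_mult)
    ultimately show ?thesis using B[of n] by (simp add: b_def abs_le_iff)
  qed
  have ebb: "exp_bounded b" "exp_bounded (\<lambda>z. exp (b z))"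
  proof -
    show "exp_bounded b" unfolding b_def by (intro exp_bounded_intros)
    have "exp_bounded (\<lambda>z. exp B * exp (sqrt v * \<bar>z\<bar>))" by (intro exp_bounded_intros)
    then show "exp_bounded (\<lambda>z. exp (b z))" by (simp add: b_def exp_add)
  qed
  have [measurable]: "F n \<in> borel_measurable borel" "f \<in> borel_measurable borel" for n
    using F f by auto
  have mean: "(\<lambda>n. LINT z|std_gaussian. F n (x + z * sqrt v)) \<longlonglongrightarrow> (LINT z|std_gaussian. f (x + z * sqrt v))"
    by (rule integral_dominated_convergence[where w=b])
       (use lim Fb in \<open>auto intro!: exp_bounded_integrable ebb\<close>)
  show ?thesis
  proof (cases "m = 0")
    case False
    then have mpos: "0 < m" using m by simp
    have I: "(\<lambda>n. LINT z|std_gaussian. exp (M n * F n (x + z * sqrt v)))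
        \<longlonglongrightarrow> (LINT z|std_gaussian. exp (m * f (x + z * sqrt v)))"
    proof (rule integral_dominated_convergence[where w="\<lambda>z. exp (b z)"])
      show "AE z in std_gaussian. (\<lambda>n. exp (M n * F n (x + z * sqrt v))) \<longlonglongrightarrow> exp (m * f (x + z * sqrt v))"
        by (intro AE_I2 tendsto_intros M lim)
      fix n
      show "AE z in std_gaussian. norm (exp (M n * F n (x + z * sqrt v))) \<le> exp (b z)"
      proof (rule AE_I2)
        fix z
        have "M n * F n (x + z * sqrt v) \<le> \<bar>M n * F n (x + z * sqrt v)\<bar>" by simp
        also have "\<dots> \<le> 1 * b z"
          unfolding abs_mult using M(1,2)[of n] Fb[of n z] by (intro mult_mono) auto
        finally show "norm (exp (M n * F n (x + z * sqrt v))) \<le> exp (b z)" by simp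
      qed
    qed (auto intro!: exp_bounded_integrable ebb)
    have pos: "0 < (LINT z|std_gaussian. exp (m * f (x + z * sqrt v)))"
      by (intro gauss_integral_pos exp_bounded_exp_lip1_affine[OF f]) auto
    have "(\<lambda>n. 1 / M n * ln (LINT z|std_gaussian. exp (M n * F n (x + z * sqrt v))))
        \<longlonglongrightarrow> 1 / m * ln (LINT z|std_gaussian. exp (m * f (x + z * sqrt v)))"
      using pos mpos by (intro tendsto_intros I M) auto
    moreover have "\<forall>\<^sub>F n in sequentially. 1 / M n * ln (LINT z|std_gaussian. exp (M n * F n (x + z * sqrt v)))
        = hopf_cole_step (M n) v (F n) x"
      using order_tendstoD(1)[OF M(3) mpos] by eventually_elim (simp add: hopf_cole_step_def)
    ultimately have "(\<lambda>n. hopf_cole_step (M n) v (F n) x)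
        \<longlonglongrightarrow> 1 / m * ln (LINT z|std_gaussian. exp (m * f (x + z * sqrt v)))"
      by (rule Lim_transform_eventually)
    then show ?thesis using False by (simp add: hopf_cole_step_def)
  next
    case True
    \<comment> \<open>For \<open>M n > 0\<close> the exponential exceeds its linearization by at
      most \<open>(M n)^2 * \<kappa> z\<close>. After taking the logarithm and dividing by
      \<open>M n\<close> the excess over the mean is at most \<open>M n * K\<close>, so the step is
      squeezed between two sequences with the same limit.\<close>
    define \<kappa> where "\<kappa> z = (b z)\<^sup>2 * (1 / 2 + b z * exp (b z))" for z
    define K where "K = (LINT z|std_gaussian. \<kappa> z)"
    have eb\<kappa>: "exp_bounded \<kappa>" unfolding \<kappa>_def by (intro exp_bounded_intros ebb)
    have b0: "0 \<le> b z" for z using Fb[of 0 z] by simp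
    have upper: "hopf_cole_step (M n) v (F n) x \<le> (LINT z|std_gaussian. F n (x + z * sqrt v)) + M n * K" for n
    proof (cases "M n = 0")
      case False
      then have Mpos: "0 < M n" using M(1)[of n] by simp
      have ebF: "exp_bounded (\<lambda>z. F n (x + z * sqrt v))"
        by (rule exp_bounded_affine[OF exp_bounded_lip1[OF F]])
      have pos: "0 < (LINT z|std_gaussian. exp (M n * F n (x + z * sqrt v)))"
        by (intro gauss_integral_pos exp_bounded_exp_lip1_affine[OF F]) auto
      have "ln (LINT z|std_gaussian. exp (M n * F n (x + z * sqrt v)))
          \<le> (LINT z|std_gaussian. exp (M n * F n (x + z * sqrt v))) - 1"
        by (rule ln_le_minus_one[OF pos])
      also have "\<dots> \<le> (LINT z|std_gaussian. 1 + M n * F n (x + z * sqrt v)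
          + (M n)\<^sup>2 * \<kappa> z) - 1"
      proof (intro diff_right_mono gauss_integral_mono)
        fix z
        define t where "t = F n (x + z * sqrt v)"
        have tb: "\<bar>t\<bar> \<le> b z" unfolding t_def by (rule Fb)
        have mt: "\<bar>M n * t\<bar> = M n * \<bar>t\<bar>" using Mpos by (simp add: abs_mult)
        have le1: "M n * \<bar>t\<bar> \<le> b z"
          using tb M(2)[of n] Mpos mult_mono[of "M n" 1 "\<bar>t\<bar>" "b z"] by simp
        have "exp (M n * t) \<le> 1 + M n * t + (M n * t)\<^sup>2 / 2 + \<bar>M n * t\<bar> ^ 3 * exp \<bar>M n * t\<bar>"
          by (rule exp_le_cubic)
        also have "\<bar>M n * t\<bar> ^ 3 * exp \<bar>M n * t\<bar> = (M n * t)\<^sup>2 * (\<bar>M n * t\<bar> * exp \<bar>M n * t\<bar>)"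
          by (simp add: power3_eq_cube power2_eq_square)
        also have "1 + M n * t + (M n * t)\<^sup>2 / 2 + (M n * t)\<^sup>2 * (\<bar>M n * t\<bar> * exp \<bar>M n * t\<bar>)
            = 1 + M n * t + (M n)\<^sup>2 * (t\<^sup>2 * (1 / 2 + \<bar>M n * t\<bar> * exp \<bar>M n * t\<bar>))"
          by (simp add: algebra_simps power2_eq_square)
        also have "\<dots> \<le> 1 + M n * t + (M n)\<^sup>2 * ((b z)\<^sup>2 * (1 / 2 + b z * exp (b z)))"
        proof (intro add_left_mono mult_left_mono mult_mono)
          show "t\<^sup>2 \<le> (b z)\<^sup>2" using tb by (metis abs_le_square_iff abs_of_nonneg b0)
        qed (use le1 mt b0 in \<open>auto intro!: add_nonneg_nonneg mult_nonneg_nonneg\<close>)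
        finally show "exp (M n * F n (x + z * sqrt v)) \<le> 1 + M n * F n (x + z * sqrt v)
          + (M n)\<^sup>2 * \<kappa> z" by (simp add: t_def \<kappa>_def)
      qed (intro exp_bounded_exp_lip1_affine[OF F] exp_bounded_intros ebF eb\<kappa>)+
      also have "\<dots> = M n * ((LINT z|std_gaussian. F n (x + z * sqrt v)) + M n * K)"
        unfolding K_def
        by (subst Bochner_Integration.integral_add, (intro exp_bounded_integrable exp_bounded_intros ebF eb\<kappa>)+,
            subst Bochner_Integration.integral_add, (intro exp_bounded_integrable exp_bounded_intros ebF eb\<kappa>)+)
           (simp add: gauss.prob_space[simplified] power2_eq_square algebra_simps)
      finally show ?thesis using Mpos by (simp add: hopf_cole_step_def field_simps)
    qed (simp add: hopf_cole_step_def)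
    have "(\<lambda>n. (LINT z|std_gaussian. F n (x + z * sqrt v)) + M n * K)
        \<longlonglongrightarrow> (LINT z|std_gaussian. f (x + z * sqrt v)) + m * K"
      by (intro tendsto_intros mean M)
    then have "(\<lambda>n. (LINT z|std_gaussian. F n (x + z * sqrt v)) + M n * K)
        \<longlonglongrightarrow> (LINT z|std_gaussian. f (x + z * sqrt v))" using True by simp
    from tendsto_sandwich[OF _ _ mean this, of "\<lambda>n. hopf_cole_step (M n) v (F n) x"]
    show ?thesis
      using upper hopf_cole_step_ge_mean[OF F M(1) v] True by (simp add: hopf_cole_step_def)
  qed
qed

lemma twist_tendsto:
  assumes F: "\<And>n. lip1 (F n)" and f: "lip1 f" and lim: "\<And>u. (\<lambda>n. F n u) \<longlonglongrightarrow> f u"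
    and M: "\<And>n. 0 \<le> M n" "\<And>n. M n \<le> 1" "M \<longlonglongrightarrow> m" and v: "0 < v"
    and [measurable]: "\<And>n. G n \<in> borel_measurable borel" "g \<in> borel_measurable borel"
    and Gk: "\<And>n u. \<bar>G n u\<bar> \<le> k" and G: "\<And>u. (\<lambda>n. G n u) \<longlonglongrightarrow> g u"
  shows "(\<lambda>n. twist (M n) v (F n) (G n) x) \<longlonglongrightarrow> twist m v f g x"
  unfolding twist_def
proof (rule integral_dominated_convergence[where w="\<lambda>z. k * exp (sqrt v * (\<bar>z\<bar> + (LINT z|std_gaussian. \<bar>z\<bar>)))"])
  have [measurable]: "F n \<in> borel_measurable borel" "f \<in> borel_measurable borel" for n
    using F f by auto
  show "(\<lambda>z. g (x + z * sqrt v) * tilt m v f x z) \<in> borel_measurable std_gaussian"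
    "\<And>n. (\<lambda>z. G n (x + z * sqrt v) * tilt (M n) v (F n) x z) \<in> borel_measurable std_gaussian"
    unfolding tilt_def by measurable
  show "integrable std_gaussian (\<lambda>z. k * exp (sqrt v * (\<bar>z\<bar> + (LINT z|std_gaussian. \<bar>z\<bar>))))"
    by (simp only: distrib_left exp_add) (intro exp_bounded_integrable exp_bounded_intros)
  show "AE z in std_gaussian. (\<lambda>n. G n (x + z * sqrt v) * tilt (M n) v (F n) x z)
      \<longlonglongrightarrow> g (x + z * sqrt v) * tilt m v f x z"
    unfolding tilt_def
    by (intro AE_I2 tendsto_intros M lim G hopf_cole_step_tendsto F f v)
  fix n
  show "AE z in std_gaussian. norm (G n (x + z * sqrt v) * tilt (M n) v (F n) x z)
      \<le> k * exp (sqrt v * (\<bar>z\<bar> + (LINT z|std_gaussian. \<bar>z\<bar>)))"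
    unfolding real_norm_def abs_mult
    using tilt_le[OF F M(1,2) v] less_imp_le[OF tilt_pos] order_trans[OF abs_ge_zero Gk]
    by (intro AE_I2 mult_mono Gk) (auto simp: abs_of_pos)
qed

text \<open>Both claims read off the second derivative \<open>1 - (tanh t)^2\<close>, the reciprocal
  of \<open>(cosh t)^2\<close>, in the Lagrange remainder: it is at most 1, and at least
  \<open>exp (- 2 * \<bar>t\<bar>)\<close> because \<open>cosh t\<close> is at most
  \<open>exp \<bar>t\<bar>\<close>.\<close>

lemma
  fixes x d :: real
  shows c11_ln_cosh: "c11 1 (\<lambda>x. ln (cosh x)) tanh"
    and ln_cosh_convexity: "ln (cosh (x + d)) \<ge> ln (cosh x) + tanh x * d + d\<^sup>2 / 2 * exp (- 2 * (\<bar>x\<bar> + \<bar>d\<bar>))"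
proof -
  have taylor: "\<exists>t. \<bar>t\<bar> \<le> \<bar>x\<bar> + \<bar>d\<bar> \<and> ln (cosh (x + d)) = ln (cosh x) + tanh x * d + (1 - (tanh t)\<^sup>2) / 2 * d\<^sup>2"
    for x d :: real
  proof (cases "d = 0")
    case False
    define D where "D k = (if k = 0 then (\<lambda>x::real. ln (cosh x)) else if k = 1 then tanh else (\<lambda>x. 1 - (tanh x)\<^sup>2))" for k :: nat
    have d0: "((\<lambda>x. ln (cosh x)) has_real_derivative tanh t) (at t)" for t :: real
      by (auto intro!: derivative_eq_intros simp: tanh_def)
    have d1: "(tanh has_real_derivative 1 - (tanh t)\<^sup>2) (at t)" for t :: real
      by (auto intro!: derivative_eq_intros)
    have der: "\<forall>k t. k < 2 \<and> min x (x + d) \<le> t \<and> t \<le> max x (x + d) \<longrightarrow> DERIV (D k) t :> D (Suc k) t"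
    proof (intro allI impI, elim conjE)
      fix k :: nat and t :: real
      assume "k < 2"
      then consider "k = 0" | "k = 1" by linarith
      then show "DERIV (D k) t :> D (Suc k) t"
        by cases (simp_all add: D_def d0 d1)
    qed
    obtain t where t: "if x + d < x then x + d < t \<and> t < x else x < t \<and> t < x + d"
      "ln (cosh (x + d)) = (\<Sum>k<2. D k x / fact k * (x + d - x) ^ k) + D 2 t / fact 2 * (x + d - x) ^ 2"
      using Taylor[of 2 D "\<lambda>x. ln (cosh x)" "min x (x + d)" "max x (x + d)" x "x + d"] der False
      by (auto simp: D_def)
    have "\<bar>t\<bar> \<le> \<bar>x\<bar> + \<bar>d\<bar>" using t(1) by (auto split: if_splits)
    moreover have "ln (cosh (x + d)) = ln (cosh x) + tanh x * d + (1 - (tanh t)\<^sup>2) / 2 * d\<^sup>2"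
      unfolding t(2) by (simp add: D_def eval_nat_numeral)
    ultimately show ?thesis by blast
  qed auto
  have sech_le: "1 - (tanh t)\<^sup>2 \<le> 1" "0 \<le> 1 - (tanh t)\<^sup>2" for t :: real
  proof -
    have "\<bar>tanh t\<bar> \<le> 1" using tanh_real_bounds[of t] by (auto simp: abs_le_iff)
    then show "1 - (tanh t)\<^sup>2 \<le> 1" "0 \<le> 1 - (tanh t)\<^sup>2" by (auto simp: abs_square_le_1)
  qed
  show "c11 1 (\<lambda>x. ln (cosh x)) tanh"
    unfolding c11_def
  proof (intro conjI allI)
    show "\<bar>tanh x\<bar> \<le> 1" for x :: real using tanh_real_bounds[of x] by (auto simp: abs_le_iff)
    fix x y :: real
    obtain t where "ln (cosh (x + (y - x))) = ln (cosh x) + tanh x * (y - x) + (1 - (tanh t)\<^sup>2) / 2 * (y - x)\<^sup>2"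
      using taylor[of x "y - x"] by blast
    then have "ln (cosh y) - ln (cosh x) - tanh x * (y - x) = (1 - (tanh t)\<^sup>2) / 2 * (y - x)\<^sup>2"
      by simp
    moreover have "0 \<le> (1 - (tanh t)\<^sup>2) / 2 * (y - x)\<^sup>2"
      using sech_le[of t] by (intro mult_nonneg_nonneg) auto
    ultimately have "\<bar>ln (cosh y) - ln (cosh x) - tanh x * (y - x)\<bar> = (1 - (tanh t)\<^sup>2) / 2 * (y - x)\<^sup>2"
      by (simp only: abs_of_nonneg)
    also have "\<dots> \<le> 1 * (y - x)\<^sup>2"
    proof (rule mult_right_mono)
      have "y / 2 \<le> 1" if "0 \<le> y" "y \<le> 1" for y :: real using that by linarith
      then show "(1 - (tanh t)\<^sup>2) / 2 \<le> 1" using sech_le[of t] by blast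
    qed simp
    finally show "\<bar>ln (cosh y) - ln (cosh x) - tanh x * (y - x)\<bar> \<le> 1 * (y - x)\<^sup>2" .
  qed
  obtain t where t: "\<bar>t\<bar> \<le> \<bar>x\<bar> + \<bar>d\<bar>"
    "ln (cosh (x + d)) = ln (cosh x) + tanh x * d + (1 - (tanh t)\<^sup>2) / 2 * d\<^sup>2"
    using taylor[of x d] by blast
  have "exp (- 2 * (\<bar>x\<bar> + \<bar>d\<bar>)) \<le> exp (- 2 * \<bar>t\<bar>)" using t(1) by simp
  also have "\<dots> \<le> 1 - (tanh t)\<^sup>2"
  proof -
    have "cosh t \<le> exp \<bar>t\<bar>" by (simp add: cosh_def) (smt (verit) exp_le_cancel_iff)
    then have "(cosh t)\<^sup>2 \<le> (exp \<bar>t\<bar>)\<^sup>2" by (intro power_mono) auto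
    then have "(cosh t)\<^sup>2 * exp (- 2 * \<bar>t\<bar>) \<le> 1"
      by (simp add: power2_eq_square exp_minus exp_add[symmetric] field_simps)
    moreover have "(cosh t)\<^sup>2 * (1 - (tanh t)\<^sup>2) = 1"
      using hyperbolic_pythagoras[of t] by (simp add: tanh_def right_diff_distrib power_divide)
    ultimately have "(cosh t)\<^sup>2 * exp (- 2 * \<bar>t\<bar>) \<le> (cosh t)\<^sup>2 * (1 - (tanh t)\<^sup>2)" by simp
    then show ?thesis by (simp add: mult_le_cancel_left)
  qed
  finally have "exp (- 2 * (\<bar>x\<bar> + \<bar>d\<bar>)) / 2 * d\<^sup>2 \<le> (1 - (tanh t)\<^sup>2) / 2 * d\<^sup>2"
    by (intro mult_right_mono) auto
  then show "ln (cosh (x + d)) \<ge> ln (cosh x) + tanh x * d + d\<^sup>2 / 2 * exp (- 2 * (\<bar>x\<bar> + \<bar>d\<bar>))"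
    unfolding t(2) by (simp add: mult.commute)
qed

section \<open>The Parisi flow of a step function\<close>

lemma AE_lborel_continuous_const:
  fixes g :: "real \<Rightarrow> real"
  assumes "AE z in lborel. g z = k" "continuous_on UNIV g"
  shows "g z = k"
proof (rule ccontr)
  assume "g z \<noteq> k"
  have "open {z. g z \<noteq> k}"
    using assms(2) by (intro open_Collect_neq) auto
  moreover have "{z. g z \<noteq> k} \<in> null_sets lborel"
    using assms(1) \<open>open {z. g z \<noteq> k}\<close> AE_iff_null[where P="\<lambda>z. g z = k" and M=lborel] by auto
  then have "negligible {z. g z \<noteq> k}"
    by (auto simp: negligible_iff_null_sets null_sets_completionI)
  ultimately show False using open_not_negligible[of "{z. g z \<noteq> k}"] \<open>g z \<noteq> k\<close> by auto
qed

text \<open>The set must contain the jumps but may contain more, so that several level functions can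
  share one set. A jump at \<open>q\<close> takes effect at \<open>q\<close> itself, as for
  distribution functions, and the value at 1 is left free.\<close>

definition step_function :: "(real \<Rightarrow> real) \<Rightarrow> real set \<Rightarrow> bool" where
  "step_function \<alpha> S \<longleftrightarrow> finite S \<and> S \<subseteq> {0..1} \<and> (\<forall>s. 0 \<le> \<alpha> s \<and> \<alpha> s \<le> 1) \<and>
    (\<forall>s t. 0 \<le> s \<longrightarrow> s < t \<longrightarrow> t < 1 \<longrightarrow> S \<inter> {s<..t} = {} \<longrightarrow> \<alpha> t = \<alpha> s)"

lemma step_functionD:
  assumes "step_function \<alpha> S"
  shows "finite S" "S \<subseteq> {0..1}" "0 \<le> \<alpha> s" "\<alpha> s \<le> 1"
    "0 \<le> s \<Longrightarrow> s < t \<Longrightarrow> t < 1 \<Longrightarrow> S \<inter> {s<..t} = {} \<Longrightarrow> \<alpha> t = \<alpha> s"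
  using assms by (auto simp: step_function_def)

lemma step_function_mono:
  "step_function \<alpha> S \<Longrightarrow> S \<subseteq> S' \<Longrightarrow> finite S' \<Longrightarrow> S' \<subseteq> {0..1} \<Longrightarrow> step_function \<alpha> S'"
  unfolding step_function_def by blast

definition next_jump :: "real set \<Rightarrow> real \<Rightarrow> real \<Rightarrow> real" where
  "next_jump S t s = Min {q \<in> S \<union> {t}. s < q \<and> q \<le> t}"

lemma next_jump:
  assumes "finite S" "s < t"
  shows "s < next_jump S t s" "next_jump S t s \<le> t" "S \<inter> {s<..<next_jump S t s} = {}"
    "next_jump S t s \<in> S \<union> {t}"
    "sorted_list_of_set {q \<in> S \<union> {t}. s < q \<and> q \<le> t}
      = next_jump S t s # sorted_list_of_set {q \<in> S \<union> {t}. next_jump S t s < q \<and> q \<le> t}"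
proof -
  define A where "A = {q \<in> S \<union> {t}. s < q \<and> q \<le> t}"
  have fin: "finite A" and ne: "A \<noteq> {}" using assms by (auto simp: A_def)
  have n: "next_jump S t s = Min A" by (simp add: next_jump_def A_def)
  have "Min A \<in> A" by (rule Min_in[OF fin ne])
  then show "s < next_jump S t s" "next_jump S t s \<le> t" "next_jump S t s \<in> S \<union> {t}"
    by (auto simp: n A_def)
  have le: "Min A \<le> q" if "q \<in> A" for q by (rule Min_le[OF fin that])
  show "S \<inter> {s<..<next_jump S t s} = {}"
  proof (rule ccontr)
    assume "S \<inter> {s<..<next_jump S t s} \<noteq> {}"
    then obtain q where q: "q \<in> S" "s < q" "q < Min A" by (auto simp: n)
    then have "q \<in> A" using \<open>next_jump S t s \<le> t\<close> by (simp add: A_def n)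
    then show False using le q by fastforce
  qed
  have "A - {Min A} = {q \<in> S \<union> {t}. Min A < q \<and> q \<le> t}"
    using le \<open>Min A \<in> A\<close> unfolding A_def by fastforce
  then show "sorted_list_of_set {q \<in> S \<union> {t}. s < q \<and> q \<le> t}
      = next_jump S t s # sorted_list_of_set {q \<in> S \<union> {t}. next_jump S t s < q \<and> q \<le> t}"
    using sorted_list_of_set_nonempty[OF fin ne] by (simp add: n A_def)
qed

lemma next_jump_eq:
  assumes "finite S" "s < u" "u \<le> t" "S \<inter> {s<..<u} = {}"
  shows "u \<le> next_jump S t s" "u < next_jump S t s \<Longrightarrow> next_jump S t u = next_jump S t s"
proof -
  have st: "s < t" using assms by simp
  note n = next_jump[OF assms(1) st]
  show "u \<le> next_jump S t s"
  proof (rule ccontr)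
    assume "\<not> u \<le> next_jump S t s"
    then have "next_jump S t s \<in> S \<inter> {s<..<u}" using n assms by auto
    then show False using assms by auto
  qed
  assume less: "u < next_jump S t s"
  have "{q \<in> S \<union> {t}. s < q \<and> q \<le> t} = {q \<in> S \<union> {t}. u < q \<and> q \<le> t}"
  proof (intro Collect_cong iffI; elim conjE)
    fix q assume q: "q \<in> S \<union> {t}" "s < q" "q \<le> t"
    have "next_jump S t s \<le> q"
    proof (rule ccontr)
      assume "\<not> next_jump S t s \<le> q"
      then have "q \<in> S \<inter> {s<..<next_jump S t s}" using q n(2) by auto
      then show False using n(3) by blast
    qed
    then show "q \<in> S \<union> {t} \<and> u < q \<and> q \<le> t" using q less by auto
  qed (use assms(2) in auto)
  then show "next_jump S t u = next_jump S t s" by (simp add: next_jump_def)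
qed

lemma next_jump_card:
  assumes "finite S" "s < t"
  shows "card {q \<in> S \<union> {t}. next_jump S t s < q \<and> q \<le> t} < card {q \<in> S \<union> {t}. s < q \<and> q \<le> t}"
proof -
  note n = next_jump[OF assms]
  have ps: "{q \<in> S \<union> {t}. next_jump S t s < q \<and> q \<le> t} \<subset> {q \<in> S \<union> {t}. s < q \<and> q \<le> t}"
  proof (rule psubsetI)
    show "{q \<in> S \<union> {t}. next_jump S t s < q \<and> q \<le> t} \<subseteq> {q \<in> S \<union> {t}. s < q \<and> q \<le> t}"
      using n(1) by auto
    have "next_jump S t s \<in> {q \<in> S \<union> {t}. s < q \<and> q \<le> t}" using n by blast
    moreover have "next_jump S t s \<notin> {q \<in> S \<union> {t}. next_jump S t s < q \<and> q \<le> t}" by simp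
    ultimately show "{q \<in> S \<union> {t}. next_jump S t s < q \<and> q \<le> t} \<noteq> {q \<in> S \<union> {t}. s < q \<and> q \<le> t}"
      by metis
  qed
  have "finite (S \<union> {t})" using assms(1) by blast
  then have "finite {q \<in> S \<union> {t}. s < q \<and> q \<le> t}" by (rule finite_subset[rotated]) blast
  from psubset_card_mono[OF this ps]
  show "card {q \<in> S \<union> {t}. next_jump S t s < q \<and> q \<le> t} < card {q \<in> S \<union> {t}. s < q \<and> q \<le> t}" .
qed

text \<open>Backward induction in time from \<open>t\<close>; the number of points still ahead of
  \<open>s\<close> decreases at each jump.\<close>

lemma next_jump_induct [consumes 3, case_names last step]:
  assumes "finite S" "0 \<le> s" "s \<le> t"
    and "P t"
    and step: "\<And>s. 0 \<le> s \<Longrightarrow> s < t \<Longrightarrow> P (next_jump S t s) \<Longrightarrow> P s"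
  shows "P s"
  using assms(2,3)
proof (induction "card {q \<in> S \<union> {t}. s < q \<and> q \<le> t}" arbitrary: s rule: less_induct)
  case less
  show ?case
  proof (cases "s = t")
    case True then show ?thesis using \<open>P t\<close> by simp
  next
    case False
    then have st: "s < t" using less.prems by simp
    note n = next_jump[OF assms(1) st]
    have "card {q \<in> S \<union> {t}. next_jump S t s < q \<and> q \<le> t} < card {q \<in> S \<union> {t}. s < q \<and> q \<le> t}"
      by (rule next_jump_card[OF assms(1) st])
    then have "P (next_jump S t s)"
      by (rule less.hyps) (use n less.prems in auto)
    then show ?thesis using step less.prems st by blast
  qed
qed

text \<open>What is used of \<xi>: its derivative is the variance accumulated up to time
  \<open>s\<close>. The rate may vanish at 0, which happens when \<open>\<gamma> 2 = 0\<close>, yet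
  the clock is strictly increasing, so no step has variance 0.\<close>

locale clock =
  fixes \<beta> :: real and \<gamma> :: "nat \<Rightarrow> real"
  assumes clock_0: "xi' \<beta> \<gamma> 0 = 0"
    and clock_deriv: "\<And>s. 0 \<le> s \<Longrightarrow> s \<le> 1 \<Longrightarrow> (xi' \<beta> \<gamma> has_real_derivative xi'' \<beta> \<gamma> s) (at s)"
    and rate_continuous: "continuous_on {0..1} (xi'' \<beta> \<gamma>)"
    and rate_0: "0 \<le> xi'' \<beta> \<gamma> 0"
    and rate_pos: "\<And>s. 0 < s \<Longrightarrow> s \<le> 1 \<Longrightarrow> 0 < xi'' \<beta> \<gamma> s"
begin

abbreviation "\<tau> \<equiv> xi' \<beta> \<gamma>"
abbreviation "\<rho> \<equiv> xi'' \<beta> \<gamma>"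

lemma rate_nonneg: "0 \<le> s \<Longrightarrow> s \<le> 1 \<Longrightarrow> 0 \<le> \<rho> s"
  using rate_0 rate_pos[of s] by (cases "s = 0") auto

lemma clock_strict_mono:
  assumes "0 \<le> s" "s < t" "t \<le> 1" shows "\<tau> s < \<tau> t"
proof (rule DERIV_pos_imp_increasing_open[OF assms(2)])
  show "\<exists>y. (\<tau> has_real_derivative y) (at x) \<and> 0 < y" if "s < x" "x < t" for x
    using clock_deriv[of x] rate_pos[of x] that assms by auto
  show "continuous_on {s..t} \<tau>"
  proof (rule DERIV_continuous_on)
    fix x assume "x \<in> {s..t}"
    then show "(\<tau> has_real_derivative \<rho> x) (at x within {s..t})"
      using assms by (intro has_field_derivative_at_within[OF clock_deriv]) auto
  qed
qed

lemma clock_mono: "0 \<le> s \<Longrightarrow> s \<le> t \<Longrightarrow> t \<le> 1 \<Longrightarrow> \<tau> s \<le> \<tau> t"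
  using clock_strict_mono[of s t] by (cases "s = t") auto

text \<open>\<open>Phi_atomic\<close> freed from the measure: the level function and the set of
  break points are independent arguments, so levels that are only limits, truncations or refinements
  can be treated alike.\<close>

definition phi :: "(real \<Rightarrow> real) \<Rightarrow> real set \<Rightarrow> real \<Rightarrow> real \<Rightarrow> real" where
  "phi \<alpha> S s x = hopf_cole \<beta> \<gamma> \<alpha> (sorted_list_of_set {q \<in> S \<union> {1}. s < q \<and> q \<le> 1}) s x"

definition dphi :: "(real \<Rightarrow> real) \<Rightarrow> real set \<Rightarrow> real \<Rightarrow> real \<Rightarrow> real" where
  "dphi \<alpha> S s = deriv (phi \<alpha> S s)"

lemma phi_1: "phi \<alpha> S 1 = (\<lambda>x. ln (cosh x))"
proof -
  have e: "{q \<in> S \<union> {1}. 1 < q \<and> q \<le> 1} = {}" by auto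
  show ?thesis unfolding phi_def[abs_def] e by (simp add: fun_eq_iff)
qed

lemma phi_next:
  assumes "finite S" "s < 1"
  shows "phi \<alpha> S s = hopf_cole_step (\<alpha> s) (\<tau> (next_jump S 1 s) - \<tau> s) (phi \<alpha> S (next_jump S 1 s))"
  unfolding phi_def[abs_def] next_jump(5)[OF assms] by (simp add: fun_eq_iff)

primrec kev_list :: "(real \<Rightarrow> real) \<Rightarrow> real set \<Rightarrow> real list \<Rightarrow> real \<Rightarrow> (real \<Rightarrow> real) \<Rightarrow> real \<Rightarrow> real" where
  "kev_list \<alpha> S [] s g = g"
| "kev_list \<alpha> S (b # bs) s g = twist (\<alpha> s) (\<tau> b - \<tau> s) (phi \<alpha> S b) (kev_list \<alpha> S bs b g)"

text \<open>The transition operator of the optimal diffusion of the control problem behind \<open>\<Phi>\<close>.\<close>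

definition kev :: "(real \<Rightarrow> real) \<Rightarrow> real set \<Rightarrow> real \<Rightarrow> real \<Rightarrow> (real \<Rightarrow> real) \<Rightarrow> real \<Rightarrow> real" where
  "kev \<alpha> S s t g = kev_list \<alpha> S (sorted_list_of_set {q \<in> S \<union> {t}. s < q \<and> q \<le> t}) s g"

lemma kev_refl: "kev \<alpha> S t t g = g"
proof -
  have e: "{q \<in> S \<union> {t}. t < q \<and> q \<le> t} = {}" by auto
  show ?thesis unfolding kev_def e by simp
qed

lemma kev_next:
  assumes "finite S" "s < t"
  shows "kev \<alpha> S s t g = twist (\<alpha> s) (\<tau> (next_jump S t s) - \<tau> s) (phi \<alpha> S (next_jump S t s)) (kev \<alpha> S (next_jump S t s) t g)"
  unfolding kev_def next_jump(5)[OF assms] by simp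

text \<open>In the notation of the control problem, \<open>energy \<alpha> S h s\<close> is \<open>E[(\<partial>\<^sub>x\<Phi>(s, X\<^sub>s))\<^sup>2]\<close> for the optimal
  diffusion started at \<open>h\<close>.\<close>

definition energy :: "(real \<Rightarrow> real) \<Rightarrow> real set \<Rightarrow> real \<Rightarrow> real \<Rightarrow> real" where
  "energy \<alpha> S h s = kev \<alpha> S 0 s (\<lambda>u. (dphi \<alpha> S s u)\<^sup>2) h"

end

lemma c11_mono: "c11 L f c \<Longrightarrow> L \<le> L' \<Longrightarrow> c11 L' f c"
  unfolding c11_def by (meson mult_right_mono order_trans zero_le_power2)

lemma c11_deriv_eq: "c11 L f c \<Longrightarrow> deriv f = c"
  using DERIV_imp_deriv[OF c11_deriv] by blast

section \<open>Regularity and energy of the flow of one step function\<close>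

locale parisi_flow = clock +
  fixes \<alpha> :: "real \<Rightarrow> real" and S :: "real set"
  assumes step_fun: "step_function \<alpha> S"
begin

lemma finite_S: "finite S" and S_sub: "S \<subseteq> {0..1}" and \<alpha>_nonneg: "0 \<le> \<alpha> s" and \<alpha>_le_1: "\<alpha> s \<le> 1"
  using step_functionD[OF step_fun] by auto

lemma \<alpha>_const: "0 \<le> s \<Longrightarrow> s < t \<Longrightarrow> t < 1 \<Longrightarrow> S \<inter> {s<..t} = {} \<Longrightarrow> \<alpha> t = \<alpha> s"
  by (rule step_functionD(5)[OF step_fun])

text \<open>The constant is 1 for \<open>ln cosh\<close> and grows by one with each Hopf-Cole step.
  Only the points of \<open>S\<close> count: it is uniform in time and does not change when the flow
  is evaluated along a finer partition.\<close>

definition "smoothness = real (card (S \<union> {1})) + 1"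

lemma smoothness_ge_1: "1 \<le> smoothness" by (simp add: smoothness_def)

lemma phi_c11:
  assumes "0 \<le> s" "s \<le> 1"
  shows "c11 smoothness (phi \<alpha> S s) (dphi \<alpha> S s)"
proof -
  have "c11 (real (card {q \<in> S \<union> {1}. s < q \<and> q \<le> 1}) + 1) (phi \<alpha> S s) (dphi \<alpha> S s)"
    using finite_S assms
  proof (induction rule: next_jump_induct)
    case last
    have e: "{q \<in> S \<union> {1}. 1 < q \<and> q \<le> 1} = {}" by auto
    show ?case unfolding e phi_1 dphi_def c11_deriv_eq[OF c11_ln_cosh] using c11_ln_cosh by simp
  next
    case (step s)
    define n where "n = next_jump S 1 s"
    note nj = next_jump[OF finite_S step(2), folded n_def]
    have eq: "phi \<alpha> S s = hopf_cole_step (\<alpha> s) (\<tau> n - \<tau> s) (phi \<alpha> S n)"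
      unfolding n_def by (rule phi_next[OF finite_S step(2)])
    have "c11 (real (card {q \<in> S \<union> {1}. n < q \<and> q \<le> 1}) + 1 + 1) (phi \<alpha> S s)
        (twist (\<alpha> s) (\<tau> n - \<tau> s) (phi \<alpha> S n) (dphi \<alpha> S n))"
      unfolding eq using step(3) clock_strict_mono[of s n] nj step(1)
      by (intro c11_step) (auto simp: \<alpha>_nonneg \<alpha>_le_1 n_def)
    moreover have "Suc (card {q \<in> S \<union> {1}. n < q \<and> q \<le> 1}) \<le> card {q \<in> S \<union> {1}. s < q \<and> q \<le> 1}"
      unfolding Suc_le_eq n_def by (rule next_jump_card[OF finite_S step(2)])
    ultimately have "c11 (real (card {q \<in> S \<union> {1}. s < q \<and> q \<le> 1}) + 1) (phi \<alpha> S s)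
        (twist (\<alpha> s) (\<tau> n - \<tau> s) (phi \<alpha> S n) (dphi \<alpha> S n))"
      by (elim c11_mono) linarith
    then show ?case using c11_deriv_eq by (metis dphi_def)
  qed
  moreover have "card {q \<in> S \<union> {1}. s < q \<and> q \<le> 1} \<le> card (S \<union> {1})"
    using finite_S by (intro card_mono) auto
  ultimately show ?thesis unfolding smoothness_def by (elim c11_mono) simp
qed

lemma phi_lip1: "0 \<le> s \<Longrightarrow> s \<le> 1 \<Longrightarrow> lip1 (phi \<alpha> S s)"
  using phi_c11 c11_lip1 by blast

lemma dphi_bound: "0 \<le> s \<Longrightarrow> s \<le> 1 \<Longrightarrow> \<bar>dphi \<alpha> S s x\<bar> \<le> 1"
  using phi_c11 c11_deriv_bound by blast

lemma exp_bounded_dphi: "0 \<le> s \<Longrightarrow> s \<le> 1 \<Longrightarrow> exp_bounded (dphi \<alpha> S s)"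
  using phi_c11 c11_exp_bounded by blast

text \<open>A step may stop anywhere before the next jump, since two steps at the same level
  compose. This permits partitions much finer than \<open>S\<close>.\<close>

lemma phi_step:
  assumes "0 \<le> s" "s < t" "t \<le> 1" "S \<inter> {s<..<t} = {}"
  shows "phi \<alpha> S s = hopf_cole_step (\<alpha> s) (\<tau> t - \<tau> s) (phi \<alpha> S t)"
proof -
  have s1: "s < 1" using assms by simp
  define n where "n = next_jump S 1 s"
  note nj = next_jump[OF finite_S s1, folded n_def]
  have tn: "t \<le> n" unfolding n_def by (rule next_jump_eq(1)[OF finite_S assms(2-4)])
  have eq: "phi \<alpha> S s = hopf_cole_step (\<alpha> s) (\<tau> n - \<tau> s) (phi \<alpha> S n)"
    unfolding n_def by (rule phi_next[OF finite_S s1])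
  show ?thesis
  proof (cases "t = n")
    case False
    then have less: "t < n" using tn by simp
    then have t1: "t < 1" using nj by simp
    have nt: "next_jump S 1 t = n" unfolding n_def
      by (rule next_jump_eq(2)[OF finite_S assms(2-4)]) (use less in \<open>simp add: n_def\<close>)
    have "\<alpha> t = \<alpha> s"
      by (rule \<alpha>_const) (use assms t1 nj less in auto)
    then have eqt: "phi \<alpha> S t = hopf_cole_step (\<alpha> s) (\<tau> n - \<tau> t) (phi \<alpha> S n)"
      using phi_next[OF finite_S t1, of \<alpha>] nt by simp
    have "0 < \<tau> t - \<tau> s" "0 < \<tau> n - \<tau> t"
      using clock_strict_mono[of s t] clock_strict_mono[of t n] assms less nj by auto
    from hopf_cole_step_semigroup[OF phi_lip1[of n] \<alpha>_nonneg[of s] this]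
    show ?thesis unfolding eq eqt using assms nj less by simp
  qed (use eq in simp)
qed

lemma dphi_step:
  assumes "0 \<le> s" "s < t" "t \<le> 1" "S \<inter> {s<..<t} = {}"
  shows "dphi \<alpha> S s = twist (\<alpha> s) (\<tau> t - \<tau> s) (phi \<alpha> S t) (dphi \<alpha> S t)"
  unfolding dphi_def[of \<alpha> S s] phi_step[OF assms]
  using clock_strict_mono[of s t] assms
  by (intro c11_deriv_eq[OF c11_step[OF phi_c11]]) (auto simp: smoothness_ge_1 \<alpha>_nonneg \<alpha>_le_1)

lemma exp_bounded_kev:
  assumes "0 \<le> s" "s \<le> t" "t \<le> 1" "exp_bounded g"
  shows "exp_bounded (kev \<alpha> S s t g)"
  using finite_S assms(1,2)
proof (induction rule: next_jump_induct)
  case (step s)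
  note nj = next_jump[OF finite_S step(2)]
  show ?case unfolding kev_next[OF finite_S step(2)]
    using nj step assms by (intro exp_bounded_twist hopf_cole_step_lip1 phi_lip1 \<alpha>_nonneg) auto
qed (simp add: kev_refl assms)

lemma kev_step:
  assumes "0 \<le> s" "s < t" "t \<le> u" "u \<le> 1" "S \<inter> {s<..<t} = {}" "exp_bounded g"
  shows "kev \<alpha> S s u g = twist (\<alpha> s) (\<tau> t - \<tau> s) (phi \<alpha> S t) (kev \<alpha> S t u g)"
proof -
  have su: "s < u" using assms by simp
  define n where "n = next_jump S u s"
  note nj = next_jump[OF finite_S su, folded n_def]
  have tn: "t \<le> n" unfolding n_def by (rule next_jump_eq(1)[OF finite_S assms(2,3,5)])
  have eq: "kev \<alpha> S s u g = twist (\<alpha> s) (\<tau> n - \<tau> s) (phi \<alpha> S n) (kev \<alpha> S n u g)"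
    unfolding n_def by (rule kev_next[OF finite_S su])
  show ?thesis
  proof (cases "t = n")
    case False
    then have less: "t < n" using tn by simp
    then have tu: "t < u" using nj by simp
    have nt: "next_jump S u t = n" unfolding n_def
      by (rule next_jump_eq(2)[OF finite_S assms(2,3,5)]) (use less in \<open>simp add: n_def\<close>)
    have al: "\<alpha> t = \<alpha> s"
      by (rule \<alpha>_const) (use assms tu nj less in auto)
    have eqt: "kev \<alpha> S t u g = twist (\<alpha> s) (\<tau> n - \<tau> t) (phi \<alpha> S n) (kev \<alpha> S n u g)"
      using kev_next[OF finite_S tu, of \<alpha>] nt al by simp
    have phit: "phi \<alpha> S t = hopf_cole_step (\<alpha> s) (\<tau> n - \<tau> t) (phi \<alpha> S n)"
      using phi_step[of t n] al assms less nj by (auto simp: disjoint_iff)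
    have "0 < \<tau> t - \<tau> s" "0 < \<tau> n - \<tau> t"
      using clock_strict_mono[of s t] clock_strict_mono[of t n] assms less nj by auto
    from twist_semigroup[OF phi_lip1[of n] \<alpha>_nonneg[of s] this exp_bounded_kev[of n u g]]
    show ?thesis unfolding eq eqt phit using assms nj less by simp
  qed (use eq in simp)
qed

lemma kev_compose:
  assumes "0 \<le> s" "s \<le> t" "t \<le> u" "u \<le> 1" "exp_bounded g"
  shows "kev \<alpha> S s u g = kev \<alpha> S s t (kev \<alpha> S t u g)"
  using finite_S assms(1,2)
proof (induction rule: next_jump_induct)
  case (step s)
  note nj = next_jump[OF finite_S step(2)]
  show ?case
    unfolding kev_next[OF finite_S step(2)] step(3)[symmetric]
    using nj step assms by (intro kev_step) auto
qed (simp add: kev_refl)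

lemma kev_mono:
  assumes "0 \<le> s" "s \<le> t" "t \<le> 1" "exp_bounded g" "exp_bounded h" "\<And>x. g x \<le> h x"
  shows "kev \<alpha> S s t g x \<le> kev \<alpha> S s t h x"
proof -
  have "\<forall>x. kev \<alpha> S s t g x \<le> kev \<alpha> S s t h x"
    using finite_S assms(1,2)
  proof (induction rule: next_jump_induct)
    case (step s)
    note nj = next_jump[OF finite_S step(2)]
    show ?case unfolding kev_next[OF finite_S step(2)]
      using nj step assms by (intro allI twist_mono exp_bounded_kev phi_lip1) auto
  qed (simp add: kev_refl assms)
  then show ?thesis by blast
qed

lemma kev_strict_mono:
  assumes "0 \<le> s" "s \<le> t" "t \<le> 1" "exp_bounded g" "exp_bounded h" "\<And>x. g x < h x"
  shows "kev \<alpha> S s t g x < kev \<alpha> S s t h x"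
proof -
  have "\<forall>x. kev \<alpha> S s t g x < kev \<alpha> S s t h x"
    using finite_S assms(1,2)
  proof (induction rule: next_jump_induct)
    case (step s)
    note nj = next_jump[OF finite_S step(2)]
    define n where "n = next_jump S t s"
    have n: "0 \<le> n" "n \<le> t" "n \<le> 1" using nj step assms by (auto simp: n_def)
    have eb: "exp_bounded (kev \<alpha> S n t g)" "exp_bounded (kev \<alpha> S n t h)"
      using n assms by (auto intro: exp_bounded_kev)
    show ?case
    proof
      fix x
      have "0 < twist (\<alpha> s) (\<tau> n - \<tau> s) (phi \<alpha> S n) (\<lambda>u. kev \<alpha> S n t h u - kev \<alpha> S n t g u) x"
        using step(3) n by (intro twist_pos phi_lip1 exp_bounded_diff eb) (auto simp: n_def)
      then show "kev \<alpha> S s t g x < kev \<alpha> S s t h x"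
        unfolding kev_next[OF finite_S step(2)] n_def[symmetric]
        by (simp add: twist_diff[OF phi_lip1[OF n(1,3)] eb(2,1)])
    qed
  qed (simp add: kev_refl assms)
  then show ?thesis by blast
qed

lemma kev_const:
  assumes "0 \<le> s" "s \<le> t" "t \<le> 1"
  shows "kev \<alpha> S s t (\<lambda>_. k) = (\<lambda>_. k)"
  using finite_S assms(1,2)
proof (induction rule: next_jump_induct)
  case (step s)
  note nj = next_jump[OF finite_S step(2)]
  show ?case unfolding kev_next[OF finite_S step(2)] step(3)
    using nj step assms by (intro ext twist_const phi_lip1) auto
qed (simp add: kev_refl)

text \<open>By \<open>dphi_step\<close> the slope is a martingale along the diffusion, so its square
  is a submartingale; the energy is therefore nondecreasing.\<close>

lemma kev_dphi_square:
  assumes "0 \<le> s" "s \<le> t" "t \<le> 1"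
  shows "(dphi \<alpha> S s x)\<^sup>2 \<le> kev \<alpha> S s t (\<lambda>u. (dphi \<alpha> S t u)\<^sup>2) x"
proof -
  have "\<forall>x. (dphi \<alpha> S s x)\<^sup>2 \<le> kev \<alpha> S s t (\<lambda>u. (dphi \<alpha> S t u)\<^sup>2) x"
    using finite_S assms(1,2)
  proof (induction rule: next_jump_induct)
    case (step s)
    note nj = next_jump[OF finite_S step(2)]
    define n where "n = next_jump S t s"
    have n: "0 \<le> n" "n \<le> t" "n \<le> 1" "s < n" "S \<inter> {s<..<n} = {}" using nj step assms by (auto simp: n_def)
    show ?case
    proof
      fix x
      have "(dphi \<alpha> S s x)\<^sup>2 \<le> twist (\<alpha> s) (\<tau> n - \<tau> s) (phi \<alpha> S n) (\<lambda>u. (dphi \<alpha> S n u)\<^sup>2) x"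
        unfolding dphi_step[OF step(1) n(4,3,5)] using n by (intro twist_square_le phi_lip1 exp_bounded_dphi)
      also have "\<dots> \<le> kev \<alpha> S s t (\<lambda>u. (dphi \<alpha> S t u)\<^sup>2) x"
        unfolding kev_next[OF finite_S step(2)] n_def[symmetric] using n step(3) assms
        by (intro twist_mono phi_lip1 exp_bounded_power exp_bounded_dphi exp_bounded_kev) (auto simp: n_def)
      finally show "(dphi \<alpha> S s x)\<^sup>2 \<le> kev \<alpha> S s t (\<lambda>u. (dphi \<alpha> S t u)\<^sup>2) x" .
    qed
  qed (simp add: kev_refl)
  then show ?thesis by blast
qed

lemma energy_mono:
  assumes "0 \<le> s" "s \<le> t" "t \<le> 1"
  shows "energy \<alpha> S h s \<le> energy \<alpha> S h t"
proof -
  have "energy \<alpha> S h t = kev \<alpha> S 0 s (kev \<alpha> S s t (\<lambda>u. (dphi \<alpha> S t u)\<^sup>2)) h"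
    unfolding energy_def using assms by (subst kev_compose[of 0 s t]) (auto intro!: exp_bounded_power exp_bounded_dphi)
  also have "\<dots> \<ge> energy \<alpha> S h s"
    unfolding energy_def using assms
    by (intro kev_mono kev_dphi_square exp_bounded_kev exp_bounded_power exp_bounded_dphi) auto
  finally show ?thesis .
qed

lemma energy_bounds:
  assumes "0 \<le> s" "s \<le> 1"
  shows "0 \<le> energy \<alpha> S h s" "energy \<alpha> S h s \<le> 1"
proof -
  have sq: "0 \<le> (dphi \<alpha> S s u)\<^sup>2" "(dphi \<alpha> S s u)\<^sup>2 \<le> 1" for u
    using dphi_bound[OF assms, of u] by (auto simp: abs_square_le_1)
  have "kev \<alpha> S 0 s (\<lambda>_. 0) h \<le> energy \<alpha> S h s" "energy \<alpha> S h s \<le> kev \<alpha> S 0 s (\<lambda>_. 1) h"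
    unfolding energy_def using assms sq
    by (auto intro!: kev_mono exp_bounded_power exp_bounded_dphi exp_bounded_const)
  then show "0 \<le> energy \<alpha> S h s" "energy \<alpha> S h s \<le> 1" using assms by (simp_all add: kev_const)
qed

text \<open>The bound holds for \<open>ln cosh\<close> and survives each step because a step
  dominates the Gaussian mean. It rules out affine flows and bounds the functional from
  below.\<close>

lemma phi_ge_abs:
  assumes "0 \<le> s" "s \<le> 1" shows "\<bar>x\<bar> - ln 2 \<le> phi \<alpha> S s x"
proof -
  have "\<forall>x. \<bar>x\<bar> - ln 2 \<le> phi \<alpha> S s x"
    using finite_S assms
  proof (induction rule: next_jump_induct)
    case last
    show ?case
    proof
      fix x :: real
      have "exp \<bar>x\<bar> / 2 \<le> cosh x" by (auto simp: cosh_def abs_if)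
      then have "ln (exp \<bar>x\<bar> / 2) \<le> ln (cosh x)" by (intro ln_mono) auto
      then show "\<bar>x\<bar> - ln 2 \<le> phi \<alpha> S 1 x" by (simp add: phi_1 ln_div)
    qed
  next
    case (step s)
    note nj = next_jump[OF finite_S step(2)]
    define n where "n = next_jump S 1 s"
    have n: "0 \<le> n" "n \<le> 1" "s < n" using nj step assms by (auto simp: n_def)
    show ?case
    proof
      fix x :: real
      have v: "0 < \<tau> n - \<tau> s" using clock_strict_mono[of s n] n step by simp
      have z: "(LINT z|std_gaussian. z) = 0"
        using twist_displacement[OF c11_ln_cosh, of 0 1 0] by (simp add: twist_def tilt_def)
      \<comment> \<open>The affine function \<open>sgn x * y\<close> lies below
        \<open>\<bar>y\<bar>\<close> and touches it at \<open>x\<close>; its Gaussian mean is its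
        value at the center.\<close>
      have "sgn x * x - ln 2 = (LINT z|std_gaussian. sgn x * (x + z * sqrt (\<tau> n - \<tau> s)) - ln 2)"
        by (subst Bochner_Integration.integral_diff)
           (auto intro!: exp_bounded_integrable exp_bounded_intros simp: gauss.prob_space[simplified] z distrib_left exp_bounded_integrable exp_bounded_ident)
      also have "\<dots> \<le> (LINT z|std_gaussian. phi \<alpha> S n (x + z * sqrt (\<tau> n - \<tau> s)))"
      proof (rule gauss_integral_mono)
        fix z
        have "sgn x * (x + z * sqrt (\<tau> n - \<tau> s)) \<le> \<bar>x + z * sqrt (\<tau> n - \<tau> s)\<bar>"
          by (auto simp: sgn_if)
        then show "sgn x * (x + z * sqrt (\<tau> n - \<tau> s)) - ln 2 \<le> phi \<alpha> S n (x + z * sqrt (\<tau> n - \<tau> s))"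
          using step(3) unfolding n_def by (meson diff_right_mono order_trans)
      qed (intro exp_bounded_intros exp_bounded_affine[OF exp_bounded_lip1[OF phi_lip1[OF n(1,2)]]])+
      also have "\<dots> \<le> phi \<alpha> S s x"
        unfolding phi_next[OF finite_S step(2)] n_def[symmetric]
        by (intro hopf_cole_step_ge_mean phi_lip1 n \<alpha>_nonneg v)
      finally show "\<bar>x\<bar> - ln 2 \<le> phi \<alpha> S s x" by (simp add: abs_sgn mult.commute)
    qed
  qed
  then show ?thesis by blast
qed

text \<open>A constant slope would make the flow affine, and an affine function cannot dominate
  \<open>\<bar>x\<bar> - ln 2\<close>: averaging its values at \<open>a\<close> and
  \<open>- a\<close> bounds \<open>\<bar>a\<bar>\<close>.\<close>

lemma dphi_not_const:
  assumes "0 \<le> s" "s \<le> 1" shows "\<exists>x. dphi \<alpha> S s x \<noteq> k"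
proof (rule ccontr)
  assume "\<nexists>x. dphi \<alpha> S s x \<noteq> k"
  then have k: "dphi \<alpha> S s = (\<lambda>_. k)" by auto
  define f where "f = phi \<alpha> S s"
  have "(f has_real_derivative k) (at x)" for x
    using c11_deriv[OF phi_c11[OF assms], of x] k by (simp add: f_def)
  then have "((\<lambda>x. f x - k * x) has_real_derivative 0) (at x)" for x
    by (auto intro!: derivative_eq_intros)
  then have const: "f x - k * x = f 0 - k * 0" for x
    using DERIV_isconst_all[of "\<lambda>x. f x - k * x" x 0] by auto
  have "\<bar>x\<bar> - ln 2 \<le> f 0 + k * x" for x
    using phi_ge_abs[OF assms, of x] const[of x] by (simp add: f_def)
  then have "\<bar>a\<bar> - ln 2 \<le> f 0 + k * a \<and> \<bar>- a\<bar> - ln 2 \<le> f 0 + k * (- a)" for a by blast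
  then have "2 * \<bar>a\<bar> \<le> 2 * (f 0 + ln 2)" for a by (smt (verit) abs_minus_cancel mult_minus_right)
  from this[of "f 0 + ln 2 + 1"] have "2 * \<bar>f 0 + ln 2 + 1\<bar> \<le> 2 * (f 0 + ln 2)" .
  moreover have False if "2 * \<bar>y + 1\<bar> \<le> 2 * y" for y :: real
    using that by (auto simp: abs_if split: if_splits)
  ultimately show False by blast
qed

text \<open>Equality would give the slope at time \<open>t\<close> zero variance under a tilted
  Gaussian. That law has a positive density, so the continuous slope would be constant.\<close>

lemma energy_strict_mono:
  assumes "0 \<le> s" "s < t" "t \<le> 1" "S \<inter> {s<..<t} = {}"
  shows "energy \<alpha> S h s < energy \<alpha> S h t"
proof -
  define c where "c = dphi \<alpha> S t"
  define f where "f = phi \<alpha> S t"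
  define v where "v = \<tau> t - \<tau> s"
  have t: "0 \<le> t" "t \<le> 1" using assms by auto
  have f: "lip1 f" unfolding f_def by (rule phi_lip1[OF t])
  have eb: "exp_bounded c" unfolding c_def by (rule exp_bounded_dphi[OF t])
  have v: "0 < v" unfolding v_def using clock_strict_mono assms by simp
  have less: "(twist (\<alpha> s) v f c x)\<^sup>2 < twist (\<alpha> s) v f (\<lambda>u. (c u)\<^sup>2) x" for x
  proof (rule ccontr)
    define k where "k = twist (\<alpha> s) v f c x"
    assume "\<not> (twist (\<alpha> s) v f c x)\<^sup>2 < twist (\<alpha> s) v f (\<lambda>u. (c u)\<^sup>2) x"
    then have "twist (\<alpha> s) v f (\<lambda>u. (c u - k)\<^sup>2) x \<le> 0"
      unfolding k_def twist_variance[OF f eb] by simp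
    moreover have "0 \<le> twist (\<alpha> s) v f (\<lambda>u. (c u - k)\<^sup>2) x"
      unfolding twist_def by (intro integral_nonneg_AE AE_I2 mult_nonneg_nonneg) (auto simp: less_imp_le[OF tilt_pos])
    ultimately have "twist (\<alpha> s) v f (\<lambda>u. (c u - k)\<^sup>2) x = 0" by simp
    moreover have "integrable std_gaussian (\<lambda>z. (c (x + z * sqrt v) - k)\<^sup>2 * tilt (\<alpha> s) v f x z)"
      using integrable_twist[OF f, of "\<lambda>u. (c u - k)\<^sup>2"] eb by (simp add: exp_bounded_intros)
    ultimately have "AE z in std_gaussian. (c (x + z * sqrt v) - k)\<^sup>2 * tilt (\<alpha> s) v f x z = 0"
      unfolding twist_def
      by (subst (asm) integral_nonneg_eq_0_iff_AE) (auto simp: less_imp_le[OF tilt_pos])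
    then have "AE z in std_gaussian. c (x + z * sqrt v) = k"
    proof eventually_elim
      case (elim z)
      then show ?case using tilt_pos[of "\<alpha> s" v f x z] by simp
    qed
    then have "AE z in lborel. c (x + z * sqrt v) = k"
      unfolding std_gaussian_def
      by (subst (asm) AE_density) (auto simp: normal_density_pos)
    moreover have "continuous_on UNIV (\<lambda>z. c (x + z * sqrt v))"
    proof -
      have "continuous_on UNIV c"
      proof (rule lipschitz_on_continuous_on)
        show "(2 * smoothness)-lipschitz_on UNIV c"
          using c11_deriv_lipschitz[OF phi_c11[OF t]] smoothness_ge_1
          by (intro lipschitz_onI) (auto simp: dist_real_def c_def)
      qed
      moreover have "continuous_on UNIV (\<lambda>z. x + z * sqrt v)" by (intro continuous_intros)
      ultimately show ?thesis by (rule continuous_on_compose2) simp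
    qed
    ultimately have all: "c (x + z * sqrt v) = k" for z
      by (rule AE_lborel_continuous_const)
    have "c y = k" for y
      using all[of "(y - x) / sqrt v"] v by simp
    then show False using dphi_not_const[OF t, of k] by (auto simp: c_def)
  qed
  have "energy \<alpha> S h t = kev \<alpha> S 0 s (kev \<alpha> S s t (\<lambda>u. (c u)\<^sup>2)) h"
    unfolding energy_def c_def[symmetric] using assms by (subst kev_compose[of 0 s t]) (auto intro!: exp_bounded_power eb)
  also have "kev \<alpha> S s t (\<lambda>u. (c u)\<^sup>2) = twist (\<alpha> s) v f (\<lambda>u. (c u)\<^sup>2)"
    unfolding v_def f_def using assms by (subst kev_step[of s t]) (auto intro!: exp_bounded_power eb simp: kev_refl)
  also have "kev \<alpha> S 0 s (twist (\<alpha> s) v f (\<lambda>u. (c u)\<^sup>2)) h > energy \<alpha> S h s"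
    unfolding energy_def
  proof (rule kev_strict_mono)
    show "(dphi \<alpha> S s u)\<^sup>2 < twist (\<alpha> s) v f (\<lambda>u. (c u)\<^sup>2) u" for u
      unfolding dphi_step[OF assms] f_def[symmetric] c_def[symmetric] v_def[symmetric] by (rule less)
    show "exp_bounded (twist (\<alpha> s) v f (\<lambda>u. (c u)\<^sup>2))"
      by (intro exp_bounded_twist hopf_cole_step_lip1 f \<alpha>_nonneg exp_bounded_power eb)
  qed (use assms in \<open>auto intro!: exp_bounded_power exp_bounded_dphi\<close>)
  finally show ?thesis .
qed

end

section \<open>Comparison of two flows along a partition\<close>

text \<open>One backward step of the comparison. The hypothesis on \<open>F\<close> is a quadratic
  lower bound in the displacement \<open>e\<close> with slope coefficient \<open>A\<close>; the
  conclusion has the same shape with \<open>A\<close> increased by \<open>(m1 - m) * v\<close>. The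
  error has the factor \<open>1 / \<epsilon>\<close> because entropy is weighted by
  \<open>1 / m1\<close>.\<close>

lemma hopf_cole_step_lower:
  assumes c11: "c11 L f c" and L: "1 \<le> L" and m: "0 \<le> m" "m \<le> 1" and v: "0 < v"
    and F: "lip1 F" and m1: "\<epsilon> \<le> m1" "m1 \<le> 1" and \<epsilon>: "0 < \<epsilon>" and C: "0 \<le> C"
    and gap: "twist m v f f x - hopf_cole_step m v f x \<le> m * v * (twist m v f c x)\<^sup>2 / 2 + C * (v * sqrt v)"
    and R: "exp_bounded R"
    and hyp: "\<And>u e. \<bar>e\<bar> \<le> \<bar>d\<bar> + v \<Longrightarrow> F (u + e) \<ge> f u + (1 + 2 * t * A) * (c u * e) + t * e\<^sup>2 + R u"
  shows "hopf_cole_step m1 v F (x + d) \<ge> hopf_cole_step m v f x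
    + (1 + 2 * t * (A + (m1 - m) * v)) * (twist m v f c x * d) + t * d\<^sup>2
    + ((m1 - m) * v / 2 + t * ((A + (m1 - m) * v)\<^sup>2 - A\<^sup>2)) * (twist m v f c x)\<^sup>2
    + twist m v f R x - C / \<epsilon> * (v * sqrt v)"
proof -
  have f: "lip1 f" by (rule c11_lip1[OF c11])
  define c0 where "c0 = twist m v f c x"
  define T where "T = hopf_cole_step m v f x"
  define \<Delta> where "\<Delta> = m1 - m"
  define e where "e = twist m v f f x - T"
  \<comment> \<open>With the control \<open>c0\<close> the drift is level times control, per unit of
    variance. Under the two levels the drifts differ by \<open>\<Delta> * c0\<close>, and
    \<open>s\<close> is the resulting displacement over the step.\<close>
  define s where "s = \<Delta> * c0 * v"
  have m1pos: "0 < m1" using m1 \<epsilon> by simp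
  have c0: "\<bar>c0\<bar> \<le> 1" unfolding c0_def
    by (rule twist_abs_le[OF f]) (use c11 in \<open>auto simp: c11_exp_bounded c11_deriv_bound\<close>)
  have \<Delta>: "\<bar>\<Delta>\<bar> \<le> 1" using m m1 m1pos by (auto simp: \<Delta>_def abs_le_iff)
  have "\<bar>s\<bar> \<le> 1 * 1 * v" unfolding s_def abs_mult using c0 \<Delta> v by (intro mult_mono) auto
  then have ds: "\<bar>d + s\<bar> \<le> \<bar>d\<bar> + v" using abs_triangle_ineq[of d s] by simp
  have b: "twist m v f (\<lambda>u. u - x) x = v * m * c0"
    unfolding c0_def by (rule twist_displacement[OF c11 L m v])
  have 1: "hopf_cole_step m1 v F (x + d) \<ge> twist m v f (\<lambda>u. F (u + (d + s))) x
    - 1 / m1 * (m * e + s * (v * m * c0) / v + s\<^sup>2 / (2 * v))"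
    unfolding e_def T_def b[symmetric] by (rule hopf_cole_step_ge_twist[OF f F m1pos v])
  have 2: "twist m v f (\<lambda>u. F (u + (d + s))) x \<ge> e + T + ((1 + 2 * t * A) * (d + s)) * c0 + t * (d + s)\<^sup>2 + twist m v f R x"
  proof -
    have "twist m v f (\<lambda>u. f u + ((1 + 2 * t * A) * (d + s)) * c u + t * (d + s)\<^sup>2 + R u) x
        \<le> twist m v f (\<lambda>u. F (u + (d + s))) x"
      using hyp[OF ds]
      by (intro twist_mono[OF f] exp_bounded_intros exp_bounded_lip1[OF f] exp_bounded_lip1[OF lip1_shift[OF F]]
          c11_exp_bounded[OF c11] R) (simp add: ac_simps)
    also have "twist m v f (\<lambda>u. f u + ((1 + 2 * t * A) * (d + s)) * c u + t * (d + s)\<^sup>2 + R u) x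
      = e + T + ((1 + 2 * t * A) * (d + s)) * c0 + t * (d + s)\<^sup>2 + twist m v f R x"
      by (simp only: twist_add[OF f] twist_cmult[OF f] twist_const[OF f] exp_bounded_add exp_bounded_mult
          exp_bounded_const exp_bounded_lip1[OF f] c11_exp_bounded[OF c11] R c0_def[symmetric] e_def)
    finally show ?thesis .
  qed
  \<comment> \<open>The entropy in excess of that of a constant drift. It is nonnegative, so it
    matters only where \<open>\<Delta>\<close> is negative, and there it is of order
    \<open>v * sqrt v\<close>.\<close>
  define g where "g = e - m * v * c0\<^sup>2 / 2"
  have g0: "0 \<le> g" unfolding g_def e_def T_def c0_def using gap_lower[OF c11 L m v, of x] by simp
  have g1: "g \<le> C * (v * sqrt v)" unfolding g_def e_def T_def c0_def using gap by simp
  have drift: "\<Delta> / m1 * g \<ge> - (C / \<epsilon> * (v * sqrt v))"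
  proof (cases "0 \<le> \<Delta>")
    case True
    then have "0 \<le> \<Delta> / m1 * g" using g0 m1pos by simp
    moreover have "0 \<le> C / \<epsilon> * (v * sqrt v)" using C \<epsilon> v by simp
    ultimately show ?thesis by linarith
  next
    case False
    have "- \<Delta> / m1 * g \<le> 1 / \<epsilon> * (C * (v * sqrt v))"
      using False \<Delta> m1 m1pos \<epsilon> g0 g1 by (intro mult_mono frac_le) auto
    then show ?thesis by simp
  qed
  \<comment> \<open>Once \<open>s\<close> is inserted, the entropy costs and the gain
    \<open>s * c0\<close> combine to exactly half of \<open>\<Delta> * v * c0^2\<close>,
    independently of \<open>m\<close> and \<open>m1\<close> otherwise.\<close>
  have 3: "e - 1 / m1 * (m * e + s * (v * m * c0) / v + s\<^sup>2 / (2 * v)) + s * c0 = \<Delta> * v / 2 * c0\<^sup>2 + \<Delta> / m1 * g"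
    using m1pos v unfolding s_def g_def \<Delta>_def by (simp add: field_simps power2_eq_square)
  have 4: "2 * t * A * (d + s) * c0 + t * (d + s)\<^sup>2
     = 2 * t * (A + \<Delta> * v) * (c0 * d) + t * d\<^sup>2 + t * ((A + \<Delta> * v)\<^sup>2 - A\<^sup>2) * c0\<^sup>2"
    unfolding s_def by (simp add: algebra_simps power2_eq_square)
  have "hopf_cole_step m1 v F (x + d) \<ge> (e - 1 / m1 * (m * e + s * (v * m * c0) / v + s\<^sup>2 / (2 * v)) + s * c0)
     + T + c0 * d + (2 * t * A * (d + s) * c0 + t * (d + s)\<^sup>2) + twist m v f R x"
    using 1 2 by (simp add: algebra_simps)
  also have "(e - 1 / m1 * (m * e + s * (v * m * c0) / v + s\<^sup>2 / (2 * v)) + s * c0)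
     + T + c0 * d + (2 * t * A * (d + s) * c0 + t * (d + s)\<^sup>2) + twist m v f R x
     = \<Delta> * v / 2 * c0\<^sup>2 + \<Delta> / m1 * g + T + c0 * d
       + (2 * t * (A + \<Delta> * v) * (c0 * d) + t * d\<^sup>2 + t * ((A + \<Delta> * v)\<^sup>2 - A\<^sup>2) * c0\<^sup>2) + twist m v f R x"
    unfolding 3 4 ..
  finally show ?thesis
    using drift unfolding \<Delta>_def[symmetric] c0_def[symmetric] T_def[symmetric] by (simp add: algebra_simps)
qed

section \<open>Two flows on a common partition\<close>

locale parisi_partition = F: parisi_flow \<beta> \<gamma> \<alpha> S + F1: parisi_flow \<beta> \<gamma> \<alpha>1 S1
  for \<beta> \<gamma> \<alpha> S \<alpha>1 S1 +
  fixes p :: "nat \<Rightarrow> real" and N :: nat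
  assumes p_0: "p 0 = 0" and p_N: "p N = 1"
    and p_less: "\<And>i. i < N \<Longrightarrow> p i < p (Suc i)"
    and p_S: "\<And>i. i < N \<Longrightarrow> S \<inter> {p i<..<p (Suc i)} = {}"
    and p_S1: "\<And>i. i < N \<Longrightarrow> S1 \<inter> {p i<..<p (Suc i)} = {}"
begin

lemma p_mono: "i \<le> j \<Longrightarrow> j \<le> N \<Longrightarrow> p i \<le> p j"
proof (induction rule: dec_induct)
  case (step n)
  then show ?case using p_less[of n] by simp
qed simp

lemma p_range: "i \<le> N \<Longrightarrow> 0 \<le> p i" "i \<le> N \<Longrightarrow> p i \<le> 1"
  using p_mono[of 0 i] p_mono[of i N] by (auto simp: p_0 p_N)

definition "\<delta> i = F.\<tau> (p (Suc i)) - F.\<tau> (p i)"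
definition "\<Delta> i = \<alpha>1 (p i) - \<alpha> (p i)"
text \<open>From \<open>p j\<close> on, the displacement grows by
  \<open>\<Delta> i * \<delta> i\<close> times the slope at \<open>p i\<close>. As the slope is a
  martingale, the expected future growth is \<open>A j\<close> times the present slope, and the
  expected square of the total is the sum of \<open>((A i)^2 - (A (Suc i))^2)\<close> times the
  energy at \<open>p i\<close>. \<open>A\<close> is the discrete form of
  \<open>tail_integral\<close>.\<close>

definition "A j = (\<Sum>i=j..<N. \<Delta> i * \<delta> i)"

lemma \<delta>_pos: "i < N \<Longrightarrow> 0 < \<delta> i"
  unfolding \<delta>_def using F.clock_strict_mono[of "p i" "p (Suc i)"] p_less[of i] p_range[of i] p_range[of "Suc i"] by simp

lemma \<delta>_le: "i < N \<Longrightarrow> \<delta> i \<le> F.\<tau> 1"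
  unfolding \<delta>_def using F.clock_mono[of "p (Suc i)" 1] F.clock_mono[of 0 "p i"] p_range[of i] p_range[of "Suc i"]
  by (simp add: F.clock_0)

lemma A_rec: "j < N \<Longrightarrow> A j = A (Suc j) + \<Delta> j * \<delta> j"
  by (simp add: A_def sum.atLeast_Suc_lessThan)

text \<open>The inverse bounds the second derivative of \<open>ln cosh\<close> on the segment between the two diffusions from below:
  they stay at distance at most \<open>\<tau> 1\<close>.\<close>

definition "weight x = exp (2 * \<bar>x\<bar> + 2 * F.\<tau> 1)"

lemma exp_bounded_weight: "exp_bounded weight"
proof -
  have "exp_bounded (\<lambda>x. exp (2 * F.\<tau> 1) * exp (2 * \<bar>x\<bar>))" by (intro exp_bounded_intros)
  then show ?thesis by (simp add: weight_def[abs_def] exp_add[symmetric] add.commute)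
qed

text \<open>Backward induction along the partition. The bound compares the flow of \<open>\<alpha>1\<close> at \<open>x + d\<close> with that of \<open>\<alpha>\<close>
  at \<open>x\<close>, where \<open>d\<close> is the displacement between two diffusions driven by the same noise and the same
  control, namely the optimal one for \<open>\<alpha>\<close>. The terms in \<open>t\<close> linearize the gain from the strict convexity of
  \<open>ln cosh\<close>: at the end \<open>d\<^sup>2 q / 2 \<ge> t d\<^sup>2 - t\<^sup>2 d\<^sup>2 / (2 q)\<close>, and \<open>E[d\<^sup>2]\<close> is explicit because \<open>dphi\<close> is a
  martingale along the diffusion.\<close>

lemma discrete_lower_bound:
  assumes \<epsilon>: "0 < \<epsilon>" "\<And>s. \<epsilon> \<le> \<alpha>1 s" and t: "0 \<le> t"
    and C: "0 \<le> C" "\<And>f c m v x. c11 F.smoothness f c \<Longrightarrow> 0 \<le> m \<Longrightarrow> m \<le> 1 \<Longrightarrow> 0 < v \<Longrightarrow> v \<le> F.\<tau> 1 \<Longrightarrow>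
      twist m v f f x - hopf_cole_step m v f x \<le> m * v * (twist m v f c x)\<^sup>2 / 2 + C * (v * sqrt v)"
  shows "F.phi \<alpha>1 S1 0 h \<ge> F.phi \<alpha> S 0 h
    + (\<Sum>i<N. (\<Delta> i * \<delta> i / 2 + t * ((A i)\<^sup>2 - (A (Suc i))\<^sup>2)) * F.energy \<alpha> S h (p i))
    - t\<^sup>2 * (F.\<tau> 1)\<^sup>2 / 2 * F.kev \<alpha> S 0 1 weight h - C / \<epsilon> * (\<Sum>i<N. \<delta> i * sqrt (\<delta> i))"
proof -
  define w where "w i = \<Delta> i * \<delta> i / 2 + t * ((A i)\<^sup>2 - (A (Suc i))\<^sup>2)" for i
  define sq where "sq i u = (F.dphi \<alpha> S (p i) u)\<^sup>2" for i u
  define K where "K = t\<^sup>2 * (F.\<tau> 1)\<^sup>2 / 2"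
  define err where "err j = C / \<epsilon> * (\<Sum>i=j..<N. \<delta> i * sqrt (\<delta> i))" for j
  \<comment> \<open>The part of the bound that does not involve the displacement: expected future
    gains, the price of linearizing the convexity, and the accumulated errors.\<close>
  define R where "R j x = (\<Sum>i=j..<N. w i * F.kev \<alpha> S (p j) (p i) (sq i) x) - K * F.kev \<alpha> S (p j) 1 weight x - err j" for j x
  have ebsq: "exp_bounded (sq i)" if "i \<le> N" for i
    unfolding sq_def using p_range[OF that] by (intro exp_bounded_power F.exp_bounded_dphi)
  have ebk: "exp_bounded (F.kev \<alpha> S (p j) (p i) (sq i))" if "j \<le> i" "i \<le> N" for i j
    using that p_range[of i] p_range[of j] p_mono[of j i] by (intro F.exp_bounded_kev ebsq) auto
  have ebw: "exp_bounded (F.kev \<alpha> S (p j) 1 weight)" if "j \<le> N" for j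
    using that p_range[of j] by (intro F.exp_bounded_kev exp_bounded_weight) auto
  have ebR: "exp_bounded (R j)" if "j \<le> N" for j
    unfolding R_def using that by (intro exp_bounded_intros ebk ebw) auto
  \<comment> \<open>The range allowed for \<open>d\<close> is the one that reproduces itself: one
    step moves the displacement by at most \<open>\<delta> j\<close>, the growth of the
    clock.\<close>
  have main: "\<forall>x d. \<bar>d\<bar> \<le> F.\<tau> (p j) \<longrightarrow> F.phi \<alpha>1 S1 (p j) (x + d) \<ge> F.phi \<alpha> S (p j) x
      + (1 + 2 * t * A j) * (F.dphi \<alpha> S (p j) x * d) + t * d\<^sup>2 + R j x" if "j \<le> N" for j
    using that
  proof (induction rule: inc_induct)
    case base
    show ?case
    proof (intro allI impI)
      fix x d assume d: "\<bar>d\<bar> \<le> F.\<tau> (p N)"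
      define q where "q = exp (- 2 * (\<bar>x\<bar> + \<bar>d\<bar>))"
      have q: "0 < q" by (simp add: q_def)
      have qw: "1 / q \<le> weight x"
        using d by (simp add: q_def weight_def exp_minus field_simps p_N exp_add[symmetric])
      have "0 \<le> (q - t)\<^sup>2 / q" using q by simp
      then have "2 * t - t\<^sup>2 * (1 / q) \<le> q" using q by (simp add: field_simps power2_eq_square)
      moreover have "t\<^sup>2 * (1 / q) \<le> t\<^sup>2 * weight x" using qw by (intro mult_left_mono) auto
      ultimately have "2 * t - t\<^sup>2 * weight x \<le> q" by linarith
      then have "d\<^sup>2 / 2 * (2 * t - t\<^sup>2 * weight x) \<le> d\<^sup>2 / 2 * q" by (intro mult_left_mono) auto
      moreover have "d\<^sup>2 * (t\<^sup>2 * weight x) \<le> (F.\<tau> 1)\<^sup>2 * (t\<^sup>2 * weight x)"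
      proof (rule mult_right_mono)
        show "d\<^sup>2 \<le> (F.\<tau> 1)\<^sup>2" using d unfolding p_N by (metis abs_ge_zero abs_le_square_iff abs_of_nonneg order_trans)
      qed (simp add: weight_def)
      ultimately have "t * d\<^sup>2 - K * weight x \<le> d\<^sup>2 / 2 * q"
        by (simp add: K_def algebra_simps)
      then show "F.phi \<alpha>1 S1 (p N) (x + d) \<ge> F.phi \<alpha> S (p N) x
        + (1 + 2 * t * A N) * (F.dphi \<alpha> S (p N) x * d) + t * d\<^sup>2 + R N x"
        using ln_cosh_convexity[of x d]
        by (simp add: p_N F.phi_1 F.dphi_def c11_deriv_eq[OF c11_ln_cosh] R_def A_def err_def F.kev_refl q_def)
    qed
  next
    case (step j)
    define f where "f = F.phi \<alpha> S (p (Suc j))"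
    define c where "c = F.dphi \<alpha> S (p (Suc j))"
    define m where "m = \<alpha> (p j)"
    have j: "j < N" by (rule step.hyps(2))
    have r: "0 \<le> p j" "p j < p (Suc j)" "p (Suc j) \<le> 1" "0 \<le> p (Suc j)"
      using j p_range[of j] p_range[of "Suc j"] p_less[of j] by auto
    have v: "F.\<tau> (p (Suc j)) - F.\<tau> (p j) = \<delta> j" by (simp add: \<delta>_def)
    have eqs: "F.phi \<alpha> S (p j) = hopf_cole_step m (\<delta> j) f"
      "F.dphi \<alpha> S (p j) = twist m (\<delta> j) f c"
      "F.phi \<alpha>1 S1 (p j) = hopf_cole_step (\<alpha>1 (p j)) (\<delta> j) (F.phi \<alpha>1 S1 (p (Suc j)))"
      unfolding f_def c_def m_def v[symmetric]
      by (intro F.phi_step F.dphi_step F1.phi_step r p_S p_S1 j)+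
    have f: "lip1 f" unfolding f_def by (rule F.phi_lip1) (use r in auto)
    have c11: "c11 F.smoothness f c" unfolding f_def c_def by (rule F.phi_c11) (use r in auto)
    have m: "0 \<le> m" "m \<le> 1" by (auto simp: m_def F.\<alpha>_nonneg F.\<alpha>_le_1)
    \<comment> \<open>Transition operators compose, so twisting the later gains yields the same
      gains seen from \<open>p j\<close>. What separates this from \<open>R j\<close> is the gain of
      step \<open>j\<close> and its error.\<close>
    have twR: "twist m (\<delta> j) f (R (Suc j)) x = R j x - w j * (twist m (\<delta> j) f c x)\<^sup>2 + C / \<epsilon> * (\<delta> j * sqrt (\<delta> j))" for x
    proof -
      have kj: "twist m (\<delta> j) f (F.kev \<alpha> S (p (Suc j)) (p i) (sq i)) = F.kev \<alpha> S (p j) (p i) (sq i)"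
        if "Suc j \<le> i" "i < N" for i
        unfolding m_def f_def v[symmetric] using that p_mono[of "Suc j" i] p_range[of i]
        by (intro F.kev_step[symmetric] r p_S j ebsq) auto
      have kw: "twist m (\<delta> j) f (F.kev \<alpha> S (p (Suc j)) 1 weight) = F.kev \<alpha> S (p j) 1 weight"
        unfolding m_def f_def v[symmetric] by (intro F.kev_step[symmetric] r p_S j exp_bounded_weight order_refl)
      have "twist m (\<delta> j) f (R (Suc j)) x
          = twist m (\<delta> j) f (\<lambda>u. \<Sum>i=Suc j..<N. w i * F.kev \<alpha> S (p (Suc j)) (p i) (sq i) u) x
            - K * twist m (\<delta> j) f (F.kev \<alpha> S (p (Suc j)) 1 weight) x - err (Suc j)"
        unfolding R_def using j
        by (subst twist_diff[OF f], (intro exp_bounded_intros ebk ebw; simp),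
            (intro exp_bounded_intros ebk ebw; simp), subst twist_diff[OF f],
            (intro exp_bounded_intros ebk ebw; simp), (intro exp_bounded_intros ebk ebw; simp))
           (simp add: twist_cmult[OF f] twist_const[OF f])
      also have "twist m (\<delta> j) f (\<lambda>u. \<Sum>i=Suc j..<N. w i * F.kev \<alpha> S (p (Suc j)) (p i) (sq i) u) x
          = (\<Sum>i=Suc j..<N. w i * F.kev \<alpha> S (p j) (p i) (sq i) x)"
        by (subst twist_sum[OF f], (intro exp_bounded_intros ebk; simp))
           (intro sum.cong refl, simp add: twist_cmult[OF f] kj)
      finally show ?thesis
        using j unfolding kw R_def err_def
        by (simp add: sum.atLeast_Suc_lessThan F.kev_refl sq_def eqs(2) algebra_simps)
    qed
    show ?case
    proof (intro allI impI)
      fix x d assume d: "\<bar>d\<bar> \<le> F.\<tau> (p j)"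
      have "hopf_cole_step (\<alpha>1 (p j)) (\<delta> j) (F.phi \<alpha>1 S1 (p (Suc j))) (x + d) \<ge> hopf_cole_step m (\<delta> j) f x
        + (1 + 2 * t * (A (Suc j) + (\<alpha>1 (p j) - m) * \<delta> j)) * (twist m (\<delta> j) f c x * d) + t * d\<^sup>2
        + ((\<alpha>1 (p j) - m) * \<delta> j / 2 + t * ((A (Suc j) + (\<alpha>1 (p j) - m) * \<delta> j)\<^sup>2 - (A (Suc j))\<^sup>2)) * (twist m (\<delta> j) f c x)\<^sup>2
        + twist m (\<delta> j) f (R (Suc j)) x - C / \<epsilon> * (\<delta> j * sqrt (\<delta> j))"
      proof (rule hopf_cole_step_lower[OF c11 F.smoothness_ge_1 m \<delta>_pos[OF j] _ \<epsilon>(2) F1.\<alpha>_le_1 \<epsilon>(1) C(1)])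
        show "lip1 (F.phi \<alpha>1 S1 (p (Suc j)))" by (rule F1.phi_lip1) (use r in auto)
        show "twist m (\<delta> j) f f x - hopf_cole_step m (\<delta> j) f x
            \<le> m * \<delta> j * (twist m (\<delta> j) f c x)\<^sup>2 / 2 + C * (\<delta> j * sqrt (\<delta> j))"
          by (rule C(2)[OF c11 m \<delta>_pos[OF j] \<delta>_le[OF j]])
        show "exp_bounded (R (Suc j))" using j by (intro ebR) simp
        fix u e assume "\<bar>e\<bar> \<le> \<bar>d\<bar> + \<delta> j"
        then have "\<bar>e\<bar> \<le> F.\<tau> (p (Suc j))" using d by (simp add: \<delta>_def)
        then show "F.phi \<alpha>1 S1 (p (Suc j)) (u + e) \<ge> f u + (1 + 2 * t * A (Suc j)) * (c u * e) + t * e\<^sup>2 + R (Suc j) u"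
          using step.IH unfolding f_def c_def by blast
      qed
      moreover have Aj: "A (Suc j) + (\<alpha>1 (p j) - m) * \<delta> j = A j"
        by (simp add: A_rec[OF j] \<Delta>_def m_def)
      moreover have "(\<alpha>1 (p j) - m) * \<delta> j / 2 + t * ((A j)\<^sup>2 - (A (Suc j))\<^sup>2) = w j"
        by (simp add: w_def \<Delta>_def m_def)
      ultimately show "F.phi \<alpha>1 S1 (p j) (x + d) \<ge> F.phi \<alpha> S (p j) x
          + (1 + 2 * t * A j) * (F.dphi \<alpha> S (p j) x * d) + t * d\<^sup>2 + R j x"
        unfolding eqs twR by simp
    qed
  qed
  from main[of 0] have "F.phi \<alpha>1 S1 0 (h + 0) \<ge> F.phi \<alpha> S 0 h
      + (1 + 2 * t * A 0) * (F.dphi \<alpha> S 0 h * 0) + t * 0\<^sup>2 + R 0 h"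
    unfolding p_0 by (metis F.clock_0 abs_zero order_refl zero_le)
  then show ?thesis
    unfolding R_def err_def K_def w_def sq_def[abs_def]
    by (simp add: p_0 F.energy_def atLeast0LessThan)
qed

end

section \<open>Integration against the rate of the clock\<close>

text \<open>Measurability is asked only on the unit interval, because \<open>cdf01\<close> and the
  energy are known to be monotone only there.\<close>

definition unit_bounded :: "(real \<Rightarrow> real) \<Rightarrow> bool" where
  "unit_bounded h \<longleftrightarrow> h \<in> borel_measurable (restrict_space borel {0..1}) \<and> (\<exists>B. \<forall>s\<in>{0..1}. \<bar>h s\<bar> \<le> B)"

lemma unit_boundedI:
  "h \<in> borel_measurable (restrict_space borel {0..1}) \<Longrightarrow> (\<And>s. 0 \<le> s \<Longrightarrow> s \<le> 1 \<Longrightarrow> \<bar>h s\<bar> \<le> B) \<Longrightarrow> unit_bounded h"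
  unfolding unit_bounded_def by (intro conjI exI[of _ B] ballI) auto

lemma unit_boundedE:
  assumes "unit_bounded h"
  obtains B where "0 \<le> B" "\<And>s. 0 \<le> s \<Longrightarrow> s \<le> 1 \<Longrightarrow> \<bar>h s\<bar> \<le> B"
proof -
  obtain B where "\<forall>s\<in>{0..1}. \<bar>h s\<bar> \<le> B" using assms by (auto simp: unit_bounded_def)
  then have B': "\<bar>h s\<bar> \<le> \<bar>B\<bar>" if "0 \<le> s" "s \<le> 1" for s
    using that by (intro order_trans[OF _ abs_ge_self[of B]]) auto
  show ?thesis by (rule that[of "\<bar>B\<bar>"]) (use B' in auto)
qed

lemma unit_bounded_measurable: "unit_bounded h \<Longrightarrow> h \<in> borel_measurable (restrict_space borel {0..1})"
  by (simp add: unit_bounded_def)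

named_theorems unit_bounded_intros

lemma unit_bounded_const [unit_bounded_intros]: "unit_bounded (\<lambda>_. c)"
  by (rule unit_boundedI[of _ "\<bar>c\<bar>"]) auto

lemma unit_bounded_ident [unit_bounded_intros]: "unit_bounded (\<lambda>s. s)"
  by (rule unit_boundedI[of _ 1]) (auto intro: measurable_restrict_space1)

lemma unit_bounded_add [unit_bounded_intros]:
  assumes "unit_bounded f" "unit_bounded g" shows "unit_bounded (\<lambda>s. f s + g s)"
proof -
  obtain B where B: "\<And>s. 0 \<le> s \<Longrightarrow> s \<le> 1 \<Longrightarrow> \<bar>f s\<bar> \<le> B" using assms(1) by (rule unit_boundedE) blast
  obtain C where C: "\<And>s. 0 \<le> s \<Longrightarrow> s \<le> 1 \<Longrightarrow> \<bar>g s\<bar> \<le> C" using assms(2) by (rule unit_boundedE) blast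
  show ?thesis
  proof (rule unit_boundedI)
    show "\<bar>f s + g s\<bar> \<le> B + C" if "0 \<le> s" "s \<le> 1" for s
      using B[OF that] C[OF that] abs_triangle_ineq[of "f s" "g s"] by linarith
  qed (intro borel_measurable_add unit_bounded_measurable assms)
qed

lemma unit_bounded_mult [unit_bounded_intros]:
  assumes "unit_bounded f" "unit_bounded g" shows "unit_bounded (\<lambda>s. f s * g s)"
proof -
  obtain B where B: "0 \<le> B" "\<And>s. 0 \<le> s \<Longrightarrow> s \<le> 1 \<Longrightarrow> \<bar>f s\<bar> \<le> B" using assms(1) by (rule unit_boundedE) blast
  obtain C where C: "\<And>s. 0 \<le> s \<Longrightarrow> s \<le> 1 \<Longrightarrow> \<bar>g s\<bar> \<le> C" using assms(2) by (rule unit_boundedE) blast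
  show ?thesis
  proof (rule unit_boundedI)
    show "\<bar>f s * g s\<bar> \<le> B * C" if "0 \<le> s" "s \<le> 1" for s
      unfolding abs_mult using B(2)[OF that] C[OF that] B(1) by (intro mult_mono) auto
  qed (intro borel_measurable_times unit_bounded_measurable assms)
qed

lemma unit_bounded_uminus [unit_bounded_intros]: "unit_bounded f \<Longrightarrow> unit_bounded (\<lambda>s. - f s)"
  using unit_bounded_mult[OF unit_bounded_const[of "-1"], of f] by simp

lemma unit_bounded_diff [unit_bounded_intros]:
  "unit_bounded f \<Longrightarrow> unit_bounded g \<Longrightarrow> unit_bounded (\<lambda>s. f s - g s)"
  using unit_bounded_add[OF _ unit_bounded_uminus, of f g] by simp

lemma unit_bounded_abs [unit_bounded_intros]:
  assumes "unit_bounded f" shows "unit_bounded (\<lambda>s. \<bar>f s\<bar>)"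
proof -
  obtain B where B: "\<And>s. 0 \<le> s \<Longrightarrow> s \<le> 1 \<Longrightarrow> \<bar>f s\<bar> \<le> B" using assms(1) by (rule unit_boundedE) blast
  show ?thesis
    by (rule unit_boundedI[of _ B]) (use B unit_bounded_measurable[OF assms] in auto)
qed

lemma unit_bounded_indicator [unit_bounded_intros]:
  "A \<in> sets borel \<Longrightarrow> unit_bounded (indicator A)"
  by (rule unit_boundedI[of _ 1]) (auto intro!: measurable_restrict_space1 simp: indicator_def)

lemma unit_bounded_mono:
  assumes "mono_on {0..1} f" shows "unit_bounded f"
proof (rule unit_boundedI)
  show "f \<in> borel_measurable (restrict_space borel {0..1})"
    by (rule borel_measurable_mono_on_fnc[OF assms])
  show "\<bar>f s\<bar> \<le> \<bar>f 0\<bar> + \<bar>f 1\<bar>" if "0 \<le> s" "s \<le> 1" for s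
    using mono_onD[OF assms, of 0 s] mono_onD[OF assms, of s 1] that by auto
qed

lemma set_integrable_unit_bounded:
  assumes h: "unit_bounded h" and A: "A \<in> sets borel" "A \<subseteq> {0..1}"
  shows "set_integrable lborel A h"
proof -
  obtain B where B: "0 \<le> B" "\<And>s. 0 \<le> s \<Longrightarrow> s \<le> 1 \<Longrightarrow> \<bar>h s\<bar> \<le> B" using h by (rule unit_boundedE) blast
  have "set_integrable lborel {0..1} h"
    unfolding set_integrable_def
  proof (rule Bochner_Integration.integrable_bound)
    show "integrable lborel (\<lambda>s. indicator {0..1::real} s *\<^sub>R B)" by (rule borel_integrable_compact) auto
    show "(\<lambda>s. indicat_real {0..1} s *\<^sub>R h s) \<in> borel_measurable lborel"
      using unit_bounded_measurable[OF h] by (subst (asm) borel_measurable_restrict_space_iff) auto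
    show "AE s in lborel. norm (indicat_real {0..1} s *\<^sub>R h s) \<le> norm (indicator {0..1} s *\<^sub>R B)"
      using B by (intro AE_I2) (auto simp: indicator_def)
  qed
  then show ?thesis by (rule set_integrable_subset) (use A in auto)
qed

context clock
begin

definition rate_integral :: "(real \<Rightarrow> real) \<Rightarrow> real" where
  "rate_integral h = (LINT s:{0..1}|lborel. \<rho> s * h s)"

lemma rate_unit_bounded: "unit_bounded \<rho>"
proof -
  have "compact (\<rho> ` {0..1})" by (rule compact_continuous_image[OF rate_continuous]) simp
  then obtain B where B: "\<forall>y\<in>\<rho> ` {0..1}. \<bar>y\<bar> \<le> B" using compact_imp_bounded bounded_real by blast
  show ?thesis
    by (rule unit_boundedI[of _ B])
       (use B in \<open>auto intro!: borel_measurable_continuous_on_restrict rate_continuous\<close>)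
qed

lemma set_integrable_rate:
  assumes "unit_bounded h" "A \<in> sets borel" "A \<subseteq> {0..1}"
  shows "set_integrable lborel A (\<lambda>s. \<rho> s * h s)"
  by (intro set_integrable_unit_bounded unit_bounded_intros rate_unit_bounded assms)

lemma rate_integral_add: "unit_bounded f \<Longrightarrow> unit_bounded g \<Longrightarrow>
    rate_integral (\<lambda>s. f s + g s) = rate_integral f + rate_integral g"
  unfolding rate_integral_def distrib_left by (intro set_integral_add set_integrable_rate) auto

lemma rate_integral_diff: "unit_bounded f \<Longrightarrow> unit_bounded g \<Longrightarrow>
    rate_integral (\<lambda>s. f s - g s) = rate_integral f - rate_integral g"
  unfolding rate_integral_def right_diff_distrib by (intro set_integral_diff set_integrable_rate) auto

lemma rate_integral_cmult: "rate_integral (\<lambda>s. c * f s) = c * rate_integral f"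
  unfolding rate_integral_def by (simp add: mult.left_commute[of _ c])

lemma rate_integral_mono:
  assumes "unit_bounded f" "unit_bounded g" "\<And>s. 0 \<le> s \<Longrightarrow> s \<le> 1 \<Longrightarrow> f s \<le> g s"
  shows "rate_integral f \<le> rate_integral g"
  unfolding rate_integral_def
  by (intro set_integral_mono set_integrable_rate mult_left_mono) (use assms rate_nonneg in auto)

lemma rate_integral_cong:
  "(\<And>s. 0 \<le> s \<Longrightarrow> s \<le> 1 \<Longrightarrow> f s = g s) \<Longrightarrow> rate_integral f = rate_integral g"
  unfolding rate_integral_def by (intro set_lebesgue_integral_cong) auto

lemma rate_integral_tendsto:
  assumes ub: "\<And>n. unit_bounded (H n)" "unit_bounded h"
    and B: "\<And>n s. 0 \<le> s \<Longrightarrow> s \<le> 1 \<Longrightarrow> \<bar>H n s\<bar> \<le> B"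
    and lim: "\<And>s. 0 \<le> s \<Longrightarrow> s \<le> 1 \<Longrightarrow> (\<lambda>n. H n s) \<longlonglongrightarrow> h s"
  shows "(\<lambda>n. rate_integral (H n)) \<longlonglongrightarrow> rate_integral h"
  unfolding rate_integral_def set_lebesgue_integral_def
proof (rule integral_dominated_convergence)
  show "integrable lborel (\<lambda>s. indicator {0..1} s *\<^sub>R (\<rho> s * B))"
    using set_integrable_rate[OF unit_bounded_const, of "{0..1}" B] unfolding set_integrable_def by simp
  show "(\<lambda>s. indicat_real {0..1} s *\<^sub>R (\<rho> s * h s)) \<in> borel_measurable lborel"
    "\<And>n. (\<lambda>s. indicat_real {0..1} s *\<^sub>R (\<rho> s * H n s)) \<in> borel_measurable lborel"
    using set_integrable_rate[OF ub(2), of "{0..1}"] set_integrable_rate[OF ub(1), of "{0..1}"]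
    unfolding set_integrable_def by auto
  show "AE s in lborel. (\<lambda>n. indicat_real {0..1} s *\<^sub>R (\<rho> s * H n s)) \<longlonglongrightarrow> indicat_real {0..1} s *\<^sub>R (\<rho> s * h s)"
  proof (rule AE_I2)
    fix s show "(\<lambda>n. indicat_real {0..1} s *\<^sub>R (\<rho> s * H n s)) \<longlonglongrightarrow> indicat_real {0..1} s *\<^sub>R (\<rho> s * h s)"
      by (cases "s \<in> {0..1}") (auto intro!: tendsto_intros lim)
  qed
  fix n
  show "AE s in lborel. norm (indicat_real {0..1} s *\<^sub>R (\<rho> s * H n s)) \<le> indicat_real {0..1} s *\<^sub>R (\<rho> s * B)"
    using B rate_nonneg by (intro AE_I2) (auto simp: indicator_def abs_mult mult_left_mono)
qed

lemma integral_rate: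
  assumes "0 \<le> a" "a \<le> b" "b \<le> 1"
  shows "(LINT s:{a..b}|lborel. \<rho> s) = \<tau> b - \<tau> a"
  unfolding set_lebesgue_integral_def
proof (rule integral_FTC_Icc[OF assms(2)])
  show "(\<tau> has_vector_derivative \<rho> x) (at x within {a..b})" if "a \<le> x" "x \<le> b" for x
    unfolding has_real_derivative_iff_has_vector_derivative[symmetric]
    using that assms by (intro has_field_derivative_at_within[OF clock_deriv]) auto
  show "continuous_on {a..b} \<rho>" using rate_continuous by (rule continuous_on_subset) (use assms in auto)
qed

lemma rate_integral_const: "rate_integral (\<lambda>_. c) = c * \<tau> 1"
  using integral_rate[of 0 1] rate_integral_cmult[of c "\<lambda>_. 1"] by (simp add: rate_integral_def clock_0)

lemma set_integral_half_open:
  fixes f :: "real \<Rightarrow> real"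
  assumes "set_integrable lborel {a..b} f"
  shows "(LINT s:{a..<b}|lborel. f s) = (LINT s:{a..b}|lborel. f s)"
proof -
  have sub: "set_integrable lborel {a..<b} f" by (rule set_integrable_subset[OF assms]) auto
  show ?thesis
    unfolding set_lebesgue_integral_def
  proof (rule integral_cong_AE)
    show "AE x in lborel. indicat_real {a..<b} x *\<^sub>R f x = indicat_real {a..b} x *\<^sub>R f x"
      using AE_lborel_singleton[of b] by eventually_elim (auto simp: indicator_def)
  qed (use assms sub in \<open>auto simp: set_integrable_def\<close>)
qed

lemma integral_rate_half_open:
  assumes "0 \<le> a" "a \<le> b" "b \<le> 1"
  shows "(LINT s:{a..<b}|lborel. \<rho> s) = \<tau> b - \<tau> a"
  using integral_rate[OF assms] set_integrable_rate[OF unit_bounded_const[of 1], of "{a..b}"] assms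
  by (subst set_integral_half_open) auto

text \<open>For the difference of two levels this measures how far the second flow drifts away after
  time \<open>r\<close>; vanishing tails will force equal measures.\<close>

definition tail_integral :: "(real \<Rightarrow> real) \<Rightarrow> real \<Rightarrow> real" where
  "tail_integral h r = rate_integral (\<lambda>s. indicator {r..} s * h s)"

lemma rate_integral_abs_le:
  assumes "unit_bounded h" "\<And>s. 0 \<le> s \<Longrightarrow> s \<le> 1 \<Longrightarrow> \<bar>h s\<bar> \<le> B"
  shows "\<bar>rate_integral h\<bar> \<le> B * \<tau> 1"
proof -
  have "rate_integral h \<le> rate_integral (\<lambda>_. B)" "rate_integral (\<lambda>_. - B) \<le> rate_integral h"
    using assms by (auto intro!: rate_integral_mono unit_bounded_intros simp: abs_le_iff minus_le_iff)
  then show ?thesis by (simp add: rate_integral_const)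
qed

end

lemma (in parisi_flow) unit_bounded_energy: "unit_bounded (energy \<alpha> S h)"
  by (rule unit_bounded_mono) (auto intro!: mono_onI energy_mono)

section \<open>Sums along the partition and integrals\<close>

context parisi_partition
begin

lemma tail_sum:
  assumes h: "unit_bounded h" and "k \<le> N"
  shows "(LINT s:{p k..<1}|lborel. F.\<rho> s * h s) = (\<Sum>i=k..<N. LINT s:{p i..<p (Suc i)}|lborel. F.\<rho> s * h s)"
  using \<open>k \<le> N\<close>
proof (induction rule: inc_induct)
  case base
  then show ?case by (simp add: p_N set_lebesgue_integral_def)
next
  case (step k)
  have r: "0 \<le> p k" "p k < p (Suc k)" "p (Suc k) \<le> 1" "0 \<le> p (Suc k)"
    using step p_range[of k] p_range[of "Suc k"] p_less[of k] by auto
  have "{p k..<1} = {p k..<p (Suc k)} \<union> {p (Suc k)..<1}" using r by auto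
  then have "(LINT s:{p k..<1}|lborel. F.\<rho> s * h s)
      = (LINT s:{p k..<p (Suc k)}|lborel. F.\<rho> s * h s) + (LINT s:{p (Suc k)..<1}|lborel. F.\<rho> s * h s)"
    using r by (simp only:) (intro set_integral_Un F.set_integrable_rate h; force)
  then show ?case using step by (simp add: sum.atLeast_Suc_lessThan)
qed

lemma \<Delta>_const:
  assumes "i < N" "s \<in> {p i..<p (Suc i)}"
  shows "\<alpha>1 s - \<alpha> s = \<Delta> i"
proof (cases "s = p i")
  case False
  then have s: "0 \<le> p i" "p i < s" "s < 1" using assms p_range[of i] p_range[of "Suc i"] by auto
  have "S \<inter> {p i<..s} = {}" "S1 \<inter> {p i<..s} = {}"
    using p_S[OF assms(1)] p_S1[OF assms(1)] assms(2) by (auto simp: disjoint_iff)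
  then show ?thesis using F.\<alpha>_const[OF s] F1.\<alpha>_const[OF s] by (simp add: \<Delta>_def)
qed (simp add: \<Delta>_def)

lemma \<Delta>_abs: "\<bar>\<Delta> i\<bar> \<le> 1"
  using F.\<alpha>_nonneg[of "p i"] F.\<alpha>_le_1[of "p i"] F1.\<alpha>_nonneg[of "p i"] F1.\<alpha>_le_1[of "p i"]
  by (simp add: \<Delta>_def abs_le_iff)

lemma piece_const:
  assumes "i < N"
  shows "(LINT s:{p i..<p (Suc i)}|lborel. F.\<rho> s * ((\<alpha>1 s - \<alpha> s) * g s))
    = \<Delta> i * (LINT s:{p i..<p (Suc i)}|lborel. F.\<rho> s * g s)"
proof -
  have "(LINT s:{p i..<p (Suc i)}|lborel. F.\<rho> s * ((\<alpha>1 s - \<alpha> s) * g s))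
      = (LINT s:{p i..<p (Suc i)}|lborel. \<Delta> i * (F.\<rho> s * g s))"
    using \<Delta>_const[OF assms] by (intro set_lebesgue_integral_cong) auto
  then show ?thesis by simp
qed

lemma A_eq_tail_integral:
  assumes \<alpha>: "unit_bounded \<alpha>" "unit_bounded \<alpha>1" and "k \<le> N"
  shows "F.tail_integral (\<lambda>s. \<alpha>1 s - \<alpha> s) (p k) = A k"
proof -
  have ub: "unit_bounded (\<lambda>s. \<alpha>1 s - \<alpha> s)" by (intro unit_bounded_intros \<alpha>)
  have r: "0 \<le> p k" "p k \<le> 1" using p_range \<open>k \<le> N\<close> by auto
  have "F.tail_integral (\<lambda>s. \<alpha>1 s - \<alpha> s) (p k) = (LINT s:{p k..1}|lborel. F.\<rho> s * (\<alpha>1 s - \<alpha> s))"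
    unfolding F.tail_integral_def F.rate_integral_def set_lebesgue_integral_def
    by (rule Bochner_Integration.integral_cong[OF refl]) (use r in \<open>auto simp: indicator_def\<close>)
  also have "\<dots> = (LINT s:{p k..<1}|lborel. F.\<rho> s * (\<alpha>1 s - \<alpha> s))"
    using r by (intro F.set_integral_half_open[symmetric] F.set_integrable_rate ub) auto
  also have "\<dots> = (\<Sum>i=k..<N. LINT s:{p i..<p (Suc i)}|lborel. F.\<rho> s * ((\<alpha>1 s - \<alpha> s) * 1))"
    using tail_sum[OF ub \<open>k \<le> N\<close>] by simp
  also have "\<dots> = A k"
    unfolding A_def
  proof (rule sum.cong[OF refl])
    fix i assume i: "i \<in> {k..<N}"
    then have "(LINT s:{p i..<p (Suc i)}|lborel. F.\<rho> s) = \<delta> i"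
      unfolding \<delta>_def using p_range[of i] p_range[of "Suc i"] p_less[of i]
      by (intro F.integral_rate_half_open) auto
    then show "(LINT s:{p i..<p (Suc i)}|lborel. F.\<rho> s * ((\<alpha>1 s - \<alpha> s) * 1)) = \<Delta> i * \<delta> i"
      using i by (subst piece_const) auto
  qed
  finally show ?thesis .
qed

text \<open>The levels are constant on each piece, so only \<open>G\<close> is discretized. Being
  monotone, it makes the error on a piece at most the mesh times its increment, and the increments
  telescope to at most 1; no continuity of the energy is involved.\<close>

lemma riemann_sum_le:
  assumes \<alpha>: "unit_bounded \<alpha>" "unit_bounded \<alpha>1" and mesh: "\<And>i. i < N \<Longrightarrow> \<delta> i \<le> \<kappa>" and "0 \<le> \<kappa>"
    and G: "mono_on {0..1} G" "0 \<le> G 0" "G 1 \<le> 1"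
  shows "F.rate_integral (\<lambda>s. (\<alpha>1 s - \<alpha> s) * G s) - \<kappa> \<le> (\<Sum>i<N. \<Delta> i * \<delta> i * G (p i))"
proof -
  have ubG: "unit_bounded G" by (rule unit_bounded_mono[OF G(1)])
  have ub: "unit_bounded (\<lambda>s. (\<alpha>1 s - \<alpha> s) * G s)" by (intro unit_bounded_intros \<alpha> ubG)
  have "F.rate_integral (\<lambda>s. (\<alpha>1 s - \<alpha> s) * G s) = (LINT s:{p 0..<1}|lborel. F.\<rho> s * ((\<alpha>1 s - \<alpha> s) * G s))"
    unfolding F.rate_integral_def p_0 by (intro F.set_integral_half_open[symmetric] F.set_integrable_rate ub) auto
  also have "\<dots> = (\<Sum>i=0..<N. LINT s:{p i..<p (Suc i)}|lborel. F.\<rho> s * ((\<alpha>1 s - \<alpha> s) * G s))"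
    by (rule tail_sum[OF ub]) simp
  also have "\<dots> \<le> (\<Sum>i=0..<N. \<Delta> i * \<delta> i * G (p i) + \<kappa> * (G (p (Suc i)) - G (p i)))"
  proof (rule sum_mono)
    fix i assume "i \<in> {0..<N}"
    then have i: "i < N" by simp
    define I where "I = (LINT s:{p i..<p (Suc i)}|lborel. F.\<rho> s * G s)"
    have r: "0 \<le> p i" "p i < p (Suc i)" "p (Suc i) \<le> 1"
      using i p_range[of i] p_range[of "Suc i"] p_less[of i] by auto
    have int: "set_integrable lborel {p i..<p (Suc i)} (\<lambda>s. F.\<rho> s * h s)" if "unit_bounded h" for h
      using r by (intro F.set_integrable_rate that) auto
    have c: "(LINT s:{p i..<p (Suc i)}|lborel. F.\<rho> s * k) = \<delta> i * k" for k
      unfolding \<delta>_def using F.integral_rate_half_open[of "p i" "p (Suc i)"] r by simp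
    have "(LINT s:{p i..<p (Suc i)}|lborel. F.\<rho> s * G (p i)) \<le> I"
      unfolding I_def using r F.rate_nonneg
      by (intro set_integral_mono int ubG unit_bounded_const mult_left_mono mono_onD[OF G(1)]) auto
    moreover have "I \<le> (LINT s:{p i..<p (Suc i)}|lborel. F.\<rho> s * G (p (Suc i)))"
      unfolding I_def using r F.rate_nonneg
      by (intro set_integral_mono int ubG unit_bounded_const mult_left_mono mono_onD[OF G(1)]) auto
    ultimately have I: "0 \<le> I - \<delta> i * G (p i)" "I - \<delta> i * G (p i) \<le> \<delta> i * (G (p (Suc i)) - G (p i))"
      unfolding c by (auto simp: algebra_simps)
    have Gd: "0 \<le> G (p (Suc i)) - G (p i)" using r mono_onD[OF G(1), of "p i" "p (Suc i)"] by simp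
    have "\<Delta> i * (I - \<delta> i * G (p i)) \<le> 1 * (I - \<delta> i * G (p i))"
      using I(1) \<Delta>_abs[of i] by (intro mult_right_mono) (auto simp: abs_le_iff)
    also have "\<dots> \<le> \<kappa> * (G (p (Suc i)) - G (p i))"
      using I(2) mult_right_mono[OF mesh[OF i] Gd] by simp
    finally show "(LINT s:{p i..<p (Suc i)}|lborel. F.\<rho> s * ((\<alpha>1 s - \<alpha> s) * G s))
        \<le> \<Delta> i * \<delta> i * G (p i) + \<kappa> * (G (p (Suc i)) - G (p i))"
      unfolding piece_const[OF i] I_def by (simp add: algebra_simps)
  qed
  also have "\<dots> = (\<Sum>i<N. \<Delta> i * \<delta> i * G (p i)) + \<kappa> * (G (p N) - G (p 0))"
    unfolding sum.distrib sum_distrib_left[symmetric] atLeast0LessThan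
    using sum_lessThan_telescope[of "\<lambda>i. G (p i)" N] by simp
  also have "\<kappa> * (G (p N) - G (p 0)) \<le> \<kappa> * 1"
    using G \<open>0 \<le> \<kappa>\<close> unfolding p_0 p_N by (intro mult_left_mono) auto
  finally show ?thesis by simp
qed

text \<open>Summation by parts, with \<open>A N = 0\<close>, puts the differences on
  \<open>G\<close>. All terms are then nonnegative, and those outside the window from
  \<open>k\<close> to \<open>l\<close> are dropped.\<close>

lemma abel_sum_ge:
  assumes G: "\<And>i. i < N \<Longrightarrow> G i \<le> G (Suc i)" "0 \<le> G 0"
    and kl: "k \<le> l" "l < N" and \<eta>: "\<And>i. k \<le> i \<Longrightarrow> i \<le> l \<Longrightarrow> \<eta> \<le> (A i)\<^sup>2"
  shows "\<eta> * (G l - G k) \<le> (\<Sum>i<N. ((A i)\<^sup>2 - (A (Suc i))\<^sup>2) * G i)"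
proof -
  have abel: "(\<Sum>i<n. ((A i)\<^sup>2 - (A (Suc i))\<^sup>2) * G i)
      = (A 0)\<^sup>2 * G 0 + (\<Sum>i<n. (A (Suc i))\<^sup>2 * (G (Suc i) - G i)) - (A n)\<^sup>2 * G n" for n
    by (induction n) (auto simp: algebra_simps)
  have "\<eta> * (G l - G k) = (\<Sum>i=k..<l. \<eta> * (G (Suc i) - G i))"
    unfolding sum_distrib_left[symmetric] using sum_Suc_diff'[OF kl(1), of G] by simp
  also have "\<dots> \<le> (\<Sum>i=k..<l. (A (Suc i))\<^sup>2 * (G (Suc i) - G i))"
    using kl by (intro sum_mono mult_right_mono \<eta>) (auto simp: G)
  also have "\<dots> \<le> (\<Sum>i<N. (A (Suc i))\<^sup>2 * (G (Suc i) - G i))"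
    using kl by (intro sum_mono2) (auto simp: G)
  also have "\<dots> \<le> (\<Sum>i<N. ((A i)\<^sup>2 - (A (Suc i))\<^sup>2) * G i)"
    using G(2) unfolding abel by (simp add: A_def)
  finally show ?thesis .
qed

end

lemma fine_partition_exists:
  fixes P :: "real set"
  assumes "finite P" "P \<subseteq> {0..1}" "0 < n"
  obtains p :: "nat \<Rightarrow> real" and N where "p 0 = 0" "p N = 1" "\<And>i. i < N \<Longrightarrow> p i < p (Suc i)"
    "\<And>i. i < N \<Longrightarrow> P \<inter> {p i<..<p (Suc i)} = {}" "\<And>q. q \<in> P \<Longrightarrow> \<exists>i\<le>N. p i = q"
    "\<And>i. i < N \<Longrightarrow> p (Suc i) - p i \<le> 1 / real n"
proof -
  define X where "X = P \<union> {0, 1} \<union> (\<lambda>j. real j / real n) ` {0..n}"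
  define xs where "xs = sorted_list_of_set X"
  define N where "N = length xs - 1"
  have X: "finite X" "X \<subseteq> {0..1}" "0 \<in> X" "1 \<in> X"
    using assms by (auto simp: X_def)
  have set: "set xs = X" and sorted: "sorted_wrt (<) xs"
    using X by (auto simp: xs_def)
  have len: "length xs = Suc N"
    using set X(3) by (cases xs) (auto simp: N_def)
  have less: "xs ! i < xs ! j" if "i < j" "j \<le> N" for i j
    using sorted_wrt_nth_less[OF sorted, of i j] that len by simp
  have mem: "xs ! i \<in> X" if "i \<le> N" for i using that len set by (metis nth_mem le_imp_less_Suc)
  have ex: "\<exists>i\<le>N. xs ! i = q" if "q \<in> X" for q
    using that set len by (metis in_set_conv_nth less_Suc_eq_le)
  have gap: "q \<le> xs ! i \<or> xs ! Suc i \<le> q" if iN: "i < N" and qX: "q \<in> X" for i q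
  proof -
    obtain j where j: "j \<le> N" "xs ! j = q" using ex[OF qX] by blast
    show ?thesis
    proof (cases "j \<le> i")
      case True then show ?thesis using less[of j i] j iN by (cases "j = i") (auto intro: less_imp_le)
    next
      case False then show ?thesis using less[of "Suc i" j] j iN by (cases "j = Suc i") (auto intro: less_imp_le)
    qed
  qed
  show ?thesis
  proof (rule that[of "\<lambda>i. xs ! i" N])
    obtain i where i: "i \<le> N" "xs ! i = 0" using ex[OF X(3)] by blast
    then show "xs ! 0 = 0"
      using less[of 0 i] mem[of 0] X(2) by (cases "i = 0") force+
    obtain k where k: "k \<le> N" "xs ! k = 1" using ex[OF X(4)] by blast
    then show "xs ! N = 1"
      using less[of k N] mem[of N] X(2) by (cases "k = N") force+
    fix i assume i: "i < N"
    show "xs ! i < xs ! Suc i" using less[of i "Suc i"] i by simp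
    show "P \<inter> {xs ! i<..<xs ! Suc i} = {}"
    proof -
      have False if "q \<in> P" "xs ! i < q" "q < xs ! Suc i" for q
        using gap[OF i, of q] that by (auto simp: X_def)
      then show ?thesis by auto
    qed
    show "xs ! Suc i - xs ! i \<le> 1 / real n"
    proof -
      \<comment> \<open>\<open>j / n\<close> is the last grid point not to the right of
        \<open>xs ! i\<close>. The next grid point bounds the successor, unless it lies beyond 1,
        and then 1 does.\<close>
      define j where "j = nat \<lfloor>real n * (xs ! i)\<rfloor>"
      have xi: "0 \<le> xs ! i" "xs ! Suc i \<le> 1" using mem[of i] mem[of "Suc i"] X(2) i by auto
      have fl: "real j \<le> real n * (xs ! i)" "real n * (xs ! i) < real j + 1"
        using xi by (auto simp: j_def)
      then have fl': "real j / real n \<le> xs ! i" "xs ! i < real (Suc j) / real n"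
        using \<open>0 < n\<close> by (auto simp: field_simps)
      have "xs ! Suc i \<le> real (Suc j) / real n"
      proof (cases "Suc j \<le> n")
        case True
        then have "real (Suc j) / real n \<in> (\<lambda>j. real j / real n) ` {0..n}"
          by (intro image_eqI[of _ _ "Suc j"]) auto
        then have "real (Suc j) / real n \<in> X" unfolding X_def by blast
        from gap[OF i this] fl' show ?thesis by linarith
      next
        case False
        then have "1 \<le> real (Suc j) / real n" using \<open>0 < n\<close> by simp
        then show ?thesis using xi by linarith
      qed
      also have "real (Suc j) / real n = real j / real n + 1 / real n" by (simp add: add_divide_distrib)
      finally show ?thesis using fl' by linarith
    qed
  next
    fix q assume "q \<in> P"
    then show "\<exists>i\<le>N. xs ! i = q" by (intro ex) (simp add: X_def)
  qed
qed

section \<open>The continuous comparison and its consequences\<close>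

context clock
begin

lemma clock_lipschitz: "\<exists>B\<ge>0. \<forall>s t. 0 \<le> s \<longrightarrow> s \<le> t \<longrightarrow> t \<le> 1 \<longrightarrow> \<tau> t - \<tau> s \<le> B * (t - s)"
proof -
  obtain B where B: "0 \<le> B" "\<And>s. 0 \<le> s \<Longrightarrow> s \<le> 1 \<Longrightarrow> \<bar>\<rho> s\<bar> \<le> B"
    using rate_unit_bounded by (rule unit_boundedE) blast
  have "\<tau> t - \<tau> s \<le> B * (t - s)" if st: "0 \<le> s" "s \<le> t" "t \<le> 1" for s t
  proof -
    have "norm (\<tau> t - \<tau> s) \<le> B * norm (t - s)"
      by (rule field_differentiable_bound[of "{0..1}" \<tau> \<rho>])
         (use st B in \<open>auto intro!: has_field_derivative_at_within[OF clock_deriv]\<close>)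
    then show ?thesis using st by (simp add: abs_le_iff)
  qed
  then show ?thesis using B(1) by blast
qed

text \<open>The price of the linearization per \<open>t^2\<close>. It depends on the base flow
  alone, so \<open>t\<close> can be chosen after the target has been approximated.\<close>

definition "penalty \<alpha> S h = (\<tau> 1)\<^sup>2 / 2 * kev \<alpha> S 0 1 (\<lambda>x. exp (2 * \<bar>x\<bar> + 2 * \<tau> 1)) h"

lemma phi_lower_bound_positive:
  assumes step: "step_function \<alpha> S" "step_function \<alpha>1 S1" and ub: "unit_bounded \<alpha>" "unit_bounded \<alpha>1"
    and \<epsilon>: "0 < \<epsilon>" "\<And>s. \<epsilon> \<le> \<alpha>1 s" and t: "0 \<le> t" and ab: "0 \<le> a" "a \<le> b" "b < 1"
    and \<eta>: "\<And>s. a \<le> s \<Longrightarrow> s \<le> b \<Longrightarrow> \<eta> \<le> (tail_integral (\<lambda>s. \<alpha>1 s - \<alpha> s) s)\<^sup>2"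
  shows "phi \<alpha>1 S1 0 h \<ge> phi \<alpha> S 0 h + rate_integral (\<lambda>s. (\<alpha>1 s - \<alpha> s) * energy \<alpha> S h s) / 2
    + t * (\<eta> * (energy \<alpha> S h b - energy \<alpha> S h a)) - t\<^sup>2 * penalty \<alpha> S h"
proof -
  interpret F: parisi_flow \<beta> \<gamma> \<alpha> S by unfold_locales (rule step)
  interpret F1: parisi_flow \<beta> \<gamma> \<alpha>1 S1 by unfold_locales (rule step)
  obtain B where B: "0 \<le> B" "\<And>s t. 0 \<le> s \<Longrightarrow> s \<le> t \<Longrightarrow> t \<le> 1 \<Longrightarrow> \<tau> t - \<tau> s \<le> B * (t - s)"
    using clock_lipschitz by blast
  obtain C where C: "0 \<le> C" "\<And>f c m v x. c11 F.smoothness f c \<Longrightarrow> 0 \<le> m \<Longrightarrow> m \<le> 1 \<Longrightarrow> 0 < v \<Longrightarrow> v \<le> \<tau> 1 \<Longrightarrow>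
      twist m v f f x - hopf_cole_step m v f x \<le> m * v * (twist m v f c x)\<^sup>2 / 2 + C * (v * sqrt v)"
    using gap_upper[OF F.smoothness_ge_1, of "\<tau> 1"] by blast
  define X where "X = phi \<alpha> S 0 h + rate_integral (\<lambda>s. (\<alpha>1 s - \<alpha> s) * energy \<alpha> S h s) / 2
    + t * (\<eta> * (energy \<alpha> S h b - energy \<alpha> S h a)) - t\<^sup>2 * penalty \<alpha> S h"
  \<comment> \<open>Half of the Riemann error plus the sum of the step errors
    \<open>\<delta> i * sqrt (\<delta> i)\<close>, which is at most \<open>sqrt \<kappa>\<close>
    times the total clock. Both vanish with the mesh for fixed \<open>\<epsilon>\<close>.\<close>
  define err where "err \<kappa> = \<kappa> / 2 + C / \<epsilon> * (sqrt \<kappa> * \<tau> 1)" for \<kappa>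
  have bound: "X - err (B / real n) \<le> phi \<alpha>1 S1 0 h" if npos: "0 < n" for n
  proof -
    define \<kappa> where "\<kappa> = B / real n"
    have \<kappa>0: "0 \<le> \<kappa>" using B by (simp add: \<kappa>_def)
    have PS: "finite (S \<union> S1 \<union> {a, b})" "S \<union> S1 \<union> {a, b} \<subseteq> {0..1}"
      using F.finite_S F1.finite_S F.S_sub F1.S_sub ab by auto
    obtain p N where p: "p 0 = 0" "p N = 1" "\<And>i. i < N \<Longrightarrow> p i < p (Suc i)"
      "\<And>i. i < N \<Longrightarrow> (S \<union> S1 \<union> {a, b}) \<inter> {p i<..<p (Suc i)} = {}"
      "\<And>q. q \<in> S \<union> S1 \<union> {a, b} \<Longrightarrow> \<exists>i\<le>N. p i = q"
      "\<And>i. i < N \<Longrightarrow> p (Suc i) - p i \<le> 1 / real n"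
      by (rule fine_partition_exists[OF PS npos]) blast
    have pS: "S \<inter> {p i<..<p (Suc i)} = {}" "S1 \<inter> {p i<..<p (Suc i)} = {}" if "i < N" for i
      using p(4)[OF that] by blast+
    interpret P: parisi_partition \<beta> \<gamma> \<alpha> S \<alpha>1 S1 p N
      by unfold_locales (rule p(1-3) pS | assumption)+
    obtain k where k: "k \<le> N" "p k = a" using p(5)[of a] by auto
    obtain l where l: "l \<le> N" "p l = b" using p(5)[of b] by auto
    \<comment> \<open>The points \<open>a\<close> and \<open>b\<close> were put into the partition
      in order to become the window of \<open>abel_sum_ge\<close>, which must end strictly before
      the last index.\<close>
    have lN: "l < N" using l p(2) ab by (cases "l = N") auto
    have kl: "k \<le> l"
    proof (rule ccontr)
      assume "\<not> k \<le> l"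
      then have "p (Suc l) \<le> p k" using k by (intro P.p_mono) auto
      then show False using P.p_less[OF lN] k l ab by simp
    qed
    have mesh: "P.\<delta> i \<le> \<kappa>" if i: "i < N" for i
    proof -
      have "P.\<delta> i \<le> B * (p (Suc i) - p i)"
        unfolding P.\<delta>_def using P.p_range[of i] P.p_range[of "Suc i"] P.p_less[OF i] i by (intro B) auto
      also have "\<dots> \<le> B * (1 / real n)" using B p(6)[OF i] by (intro mult_left_mono) auto
      finally show ?thesis by (simp add: \<kappa>_def)
    qed
    have 1: "rate_integral (\<lambda>s. (\<alpha>1 s - \<alpha> s) * energy \<alpha> S h s) - \<kappa> \<le> (\<Sum>i<N. P.\<Delta> i * P.\<delta> i * energy \<alpha> S h (p i))"
      by (rule P.riemann_sum_le[OF ub mesh \<kappa>0]) (auto intro!: mono_onI F.energy_mono F.energy_bounds)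
    have 2: "\<eta> * (energy \<alpha> S h (p l) - energy \<alpha> S h (p k)) \<le> (\<Sum>i<N. ((P.A i)\<^sup>2 - (P.A (Suc i))\<^sup>2) * energy \<alpha> S h (p i))"
    proof (rule P.abel_sum_ge[OF _ _ kl lN])
      show "energy \<alpha> S h (p i) \<le> energy \<alpha> S h (p (Suc i))" if "i < N" for i
        using that P.p_range[of i] P.p_range[of "Suc i"] P.p_less[of i] by (intro F.energy_mono) auto
      show "0 \<le> energy \<alpha> S h (p 0)" by (simp add: p(1) F.energy_bounds)
      show "\<eta> \<le> (P.A i)\<^sup>2" if "k \<le> i" "i \<le> l" for i
        using P.p_mono[of k i] P.p_mono[of i l] that k l
        by (subst P.A_eq_tail_integral[OF ub, symmetric]) (auto intro!: \<eta>)
    qed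
    have 3: "(\<Sum>i<N. P.\<delta> i * sqrt (P.\<delta> i)) \<le> sqrt \<kappa> * \<tau> 1"
    proof -
      have "(\<Sum>i<N. P.\<delta> i * sqrt (P.\<delta> i)) \<le> (\<Sum>i<N. P.\<delta> i * sqrt \<kappa>)"
        using P.\<delta>_pos mesh by (intro sum_mono mult_left_mono) (auto intro: less_imp_le)
      also have "\<dots> = (\<tau> (p N) - \<tau> (p 0)) * sqrt \<kappa>"
        unfolding sum_distrib_right[symmetric] P.\<delta>_def
        using sum_lessThan_telescope[of "\<lambda>i. \<tau> (p i)" N] by simp
      finally show ?thesis by (simp add: p(1,2) clock_0 mult.commute)
    qed
    have "(\<Sum>i<N. (P.\<Delta> i * P.\<delta> i / 2 + t * ((P.A i)\<^sup>2 - (P.A (Suc i))\<^sup>2)) * energy \<alpha> S h (p i))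
        = (\<Sum>i<N. P.\<Delta> i * P.\<delta> i * energy \<alpha> S h (p i)) / 2
          + t * (\<Sum>i<N. ((P.A i)\<^sup>2 - (P.A (Suc i))\<^sup>2) * energy \<alpha> S h (p i))"
      unfolding sum_divide_distrib sum_distrib_left sum.distrib[symmetric]
      by (intro sum.cong refl) (simp add: algebra_simps)
    also have "\<dots> \<ge> (rate_integral (\<lambda>s. (\<alpha>1 s - \<alpha> s) * energy \<alpha> S h s) - \<kappa>) / 2
          + t * (\<eta> * (energy \<alpha> S h b - energy \<alpha> S h a))"
      using 1 2 t k l by (intro add_mono divide_right_mono mult_left_mono) auto
    finally have 4: "(rate_integral (\<lambda>s. (\<alpha>1 s - \<alpha> s) * energy \<alpha> S h s) - \<kappa>) / 2
          + t * (\<eta> * (energy \<alpha> S h b - energy \<alpha> S h a))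
          \<le> (\<Sum>i<N. (P.\<Delta> i * P.\<delta> i / 2 + t * ((P.A i)\<^sup>2 - (P.A (Suc i))\<^sup>2)) * energy \<alpha> S h (p i))" .
    have 5: "C / \<epsilon> * (\<Sum>i<N. P.\<delta> i * sqrt (P.\<delta> i)) \<le> C / \<epsilon> * (sqrt \<kappa> * \<tau> 1)"
      using 3 C(1) \<epsilon>(1) by (intro mult_left_mono) auto
    have "phi \<alpha>1 S1 0 h \<ge> phi \<alpha> S 0 h
      + (\<Sum>i<N. (P.\<Delta> i * P.\<delta> i / 2 + t * ((P.A i)\<^sup>2 - (P.A (Suc i))\<^sup>2)) * energy \<alpha> S h (p i))
      - t\<^sup>2 * (\<tau> 1)\<^sup>2 / 2 * kev \<alpha> S 0 1 P.weight h - C / \<epsilon> * (\<Sum>i<N. P.\<delta> i * sqrt (P.\<delta> i))"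
      by (rule P.discrete_lower_bound[OF \<epsilon> t C])
    then show ?thesis
      using 4 5 unfolding X_def err_def penalty_def P.weight_def[abs_def] \<kappa>_def[symmetric] diff_divide_distrib by simp
  qed
  have "(\<lambda>n. X - err (B / real n)) \<longlonglongrightarrow> X - (0 / 2 + C / \<epsilon> * (sqrt 0 * \<tau> 1))"
    unfolding err_def by (intro tendsto_intros lim_const_over_n) auto
  then have "(\<lambda>n. X - err (B / real n)) \<longlonglongrightarrow> X" by simp
  then have "X \<le> phi \<alpha>1 S1 0 h"
    by (rule LIMSEQ_le_const2) (use bound in \<open>auto intro!: exI[of _ 1]\<close>)
  then show ?thesis by (simp add: X_def)
qed

text \<open>Both quantities are finite compositions of steps, each continuous in level and function.
  Convergence of the levels before time 1 suffices because a level is read only at the left end of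
  an interval.\<close>

lemma
  assumes F: "\<And>n. step_function (A n) S" and f: "step_function \<alpha> S"
    and lim: "\<And>s. 0 \<le> s \<Longrightarrow> s < 1 \<Longrightarrow> (\<lambda>n. A n s) \<longlonglongrightarrow> \<alpha> s"
  shows phi_tendsto: "0 \<le> s \<Longrightarrow> s \<le> 1 \<Longrightarrow> (\<lambda>n. phi (A n) S s x) \<longlonglongrightarrow> phi \<alpha> S s x"
    and energy_tendsto: "0 \<le> s \<Longrightarrow> s \<le> 1 \<Longrightarrow> (\<lambda>n. energy (A n) S h s) \<longlonglongrightarrow> energy \<alpha> S h s"
proof -
  have flow: "parisi_flow \<beta> \<gamma> (A n) S" for n by unfold_locales (rule F)
  interpret f: parisi_flow \<beta> \<gamma> \<alpha> S by unfold_locales (rule f)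
  have both: "\<forall>x. (\<lambda>n. phi (A n) S s x) \<longlonglongrightarrow> phi \<alpha> S s x \<and> (\<lambda>n. dphi (A n) S s x) \<longlonglongrightarrow> dphi \<alpha> S s x"
    if "0 \<le> s" "s \<le> 1" for s
    using f.finite_S that
  proof (induction rule: next_jump_induct)
    case last
    then show ?case by (simp add: phi_1 dphi_def)
  next
    case (step s)
    note nj = next_jump[OF f.finite_S step(2)]
    define n where "n = next_jump S 1 s"
    have n: "0 \<le> n" "n \<le> 1" "s < n" "S \<inter> {s<..<n} = {}" using nj step by (auto simp: n_def)
    have v: "0 < \<tau> n - \<tau> s" using clock_strict_mono[of s n] n step by simp
    note eq = parisi_flow.phi_step[OF flow step(1) n(3,2,4)] parisi_flow.dphi_step[OF flow step(1) n(3,2,4)]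
      f.phi_step[OF step(1) n(3,2,4)] f.dphi_step[OF step(1) n(3,2,4)]
    have P: "(\<lambda>i. phi (A i) S n u) \<longlonglongrightarrow> phi \<alpha> S n u" "(\<lambda>i. dphi (A i) S n u) \<longlonglongrightarrow> dphi \<alpha> S n u" for u
      using step(3) by (auto simp: n_def)
    show ?case unfolding eq
      by (intro allI conjI hopf_cole_step_tendsto twist_tendsto[where k=1] P lim v
          parisi_flow.phi_lip1[OF flow] f.phi_lip1 parisi_flow.dphi_bound[OF flow] n step(1,2)
          parisi_flow.\<alpha>_nonneg[OF flow] parisi_flow.\<alpha>_le_1[OF flow]
          exp_bounded_measurable parisi_flow.exp_bounded_dphi[OF flow] f.exp_bounded_dphi)
  qed
  have kev: "\<forall>x. (\<lambda>n. kev (A n) S s t (g n) x) \<longlonglongrightarrow> kev \<alpha> S s t g0 x"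
    if st: "0 \<le> s" "s \<le> t" "t \<le> 1" and g: "\<And>n. exp_bounded (g n)" "exp_bounded g0" "\<And>n u. 0 \<le> g n u" "\<And>n u. g n u \<le> 1"
      "\<And>u. (\<lambda>n. g n u) \<longlonglongrightarrow> g0 u" for s t g g0
    using f.finite_S st(1,2)
  proof (induction rule: next_jump_induct)
    case last
    then show ?case using g by (simp add: kev_refl)
  next
    case (step s)
    note nj = next_jump[OF f.finite_S step(2)]
    define n where "n = next_jump S t s"
    have n: "0 \<le> n" "n \<le> 1" "s < n" "n \<le> t" "S \<inter> {s<..<n} = {}" using nj step st by (auto simp: n_def)
    have v: "0 < \<tau> n - \<tau> s" using clock_strict_mono[of s n] n step by simp
    have bd: "\<bar>kev (A i) S n t (g i) u\<bar> \<le> 1" for i u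
    proof -
      have "kev (A i) S n t (\<lambda>_. 0) u \<le> kev (A i) S n t (g i) u" "kev (A i) S n t (g i) u \<le> kev (A i) S n t (\<lambda>_. 1) u"
        using n st g by (auto intro!: parisi_flow.kev_mono[OF flow] exp_bounded_const)
      then show ?thesis using n st by (simp add: parisi_flow.kev_const[OF flow] abs_le_iff)
    qed
    have IH: "(\<lambda>i. kev (A i) S n t (g i) u) \<longlonglongrightarrow> kev \<alpha> S n t g0 u" for u using step(3) by (simp add: n_def)
    have s1: "s < 1" using step st by simp
    show ?case
      unfolding kev_next[OF f.finite_S step(2)] n_def[symmetric]
      by (intro allI twist_tendsto[where k=1] bd IH both[rule_format, THEN conjunct1] lim v
          parisi_flow.phi_lip1[OF flow] f.phi_lip1 n step(1) s1 st
          parisi_flow.\<alpha>_nonneg[OF flow] parisi_flow.\<alpha>_le_1[OF flow]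
          exp_bounded_measurable parisi_flow.exp_bounded_kev[OF flow] f.exp_bounded_kev g)
  qed
  show "0 \<le> s \<Longrightarrow> s \<le> 1 \<Longrightarrow> (\<lambda>n. phi (A n) S s x) \<longlonglongrightarrow> phi \<alpha> S s x"
    using both by blast
  show "(\<lambda>n. energy (A n) S h s) \<longlonglongrightarrow> energy \<alpha> S h s" if s: "0 \<le> s" "s \<le> 1"
  proof -
    have "(dphi (A n) S s u)\<^sup>2 \<le> 1" for n u
      using parisi_flow.dphi_bound[OF flow s, of n u] by (simp add: abs_square_le_1)
    moreover have "(\<lambda>n. (dphi (A n) S s u)\<^sup>2) \<longlonglongrightarrow> (dphi \<alpha> S s u)\<^sup>2" for u
      using both[OF s] by (intro tendsto_power) blast
    ultimately show ?thesis
      unfolding energy_def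
      using kev[of 0 s "\<lambda>n u. (dphi (A n) S s u)\<^sup>2" "\<lambda>u. (dphi \<alpha> S s u)\<^sup>2"] s
      by (simp add: exp_bounded_power parisi_flow.exp_bounded_dphi[OF flow] f.exp_bounded_dphi)
  qed
qed

lemma step_function_max:
  assumes "step_function \<alpha> S" "0 \<le> c" "c \<le> 1" shows "step_function (\<lambda>s. max (\<alpha> s) c) S"
  using assms unfolding step_function_def by (auto simp: max_def)

lemma unit_bounded_max:
  assumes "unit_bounded \<alpha>" shows "unit_bounded (\<lambda>s. max (\<alpha> s) c)"
proof -
  have "(\<lambda>s. max (\<alpha> s) c) = (\<lambda>s. (\<alpha> s + c + \<bar>\<alpha> s - c\<bar>) * (1 / 2))" by (auto simp: max_def abs_if)
  then show ?thesis by (simp only:) (intro unit_bounded_intros assms)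
qed

text \<open>The positive lower bound on the target level is removed by raising it to
  \<open>1 / (n + 1)\<close> and letting \<open>n\<close> grow. Here \<open>t = 0\<close>, so only
  the first-order part is kept.\<close>

lemma phi_lower_bound:
  assumes step: "step_function \<alpha> S" "step_function \<alpha>1 S1" and ub: "unit_bounded \<alpha>" "unit_bounded \<alpha>1"
  shows "phi \<alpha>1 S1 0 h \<ge> phi \<alpha> S 0 h + rate_integral (\<lambda>s. (\<alpha>1 s - \<alpha> s) * energy \<alpha> S h s) / 2"
proof -
  interpret F: parisi_flow \<beta> \<gamma> \<alpha> S by unfold_locales (rule step)
  define c where "c n = inverse (real (Suc n))" for n
  define A where "A n s = max (\<alpha>1 s) (c n)" for n s
  have c: "0 < c n" "c n \<le> 1" for n by (auto simp: c_def field_simps)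
  have c0: "c \<longlonglongrightarrow> 0" unfolding c_def by (rule LIMSEQ_inverse_real_of_nat)
  have stepA: "step_function (A n) S1" for n
    unfolding A_def using c by (intro step_function_max step) (auto intro: less_imp_le)
  have ubA: "unit_bounded (A n)" for n unfolding A_def by (intro unit_bounded_max ub)
  have lim: "(\<lambda>n. A n s) \<longlonglongrightarrow> \<alpha>1 s" for s
  proof -
    have "(\<lambda>n. max (\<alpha>1 s) (c n)) \<longlonglongrightarrow> max (\<alpha>1 s) 0" by (intro tendsto_max tendsto_const c0)
    then show ?thesis using step_functionD(3)[OF step(2), of s] by (simp add: A_def max_def)
  qed
  have "(\<lambda>n. rate_integral (\<lambda>s. (A n s - \<alpha> s) * energy \<alpha> S h s)) \<longlonglongrightarrow> rate_integral (\<lambda>s. (\<alpha>1 s - \<alpha> s) * energy \<alpha> S h s)"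
  proof (rule rate_integral_tendsto[where B=1])
    show "\<bar>(A n s - \<alpha> s) * energy \<alpha> S h s\<bar> \<le> 1" if "0 \<le> s" "s \<le> 1" for n s
    proof -
      have "\<bar>A n s - \<alpha> s\<bar> \<le> 1"
        using step_functionD(3,4)[OF stepA, of n s] F.\<alpha>_nonneg[of s] F.\<alpha>_le_1[of s] by (simp add: abs_le_iff)
      then show ?thesis
        using F.energy_bounds[OF that, of h] mult_mono[of "\<bar>A n s - \<alpha> s\<bar>" 1 "\<bar>energy \<alpha> S h s\<bar>" 1] by (simp add: abs_mult)
    qed
  qed (intro unit_bounded_intros ubA ub F.unit_bounded_energy tendsto_intros lim)+
  then have l1: "(\<lambda>n. phi \<alpha> S 0 h + rate_integral (\<lambda>s. (A n s - \<alpha> s) * energy \<alpha> S h s) / 2)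
      \<longlonglongrightarrow> phi \<alpha> S 0 h + rate_integral (\<lambda>s. (\<alpha>1 s - \<alpha> s) * energy \<alpha> S h s) / 2"
    by (intro tendsto_intros) auto
  have l2: "(\<lambda>n. phi (A n) S1 0 h) \<longlonglongrightarrow> phi \<alpha>1 S1 0 h"
    by (rule phi_tendsto[OF stepA step(2) lim]) auto
  have "phi \<alpha> S 0 h + rate_integral (\<lambda>s. (A n s - \<alpha> s) * energy \<alpha> S h s) / 2 \<le> phi (A n) S1 0 h" for n
    using phi_lower_bound_positive[OF step(1) stepA ub(1) ubA c(1), of n n 0 0 0 0 h]
    by (simp add: A_def)
  then show ?thesis by (intro LIMSEQ_le[OF l1 l2]) auto
qed

text \<open>The slope of the lower bound is an energy between 0 and 1; exchanging the roles of base
  and target gives the other inequality.\<close>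

lemma phi_lipschitz:
  assumes step: "step_function \<alpha> S" "step_function \<alpha>1 S1" and ub: "unit_bounded \<alpha>" "unit_bounded \<alpha>1"
  shows "\<bar>phi \<alpha>1 S1 0 h - phi \<alpha> S 0 h\<bar> \<le> rate_integral (\<lambda>s. \<bar>\<alpha>1 s - \<alpha> s\<bar>)"
proof -
  have one: "phi \<alpha> S 0 h - phi \<alpha>1 S1 0 h \<le> rate_integral (\<lambda>s. \<bar>\<alpha>1 s - \<alpha> s\<bar>)"
    if step: "step_function \<alpha> S" "step_function \<alpha>1 S1" and ub: "unit_bounded \<alpha>" "unit_bounded \<alpha>1" for \<alpha> S \<alpha>1 S1
  proof -
    interpret F: parisi_flow \<beta> \<gamma> \<alpha> S by unfold_locales (rule step)
    have "rate_integral (\<lambda>s. - \<bar>\<alpha>1 s - \<alpha> s\<bar>) \<le> rate_integral (\<lambda>s. (\<alpha>1 s - \<alpha> s) * energy \<alpha> S h s)"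
    proof (rule rate_integral_mono)
      show "- \<bar>\<alpha>1 s - \<alpha> s\<bar> \<le> (\<alpha>1 s - \<alpha> s) * energy \<alpha> S h s" if "0 \<le> s" "s \<le> 1" for s
      proof -
        have "\<bar>(\<alpha>1 s - \<alpha> s) * energy \<alpha> S h s\<bar> \<le> \<bar>\<alpha>1 s - \<alpha> s\<bar> * 1"
          unfolding abs_mult using F.energy_bounds[OF that, of h] by (intro mult_left_mono) auto
        then show ?thesis by (simp only: abs_le_iff mult_1_right) linarith
      qed
    qed (intro unit_bounded_intros ub F.unit_bounded_energy)+
    moreover have "rate_integral (\<lambda>s. - \<bar>\<alpha>1 s - \<alpha> s\<bar>) = - rate_integral (\<lambda>s. \<bar>\<alpha>1 s - \<alpha> s\<bar>)"
      using rate_integral_cmult[of "-1"] by simp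
    moreover have "0 \<le> rate_integral (\<lambda>s. \<bar>\<alpha>1 s - \<alpha> s\<bar>)"
      using rate_integral_mono[of "\<lambda>_. 0" "\<lambda>s. \<bar>\<alpha>1 s - \<alpha> s\<bar>"] ub
      by (simp add: rate_integral_const unit_bounded_intros)
    ultimately show ?thesis using phi_lower_bound[OF step ub, of h] by linarith
  qed
  have "rate_integral (\<lambda>s. \<bar>\<alpha> s - \<alpha>1 s\<bar>) = rate_integral (\<lambda>s. \<bar>\<alpha>1 s - \<alpha> s\<bar>)"
    by (simp add: abs_minus_commute)
  then show ?thesis using one[OF step ub] one[OF step(2,1) ub(2,1)] by (simp add: abs_le_iff)
qed

lemma
  assumes step: "step_function \<alpha> S" and S': "S \<subseteq> S'" "finite S'" "S' \<subseteq> {0..1}"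
  shows phi_refine: "0 \<le> s \<Longrightarrow> s \<le> 1 \<Longrightarrow> phi \<alpha> S' s = phi \<alpha> S s"
    and energy_refine: "0 \<le> s \<Longrightarrow> s \<le> 1 \<Longrightarrow> energy \<alpha> S' h s = energy \<alpha> S h s"
proof -
  interpret F: parisi_flow \<beta> \<gamma> \<alpha> S by unfold_locales (rule step)
  have phi: "phi \<alpha> S' s = phi \<alpha> S s" if "0 \<le> s" "s \<le> 1" for s
    using S'(2) that
  proof (induction rule: next_jump_induct)
    case (step s)
    note nj = next_jump[OF S'(2) step(2)]
    then have "S \<inter> {s<..<next_jump S' 1 s} = {}" using S'(1) by blast
    then show ?case
      unfolding phi_next[OF S'(2) step(2)] step(3) using nj step by (intro F.phi_step[symmetric]) auto
  qed (simp add: phi_1)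
  then show "0 \<le> s \<Longrightarrow> s \<le> 1 \<Longrightarrow> phi \<alpha> S' s = phi \<alpha> S s" by blast
  have kev: "kev \<alpha> S' s t g = kev \<alpha> S s t g" if st: "0 \<le> s" "s \<le> t" "t \<le> 1" and g: "exp_bounded g" for s t g
    using S'(2) st(1,2)
  proof (induction rule: next_jump_induct)
    case (step s)
    note nj = next_jump[OF S'(2) step(2)]
    then have "S \<inter> {s<..<next_jump S' t s} = {}" using S'(1) by blast
    moreover have "phi \<alpha> S' (next_jump S' t s) = phi \<alpha> S (next_jump S' t s)" using nj step st by (intro phi) auto
    ultimately show ?case
      unfolding kev_next[OF S'(2) step(2)] step(3) using nj step st g by (simp add: F.kev_step[symmetric])
  qed (simp add: kev_refl)
  show "energy \<alpha> S' h s = energy \<alpha> S h s" if "0 \<le> s" "s \<le> 1"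
    unfolding energy_def dphi_def phi[OF that] using that F.exp_bounded_dphi[OF that]
    by (simp add: kev exp_bounded_power dphi_def)
qed

end

lemma clockI:
  assumes "\<beta> > 0" and "\<exists>p\<ge>2. \<gamma> p \<noteq> 0" and sm: "summable (\<lambda>p. 2 ^ p * (\<gamma> p)\<^sup>2)"
  shows "clock \<beta> \<gamma>"
proof -
  \<comment> \<open>The coefficients of \<xi>, re-indexed to start at 0; \<open>d\<close> and
    \<open>e\<close> are those of its first two derivatives. The weight \<open>2 ^ p\<close> in the
    summability gives a radius of at least 2, which covers the endpoint 1.\<close>
  define c where "c n = (if n < 2 then 0 else \<beta>\<^sup>2 * (\<gamma> n)\<^sup>2)" for n :: nat
  define d where "d = diffs c"
  define e where "e = diffs d"
  have c0: "0 \<le> c n" for n by (simp add: c_def)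
  have d0: "0 \<le> d n" for n by (simp add: d_def diffs_def c0)
  have e0: "0 \<le> e n" for n by (simp add: e_def diffs_def d0)
  have "summable (\<lambda>n. \<beta>\<^sup>2 * (2 ^ n * (\<gamma> n)\<^sup>2))" by (intro summable_mult sm)
  then have c2: "summable (\<lambda>n. c n * 2 ^ n)"
    by (rule summable_comparison_test') (auto simp: c_def)
  have sc: "summable (\<lambda>n. c n * z ^ n)" if "norm z < 2" for z :: real
    by (rule powser_inside[OF c2]) (use that in simp)
  have sd: "summable (\<lambda>n. d n * z ^ n)" if "norm z < 2" for z :: real
    unfolding d_def by (rule termdiff_converges[OF that sc])
  have se: "summable (\<lambda>n. e n * z ^ n)" if "norm z < 2" for z :: real
    unfolding e_def by (rule termdiff_converges[OF that sd])
  have xi: "xi \<beta> \<gamma> s = (\<Sum>n. c n * s ^ n)" if "norm s < 2" for s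
    unfolding xi_def using suminf_split_initial_segment[OF sc[OF that], of 2]
    by (simp add: c_def eval_nat_numeral)
  have op: "open (ball 0 2 :: real set)" by simp
  have dxi: "(xi \<beta> \<gamma> has_real_derivative (\<Sum>n. d n * s ^ n)) (at s)" if "norm s < 2" for s
    unfolding d_def
    by (rule has_field_derivative_transform_within_open[OF termdiffs_strong'[OF sc that] op])
       (use that xi in auto)
  then have xi': "xi' \<beta> \<gamma> s = (\<Sum>n. d n * s ^ n)" if "norm s < 2" for s
    using that unfolding xi'_def by (intro DERIV_imp_deriv) auto
  have dxi': "(xi' \<beta> \<gamma> has_real_derivative (\<Sum>n. e n * s ^ n)) (at s)" if "norm s < 2" for s
    unfolding e_def
    by (rule has_field_derivative_transform_within_open[OF termdiffs_strong'[OF sd that] op])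
       (use that xi' in auto)
  then have xi'': "xi'' \<beta> \<gamma> s = (\<Sum>n. e n * s ^ n)" if "norm s < 2" for s
    using that unfolding xi''_def by (intro DERIV_imp_deriv) auto
  show ?thesis
  proof
    show "xi' \<beta> \<gamma> 0 = 0"
      by (subst xi') (simp_all add: powser_zero d_def diffs_def c_def)
    show "(xi' \<beta> \<gamma> has_real_derivative xi'' \<beta> \<gamma> s) (at s)" if "0 \<le> s" "s \<le> 1" for s
      using dxi'[of s] xi''[of s] that by simp
    show "continuous_on {0..1} (xi'' \<beta> \<gamma>)"
    proof (rule continuous_on_eq)
      show "continuous_on {0..1} (\<lambda>s. \<Sum>n. e n * s ^ n)"
        by (intro continuous_at_imp_continuous_on ballI DERIV_isCont[OF termdiffs_strong'[OF se]]) auto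
    qed (simp add: xi'')
    show "0 \<le> xi'' \<beta> \<gamma> 0"
      by (subst xi'') (simp_all add: powser_zero e0)
    show "0 < xi'' \<beta> \<gamma> s" if s: "0 < s" "s \<le> 1" for s
    proof -
      obtain p where p: "2 \<le> p" "\<gamma> p \<noteq> 0" using assms by blast
      define i where "i = p - 2"
      have i: "p = Suc (Suc i)" using p by (simp add: i_def)
      have "0 < e i * s ^ i"
        using s p \<open>\<beta> > 0\<close> unfolding i by (simp add: e_def d_def diffs_def c_def)
      then have "0 < (\<Sum>n. e n * s ^ n)"
        by (intro suminf_pos2[OF se]) (use s e0 in auto)
      then show ?thesis using xi''[of s] s by simp
    qed
  qed
qed

section \<open>Measures on the unit interval\<close>

lemma prob_measuresD:
  assumes "\<mu> \<in> prob_measures"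
  shows "prob_space \<mu>" "space \<mu> = {0..1}" "A \<in> sets borel \<Longrightarrow> A \<subseteq> {0..1} \<Longrightarrow> A \<in> sets \<mu>"
    "A \<in> sets \<mu> \<Longrightarrow> A \<subseteq> {0..1} \<and> A \<in> sets borel"
proof -
  have sets: "sets \<mu> = sets (restrict_space borel {0..1})" and ps: "prob_space \<mu>"
    using assms by (auto simp: prob_measures_def)
  show "prob_space \<mu>" by (rule ps)
  show "space \<mu> = {0..1}" using sets_eq_imp_space_eq[OF sets] by (simp add: space_restrict_space)
  show "A \<in> sets borel \<Longrightarrow> A \<subseteq> {0..1} \<Longrightarrow> A \<in> sets \<mu>" unfolding sets by (subst sets_restrict_space_iff) auto
  show "A \<in> sets \<mu> \<Longrightarrow> A \<subseteq> {0..1} \<and> A \<in> sets borel" unfolding sets by (subst (asm) sets_restrict_space_iff) auto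
qed

lemma cdf01_bounds: "\<mu> \<in> prob_measures \<Longrightarrow> 0 \<le> cdf01 \<mu> s" "\<mu> \<in> prob_measures \<Longrightarrow> cdf01 \<mu> s \<le> 1"
  using prob_space.prob_le_1[OF prob_measuresD(1)] by (auto simp: cdf01_def)

lemma cdf01_1: "\<mu> \<in> prob_measures \<Longrightarrow> cdf01 \<mu> 1 = 1"
  using prob_space.prob_space[OF prob_measuresD(1)] prob_measuresD(2) by (metis cdf01_def)

lemma cdf01_mono:
  assumes "\<mu> \<in> prob_measures" "s \<le> t" "t \<le> 1" shows "cdf01 \<mu> s \<le> cdf01 \<mu> t"
proof -
  interpret prob_space \<mu> by (rule prob_measuresD(1)[OF assms(1)])
  show ?thesis unfolding cdf01_def
    by (rule finite_measure_mono) (use assms prob_measuresD(3)[OF assms(1)] in auto)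
qed

lemma unit_bounded_cdf01: "\<mu> \<in> prob_measures \<Longrightarrow> unit_bounded (cdf01 \<mu>)"
  by (rule unit_bounded_mono) (auto intro!: mono_onI cdf01_mono)

text \<open>The argument is capped at 1 because beyond it \<open>{0..s}\<close> is not an event of
  \<open>\<mu>\<close>, and \<open>measure\<close> would return the default 0.\<close>

lemma cdf01_right_continuous:
  assumes "\<mu> \<in> prob_measures" "0 \<le> s" "s \<le> 1"
  shows "(\<lambda>n. cdf01 \<mu> (min 1 (s + inverse (real (Suc n))))) \<longlonglongrightarrow> cdf01 \<mu> s"
proof -
  interpret prob_space \<mu> by (rule prob_measuresD(1)[OF assms(1)])
  define X where "X n = {0..min 1 (s + inverse (real (Suc n)))}" for n
  have "decseq X"
  proof (rule antimonoI)
    fix m n :: nat assume "m \<le> n"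
    then have "inverse (real (Suc n)) \<le> inverse (real (Suc m))" by (intro le_imp_inverse_le) auto
    then show "X n \<subseteq> X m" unfolding X_def by (intro atLeastatMost_subset_iff[THEN iffD2]) linarith
  qed
  moreover have "range X \<subseteq> sets \<mu>" unfolding X_def using prob_measuresD(3)[OF assms(1)] by auto
  ultimately have "(\<lambda>n. measure \<mu> (X n)) \<longlonglongrightarrow> measure \<mu> (\<Inter>n. X n)" by (intro finite_Lim_measure_decseq) auto
  moreover have "(\<Inter>n. X n) = {0..s}"
  proof (intro equalityI subsetI)
    fix x assume x: "x \<in> (\<Inter>n. X n)"
    have "x \<le> s"
    proof (rule ccontr)
      assume "\<not> x \<le> s"
      then obtain n where "inverse (real (Suc n)) < x - s" using reals_Archimedean[of "x - s"] by auto
      moreover have "x \<le> s + inverse (real (Suc n))" using x by (auto simp: X_def)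
      ultimately show False by linarith
    qed
    then show "x \<in> {0..s}" using x by (auto simp: X_def)
  next
    fix x assume x: "x \<in> {0..s}"
    have "x \<in> X n" for n
    proof -
      have "0 \<le> inverse (real (Suc n))" by simp
      then have "x \<le> s + inverse (real (Suc n))" "x \<le> 1" "0 \<le> x"
        using x assms(3) unfolding atLeastAtMost_iff by linarith+
      then show ?thesis unfolding X_def by simp
    qed
    then show "x \<in> (\<Inter>n. X n)" by blast
  qed
  ultimately show ?thesis by (simp add: X_def cdf01_def)
qed

text \<open>Pushed forward to the real line, both measures are real distributions, which are
  determined by their distribution functions.\<close>

lemma cdf01_unique:
  assumes \<mu>: "\<mu> \<in> prob_measures" and \<nu>: "\<nu> \<in> prob_measures"
    and eq: "\<And>s. 0 \<le> s \<Longrightarrow> s < 1 \<Longrightarrow> cdf01 \<nu> s = cdf01 \<mu> s"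
  shows "\<nu> = \<mu>"
proof -
  have m: "(\<lambda>x. x) \<in> measurable \<mu>' borel" if "\<mu>' \<in> prob_measures" for \<mu>' :: "real measure"
  proof (rule measurableI)
    fix A :: "real set" assume "A \<in> sets borel"
    then show "(\<lambda>x. x) -` A \<inter> space \<mu>' \<in> sets \<mu>'"
      unfolding prob_measuresD(2)[OF that] by (intro prob_measuresD(3)[OF that]) auto
  qed simp
  have rd: "real_distribution (distr \<mu>' borel (\<lambda>x. x))" if "\<mu>' \<in> prob_measures" for \<mu>' :: "real measure"
    using prob_space.prob_space_distr[OF prob_measuresD(1)[OF that] m[OF that]]
    by (simp add: real_distribution_def real_distribution_axioms_def)
  have meas: "measure (distr \<mu>' borel (\<lambda>x. x)) A = measure \<mu>' (A \<inter> {0..1})"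
    if "\<mu>' \<in> prob_measures" "A \<in> sets borel" for \<mu>' :: "real measure" and A
    using that by (subst measure_distr) (auto intro: m simp: prob_measuresD(2))
  have "cdf (distr \<nu> borel (\<lambda>x. x)) = cdf (distr \<mu> borel (\<lambda>x. x))"
  proof
    fix x :: real
    consider "x < 0" | "0 \<le> x" "x < 1" | "1 \<le> x" by linarith
    then show "cdf (distr \<nu> borel (\<lambda>x. x)) x = cdf (distr \<mu> borel (\<lambda>x. x)) x"
    proof cases
      case 1
      then have "{..x} \<inter> {0..1} = {}" by auto
      then show ?thesis by (simp add: cdf_def meas \<mu> \<nu>)
    next
      case 2
      then have e: "{..x} \<inter> {0..1} = {0..x}" by auto
      have bx: "{..x} \<in> sets borel" by simp
      show ?thesis using eq[OF 2] unfolding cdf_def meas[OF \<mu> bx] meas[OF \<nu> bx] e cdf01_def .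
    next
      case 3
      then have "{..x} \<inter> {0..1} = {0..1::real}" by auto
      then show ?thesis using cdf01_1[OF \<mu>] cdf01_1[OF \<nu>] by (simp add: cdf_def meas \<mu> \<nu> cdf01_def)
    qed
  qed
  then have d: "distr \<nu> borel (\<lambda>x. x) = distr \<mu> borel (\<lambda>x. x)"
    by (rule cdf_unique[OF rd[OF \<nu>] rd[OF \<mu>]])
  interpret n: prob_space \<nu> by (rule prob_measuresD(1)[OF \<nu>])
  interpret m: prob_space \<mu> by (rule prob_measuresD(1)[OF \<mu>])
  show ?thesis
  proof (rule measure_eqI)
    show "sets \<nu> = sets \<mu>" using \<mu> \<nu> by (simp add: prob_measures_def)
    fix A assume "A \<in> sets \<nu>"
    then have A: "A \<subseteq> {0..1}" "A \<in> sets borel" using prob_measuresD(4)[OF \<nu>] by auto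
    have "measure \<nu> (A \<inter> {0..1}) = measure \<mu> (A \<inter> {0..1})"
      using meas[OF \<mu> A(2)] meas[OF \<nu> A(2)] d by simp
    then show "emeasure \<nu> A = emeasure \<mu> A"
      using A by (simp add: n.emeasure_eq_measure m.emeasure_eq_measure Int_absorb2)
  qed
qed

section \<open>Finitely atomic measures, mixtures and approximation\<close>

lemma finitely_atomicD:
  assumes "\<mu> \<in> finitely_atomic"
  shows "\<mu> \<in> prob_measures" "finite (atoms \<mu>)" "atoms \<mu> \<subseteq> {0..1}" "measure \<mu> (atoms \<mu>) = 1"
  using assms by (auto simp: finitely_atomic_def atoms_def)

lemma measure_atomic:
  assumes \<mu>: "\<mu> \<in> finitely_atomic" and A: "A \<in> sets borel" "A \<subseteq> {0..1}"
  shows "measure \<mu> A = (\<Sum>q\<in>atoms \<mu>. measure \<mu> {q} * indicator A q)"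
proof -
  note D = finitely_atomicD[OF \<mu>]
  interpret prob_space \<mu> by (rule prob_measuresD(1)[OF D(1)])
  have sing: "{q} \<in> sets \<mu>" if "q \<in> {0..1}" for q using that by (intro prob_measuresD(3)[OF D(1)]) auto
  have at: "atoms \<mu> \<in> sets \<mu>" using D by (intro prob_measuresD(3)[OF D(1)] borel_closed finite_imp_closed)
  have As: "A \<in> sets \<mu>" using A by (intro prob_measuresD(3)[OF D(1)])
  have "measure \<mu> (A - atoms \<mu>) \<le> measure \<mu> (space \<mu> - atoms \<mu>)"
    using sets.sets_into_space[OF As] sets.compl_sets[OF at] by (intro finite_measure_mono) auto
  also have "\<dots> = 0" using prob_compl[OF at] D(4) by simp
  finally have 0: "measure \<mu> (A - atoms \<mu>) = 0" by (simp add: measure_le_0_iff)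
  have "measure \<mu> A = measure \<mu> (A \<inter> atoms \<mu>) + measure \<mu> (A - atoms \<mu>)"
    using finite_measure_Union[of "A \<inter> atoms \<mu>" "A - atoms \<mu>"] at As by (simp add: Int_Diff_Un Int_Diff_disjoint)
  also have "\<dots> = measure \<mu> (A \<inter> atoms \<mu>)" using 0 by simp
  also have "\<dots> = (\<Sum>q\<in>A \<inter> atoms \<mu>. measure \<mu> {q})"
    using D sing by (intro finite_measure_eq_sum_singleton) auto
  also have "\<dots> = (\<Sum>q\<in>atoms \<mu>. measure \<mu> {q} * indicator A q)"
    using D(2) by (intro sum.mono_neutral_cong_left) (auto simp: indicator_def)
  finally show ?thesis .
qed

lemma cdf01_atomic:
  assumes "\<mu> \<in> finitely_atomic" "s \<le> 1"
  shows "cdf01 \<mu> s = (\<Sum>q\<in>atoms \<mu>. measure \<mu> {q} * indicator {q..} s)"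
proof -
  have "cdf01 \<mu> s = (\<Sum>q\<in>atoms \<mu>. measure \<mu> {q} * indicator {0..s} q)"
    unfolding cdf01_def using assms by (intro measure_atomic) auto
  also have "\<dots> = (\<Sum>q\<in>atoms \<mu>. measure \<mu> {q} * indicator {q..} s)"
    using finitely_atomicD(3)[OF assms(1)] by (intro sum.cong) (auto simp: indicator_def)
  finally show ?thesis .
qed

lemma step_function_cdf01:
  assumes "\<mu> \<in> finitely_atomic" shows "step_function (cdf01 \<mu>) (atoms \<mu>)"
  unfolding step_function_def
proof (intro conjI allI impI)
  note D = finitely_atomicD[OF assms]
  show "finite (atoms \<mu>)" "atoms \<mu> \<subseteq> {0..1}" by fact+
  show "0 \<le> cdf01 \<mu> s" "cdf01 \<mu> s \<le> 1" for s using cdf01_bounds[OF D(1)] by auto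
  fix s t :: real assume st: "0 \<le> s" "s < t" "t < 1" "atoms \<mu> \<inter> {s<..t} = {}"
  then show "cdf01 \<mu> t = cdf01 \<mu> s"
    unfolding cdf01_atomic[OF assms, of t, OF less_imp_le[OF st(3)]] cdf01_atomic[OF assms, of s, OF less_imp_le[OF less_trans[OF st(2,3)]]]
    by (intro sum.cong) (auto simp: indicator_def disjoint_iff)
qed

lemma atomicI:
  assumes \<mu>: "\<mu> \<in> prob_measures" and P: "finite P" "P \<subseteq> {0..1}" "measure \<mu> P = 1"
  shows "\<mu> \<in> finitely_atomic" "atoms \<mu> \<subseteq> P"
proof -
  interpret prob_space \<mu> by (rule prob_measuresD(1)[OF \<mu>])
  have Ps: "P \<in> sets \<mu>" using P by (intro prob_measuresD(3)[OF \<mu>] borel_closed finite_imp_closed)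
  have sing: "{q} \<in> sets \<mu>" if "q \<in> {0..1}" for q using that by (intro prob_measuresD(3)[OF \<mu>]) auto
  show sub: "atoms \<mu> \<subseteq> P"
  proof
    fix q assume q: "q \<in> atoms \<mu>"
    show "q \<in> P"
    proof (rule ccontr)
      assume "q \<notin> P"
      then have "measure \<mu> {q} \<le> measure \<mu> (space \<mu> - P)"
        using q sets.compl_sets[OF Ps] sets.sets_into_space[OF sing[of q]]
        by (intro finite_measure_mono) (auto simp: atoms_def)
      also have "\<dots> = 0" using prob_compl[OF Ps] P by simp
      finally show False using q by (simp add: atoms_def)
    qed
  qed
  have "measure \<mu> P = (\<Sum>q\<in>P. measure \<mu> {q})"
    using P sing by (intro finite_measure_eq_sum_singleton) auto
  also have "\<dots> = (\<Sum>q\<in>atoms \<mu>. measure \<mu> {q})"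
    using P sub by (intro sum.mono_neutral_right) (auto simp: atoms_def less_le)
  also have "\<dots> = measure \<mu> (atoms \<mu>)"
    using P sub sing by (intro finite_measure_eq_sum_singleton[symmetric]) (auto intro: finite_subset)
  finally show "\<mu> \<in> finitely_atomic"
    using \<mu> P sub by (auto simp: finitely_atomic_def intro: finite_subset)
qed

text \<open>The perturbation in direction of the Dirac measure at \<open>q\<close>, built on the
  sigma-algebra of \<open>\<mu>\<close>. It is characterized by its values on Borel sets, which is
  all that levels and atoms require.\<close>

lemma mixture_exists:
  assumes \<mu>: "\<mu> \<in> prob_measures" and q: "q \<in> {0..1}" and \<theta>: "0 \<le> \<theta>" "\<theta> \<le> 1"
  obtains \<nu> where "\<nu> \<in> prob_measures"
    "\<And>A. A \<in> sets borel \<Longrightarrow> A \<subseteq> {0..1} \<Longrightarrow> measure \<nu> A = (1 - \<theta>) * measure \<mu> A + \<theta> * indicator A q"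
proof -
  interpret prob_space \<mu> by (rule prob_measuresD(1)[OF \<mu>])
  define m where "m A = ennreal (1 - \<theta>) * emeasure \<mu> A + ennreal \<theta> * emeasure (return \<mu> q) A" for A
  define \<nu> where "\<nu> = measure_of (space \<mu>) (sets \<mu>) m"
  have sets: "sets \<nu> = sets \<mu>" by (simp add: \<nu>_def)
  have em: "emeasure \<nu> A = m A" if "A \<in> sets \<mu>" for A
    unfolding \<nu>_def
  proof (rule emeasure_measure_of_sigma)
    show "sigma_algebra (space \<mu>) (sets \<mu>)" ..
    show "positive (sets \<mu>) m" by (simp add: positive_def m_def)
    show "countably_additive (sets \<mu>) m"
    proof (rule countably_additiveI)
      fix A :: "nat \<Rightarrow> real set" assume A: "range A \<subseteq> sets \<mu>" "disjoint_family A"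
      then show "(\<Sum>i. m (A i)) = m (\<Union>i. A i)"
        unfolding m_def
        by (subst suminf_add[symmetric]) (auto simp: suminf_emeasure simp del: emeasure_return)
    qed
  qed fact
  have meas: "measure \<nu> A = (1 - \<theta>) * measure \<mu> A + \<theta> * indicator A q" if A: "A \<in> sets borel" "A \<subseteq> {0..1}" for A
  proof -
    have As: "A \<in> sets \<mu>" by (rule prob_measuresD(3)[OF \<mu> A])
    have "emeasure \<nu> A = ennreal (1 - \<theta>) * ennreal (measure \<mu> A) + ennreal \<theta> * ennreal (indicator A q)"
      using em[OF As] As by (simp add: m_def emeasure_eq_measure indicator_def)
    also have "\<dots> = ennreal ((1 - \<theta>) * measure \<mu> A + \<theta> * indicator A q)"
      using \<theta> by (simp add: ennreal_mult ennreal_plus)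
    finally have "emeasure \<nu> A = ennreal ((1 - \<theta>) * measure \<mu> A + \<theta> * indicator A q)" .
    moreover have "0 \<le> (1 - \<theta>) * measure \<mu> A + \<theta> * indicator A q" using \<theta> by simp
    ultimately show ?thesis unfolding measure_def[of \<nu> A] by (simp only: enn2real_ennreal)
  qed
  have "\<nu> \<in> prob_measures"
  proof -
    have sp: "space \<nu> = {0..1}" using sets_eq_imp_space_eq[OF sets] prob_measuresD(2)[OF \<mu>] by simp
    have "emeasure \<nu> (space \<nu>) = ennreal (1 - \<theta>) + ennreal \<theta>"
      using em[OF sets.top] sets.top[of \<mu>] sp prob_measuresD(2)[OF \<mu>] q emeasure_space_1
      by (simp add: m_def)
    also have "\<dots> = 1" using \<theta> by (simp add: ennreal_plus[symmetric] del: ennreal_plus)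
    finally have "prob_space \<nu>" by (intro prob_spaceI)
    then show ?thesis using \<mu> sets by (simp add: prob_measures_def)
  qed
  then show ?thesis using meas by (rule that)
qed

text \<open>Round down to multiples of \<open>1 / (n + 1)\<close>. Rounding moves mass to the left
  by less than the mesh, so the new distribution function lies between the old one at
  \<open>s\<close> and the old one slightly later; right continuity closes the gap at every
  \<open>s\<close>.\<close>

lemma atomic_approximation:
  assumes \<nu>: "\<nu> \<in> prob_measures"
  obtains \<nu>' :: "nat \<Rightarrow> real measure" where "\<And>n. \<nu>' n \<in> finitely_atomic"
    "\<And>s. 0 \<le> s \<Longrightarrow> s \<le> 1 \<Longrightarrow> (\<lambda>n. cdf01 (\<nu>' n) s) \<longlonglongrightarrow> cdf01 \<nu> s"
proof -
  interpret prob_space \<nu> by (rule prob_measuresD(1)[OF \<nu>])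
  note sp = prob_measuresD(2)[OF \<nu>]
  define r where "r n x = of_int \<lfloor>real (Suc n) * x\<rfloor> / real (Suc n)" for n and x :: real
  have r_le: "r n x \<le> x" and r_ge: "x < r n x + inverse (real (Suc n))" for n x
  proof -
    have "of_int \<lfloor>real (Suc n) * x\<rfloor> \<le> real (Suc n) * x" "real (Suc n) * x < of_int \<lfloor>real (Suc n) * x\<rfloor> + 1" by linarith+
    then show "r n x \<le> x" "x < r n x + inverse (real (Suc n))" by (auto simp: r_def field_simps)
  qed
  have r_mem: "r n x \<in> (\<lambda>j. real j / real (Suc n)) ` {0..Suc n}" if "x \<in> {0..1}" for n x
  proof -
    define j where "j = nat \<lfloor>real (Suc n) * x\<rfloor>"
    have j: "of_int \<lfloor>real (Suc n) * x\<rfloor> = real j" using that by (simp add: j_def)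
    have "real j \<le> real (Suc n) * x" unfolding j[symmetric] by linarith
    also have "\<dots> \<le> real (Suc n)" using that mult_left_mono[of x 1 "real (Suc n)"] by simp
    finally have "j \<le> Suc n" by simp
    then show ?thesis unfolding r_def j by auto
  qed
  have P: "(\<lambda>j. real j / real (Suc n)) ` {0..Suc n} \<subseteq> {0..1}" for n by (auto simp: field_simps)
  have sets\<nu>: "sets \<nu> = sets (restrict_space borel {0..1})" using \<nu> by (simp add: prob_measures_def)
  have rm: "r n \<in> measurable \<nu> \<nu>" for n
  proof -
    have "r n \<in> borel_measurable borel" unfolding r_def by measurable
    then have "r n \<in> measurable (restrict_space borel {0..1}) (restrict_space borel {0..1})"
    proof (intro measurable_restrict_space2 measurable_restrict_space1 Pi_I)
      fix x assume "x \<in> space (restrict_space borel {0..1::real})"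
      then show "r n x \<in> {0..1}" using r_mem[of x n] P[of n] by (auto simp: space_restrict_space)
    qed
    then show ?thesis using sets\<nu> by (simp cong: measurable_cong_sets)
  qed
  define \<nu>' where "\<nu>' n = distr \<nu> \<nu> (r n)" for n
  have pm: "\<nu>' n \<in> prob_measures" for n
    using prob_space_distr[OF rm] \<nu> by (simp add: prob_measures_def \<nu>'_def)
  have meas: "measure (\<nu>' n) A = measure \<nu> (r n -` A \<inter> {0..1})" if "A \<in> sets borel" "A \<subseteq> {0..1}" for n A
    unfolding \<nu>'_def using that by (subst measure_distr[OF rm]) (auto simp: sp intro: prob_measuresD(3)[OF \<nu>])
  have fa: "\<nu>' n \<in> finitely_atomic" for n
  proof (rule atomicI(1)[OF pm _ P])
    have "r n -` ((\<lambda>j. real j / real (Suc n)) ` {0..Suc n}) \<inter> {0..1} = {0..1}" using r_mem by blast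
    then have "measure (\<nu>' n) ((\<lambda>j. real j / real (Suc n)) ` {0..Suc n}) = measure \<nu> {0..1}"
      using P by (subst meas) (auto intro!: borel_closed finite_imp_closed)
    then show "measure (\<nu>' n) ((\<lambda>j. real j / real (Suc n)) ` {0..Suc n}) = 1"
      using prob_space sp by simp
  qed simp
  show ?thesis
  proof (rule that[of \<nu>'])
    show "\<nu>' n \<in> finitely_atomic" for n by (rule fa)
    fix s :: real assume s: "0 \<le> s" "s \<le> 1"
    have rs: "r n -` {0..s} \<inter> {0..1} \<in> sets \<nu>" for n
      using measurable_sets[OF rm, of "{0..s}" n] s prob_measuresD(3)[OF \<nu>, of "{0..s}"] by (simp add: sp)
    have r0: "0 \<le> r n x" if "x \<in> {0..1}" for n x using r_mem[OF that, of n] P[of n] by auto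
    have lower: "cdf01 \<nu> s \<le> cdf01 (\<nu>' n) s" for n
      unfolding cdf01_def using s
      by (subst meas) (auto intro!: finite_measure_mono rs r0 order_trans[OF r_le])
    have upper: "cdf01 (\<nu>' n) s \<le> cdf01 \<nu> (min 1 (s + inverse (real (Suc n))))" for n
    proof -
      have "x \<le> s + inverse (real (Suc n))" if "r n x \<le> s" for x using r_ge[of x n] that by linarith
      then have "r n -` {0..s} \<inter> {0..1} \<subseteq> {0..min 1 (s + inverse (real (Suc n)))}" by auto
      then show ?thesis
        unfolding cdf01_def using s by (subst meas) (auto intro!: finite_measure_mono prob_measuresD(3)[OF \<nu>])
    qed
    show "(\<lambda>n. cdf01 (\<nu>' n) s) \<longlonglongrightarrow> cdf01 \<nu> s"
      by (rule tendsto_sandwich[OF _ _ tendsto_const cdf01_right_continuous[OF \<nu> s]]) (use lower upper in auto)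
  qed
qed

section \<open>First-order condition and minimality\<close>

context clock
begin

text \<open>\<open>Phi\<close> is defined through unweighted convergence of levels, whereas the
  Lipschitz estimate carries the weight \<xi>''; boundedness of the latter links the two.\<close>

lemma rate_integral_abs_le_l1:
  "\<exists>B\<ge>0. \<forall>h. unit_bounded h \<longrightarrow> rate_integral (\<lambda>s. \<bar>h s\<bar>) \<le> B * (LINT s:{0..1}|lborel. \<bar>h s\<bar>)"
proof -
  obtain B where B: "0 \<le> B" "\<And>s. 0 \<le> s \<Longrightarrow> s \<le> 1 \<Longrightarrow> \<bar>\<rho> s\<bar> \<le> B"
    using rate_unit_bounded by (rule unit_boundedE) blast
  have "rate_integral (\<lambda>s. \<bar>h s\<bar>) \<le> (LINT s:{0..1}|lborel. B * \<bar>h s\<bar>)" if "unit_bounded h" for h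
    unfolding rate_integral_def using B that
    by (intro set_integral_mono set_integrable_rate set_integrable_unit_bounded unit_bounded_intros mult_right_mono)
       (auto simp: abs_le_iff)
  then show ?thesis using B(1) by auto
qed

lemma l1_tendsto:
  assumes ub: "\<And>n. unit_bounded (H n)" and B: "\<And>n s. 0 \<le> s \<Longrightarrow> s \<le> 1 \<Longrightarrow> \<bar>H n s\<bar> \<le> B"
    and lim: "\<And>s. 0 \<le> s \<Longrightarrow> s \<le> 1 \<Longrightarrow> (\<lambda>n. H n s) \<longlonglongrightarrow> 0"
  shows "(\<lambda>n. LINT s:{0..1}|lborel. \<bar>H n s\<bar>) \<longlonglongrightarrow> 0"
proof -
  have "(\<lambda>n. LINT s:{0..1}|lborel. \<bar>H n s\<bar>) \<longlonglongrightarrow> (LINT s|(lborel :: real measure). (0 :: real))"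
    unfolding set_lebesgue_integral_def
  proof (rule integral_dominated_convergence[where w="\<lambda>s. indicator {0..1} s *\<^sub>R B" and f="\<lambda>_. 0 :: real"])
    show "integrable lborel (\<lambda>s. indicator {0..1::real} s *\<^sub>R B)" by (rule borel_integrable_compact) auto
    show "(\<lambda>s. indicat_real {0..1} s *\<^sub>R \<bar>H n s\<bar>) \<in> borel_measurable lborel" for n
      using set_integrable_unit_bounded[OF unit_bounded_abs[OF ub], of "{0..1}" n]
      unfolding set_integrable_def by auto
    show "AE s in lborel. (\<lambda>n. indicat_real {0..1} s *\<^sub>R \<bar>H n s\<bar>) \<longlonglongrightarrow> 0"
    proof (rule AE_I2)
      fix s show "(\<lambda>n. indicat_real {0..1} s *\<^sub>R \<bar>H n s\<bar>) \<longlonglongrightarrow> 0"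
        using lim[of s] by (cases "s \<in> {0..1}") (auto intro!: tendsto_rabs_zero)
    qed
    show "AE s in lborel. norm (indicat_real {0..1} s *\<^sub>R \<bar>H n s\<bar>) \<le> indicat_real {0..1} s *\<^sub>R B" for n
      using B by (intro AE_I2) (auto simp: indicator_def)
  qed simp
  then show ?thesis by simp
qed

lemma Phi_atomic_eq_phi:
  assumes "\<mu> \<in> finitely_atomic"
  shows "Phi_atomic \<beta> \<gamma> \<mu> 0 h = phi (cdf01 \<mu>) (atoms \<mu>) 0 h"
proof -
  have "{q \<in> atoms \<mu> \<union> {1}. 0 < q} = {q \<in> atoms \<mu> \<union> {1}. 0 < q \<and> q \<le> 1}"
    using finitely_atomicD(3)[OF assms] by auto
  then show ?thesis unfolding Phi_atomic_def phi_def by simp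
qed

lemma Phi_atomic_lipschitz:
  assumes "\<mu> \<in> finitely_atomic" "\<nu> \<in> finitely_atomic"
  shows "\<bar>Phi_atomic \<beta> \<gamma> \<mu> 0 h - Phi_atomic \<beta> \<gamma> \<nu> 0 h\<bar> \<le> rate_integral (\<lambda>s. \<bar>cdf01 \<mu> s - cdf01 \<nu> s\<bar>)"
  unfolding Phi_atomic_eq_phi[OF assms(1)] Phi_atomic_eq_phi[OF assms(2)]
  using assms by (intro phi_lipschitz step_function_cdf01 unit_bounded_cdf01 finitely_atomicD)

text \<open>The Lipschitz estimate makes the values along an approximating sequence Cauchy and gives
  any two such sequences the same limit, so the description by \<open>THE\<close> is legitimate. For
  an atomic measure, where \<open>Phi\<close> is not defined as a limit, the same estimate gives
  consistency.\<close>

lemma Phi_limit: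
  assumes \<nu>: "\<nu> \<in> prob_measures" and \<nu>': "\<And>n. \<nu>' n \<in> finitely_atomic"
    and lim: "\<And>s. 0 \<le> s \<Longrightarrow> s \<le> 1 \<Longrightarrow> (\<lambda>n. cdf01 (\<nu>' n) s) \<longlonglongrightarrow> cdf01 \<nu> s"
  shows "(\<lambda>n. Phi_atomic \<beta> \<gamma> (\<nu>' n) 0 h) \<longlonglongrightarrow> Phi \<beta> \<gamma> \<nu> 0 h"
proof -
  obtain B where B: "0 \<le> B" "\<And>h. unit_bounded h \<Longrightarrow> rate_integral (\<lambda>s. \<bar>h s\<bar>) \<le> B * (LINT s:{0..1}|lborel. \<bar>h s\<bar>)"
    using rate_integral_abs_le_l1 by blast
  define d where "d \<mu> = (LINT r:{0..1}|lborel. \<bar>cdf01 \<mu> r - cdf01 \<nu> r\<bar>)" for \<mu>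
  define \<Phi> where "\<Phi> \<mu> = Phi_atomic \<beta> \<gamma> \<mu> 0 h" for \<mu>
  have fp: "\<mu> \<in> prob_measures" if "\<mu> \<in> finitely_atomic" for \<mu> using that by (rule finitely_atomicD)
  have ubd: "unit_bounded (\<lambda>s. cdf01 \<mu> s - cdf01 \<nu> s)" if "\<mu> \<in> prob_measures" for \<mu>
    by (intro unit_bounded_intros unit_bounded_cdf01 that \<nu>)
  have d': "(\<lambda>n. d (\<nu>' n)) \<longlonglongrightarrow> 0"
    unfolding d_def
  proof (rule l1_tendsto[OF ubd[OF fp[OF \<nu>']], where B=1])
    show "\<bar>cdf01 (\<nu>' n) s - cdf01 \<nu> s\<bar> \<le> 1" for n s
      using cdf01_bounds[OF \<nu>, of s] cdf01_bounds[OF fp[OF \<nu>'], of n s] by (simp add: abs_le_iff)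
    show "(\<lambda>n. cdf01 (\<nu>' n) s - cdf01 \<nu> s) \<longlonglongrightarrow> 0" if "0 \<le> s" "s \<le> 1" for s
      using lim[OF that] by (simp add: LIM_zero)
  qed
  show ?thesis
  proof (cases "\<nu> \<in> finitely_atomic")
    case True
    have "\<bar>\<Phi> (\<nu>' n) - \<Phi> \<nu>\<bar> \<le> B * d (\<nu>' n)" for n
      unfolding \<Phi>_def d_def
      by (rule order_trans[OF Phi_atomic_lipschitz[OF \<nu>' True] B(2)[OF ubd[OF fp[OF \<nu>']]]])
    then have le: "\<forall>n. norm (\<Phi> (\<nu>' n) - \<Phi> \<nu>) \<le> B * d (\<nu>' n)" by simp
    have "(\<lambda>n. \<Phi> (\<nu>' n) - \<Phi> \<nu>) \<longlonglongrightarrow> 0"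
      by (rule Lim_null_comparison[OF always_eventually[OF le] tendsto_mult_right_zero[OF d']])
    then show ?thesis using True by (simp add: Phi_def \<Phi>_def LIM_zero_iff)
  next
    case False
    have lip: "\<bar>\<Phi> \<mu> - \<Phi> \<mu>'\<bar> \<le> B * (d \<mu> + d \<mu>')" if "\<mu> \<in> finitely_atomic" "\<mu>' \<in> finitely_atomic" for \<mu> \<mu>'
    proof -
      note ub = ubd[OF fp[OF that(1)]] ubd[OF fp[OF that(2)]]
      have "\<bar>\<Phi> \<mu> - \<Phi> \<mu>'\<bar> \<le> rate_integral (\<lambda>s. \<bar>cdf01 \<mu> s - cdf01 \<mu>' s\<bar>)"
        unfolding \<Phi>_def by (rule Phi_atomic_lipschitz[OF that])
      also have "\<dots> \<le> rate_integral (\<lambda>s. \<bar>cdf01 \<mu> s - cdf01 \<nu> s\<bar> + \<bar>cdf01 \<mu>' s - cdf01 \<nu> s\<bar>)"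
        by (rule rate_integral_mono) (auto intro!: unit_bounded_intros unit_bounded_cdf01 fp that \<nu>)
      also have "\<dots> = rate_integral (\<lambda>s. \<bar>cdf01 \<mu> s - cdf01 \<nu> s\<bar>) + rate_integral (\<lambda>s. \<bar>cdf01 \<mu>' s - cdf01 \<nu> s\<bar>)"
        by (intro rate_integral_add unit_bounded_abs ub)
      also have "\<dots> \<le> B * d \<mu> + B * d \<mu>'" unfolding d_def by (intro add_mono B(2) ub)
      finally show ?thesis by (simp add: distrib_left)
    qed
    have "Cauchy (\<lambda>n. \<Phi> (\<nu>' n))"
    proof (rule metric_CauchyI)
      fix e :: real assume e: "0 < e"
      have "0 < e / (2 * (B + 1))" using e B(1) by simp
      from order_tendstoD(2)[OF d' this] obtain M where M: "\<And>n. n \<ge> M \<Longrightarrow> d (\<nu>' n) < e / (2 * (B + 1))"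
        unfolding eventually_sequentially by blast
      have d0: "0 \<le> d \<mu>" for \<mu> unfolding d_def set_lebesgue_integral_def by (intro integral_nonneg_AE) auto
      have "dist (\<Phi> (\<nu>' m)) (\<Phi> (\<nu>' n)) < e" if "m \<ge> M" "n \<ge> M" for m n
      proof -
        have "dist (\<Phi> (\<nu>' m)) (\<Phi> (\<nu>' n)) \<le> B * (d (\<nu>' m) + d (\<nu>' n))"
          unfolding dist_real_def by (rule lip[OF \<nu>' \<nu>'])
        also have "\<dots> \<le> (B + 1) * (d (\<nu>' m) + d (\<nu>' n))" using d0 by (intro mult_right_mono add_nonneg_nonneg) auto
        also have "\<dots> < (B + 1) * (e / (2 * (B + 1)) + e / (2 * (B + 1)))"
          using M[OF that(1)] M[OF that(2)] B(1) by (intro mult_strict_left_mono) auto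
        also have "\<dots> = e"
        proof -
          have D: "D * (e / (2 * D) + e / (2 * D)) = e" if "0 < D" for D :: real using that by (simp add: field_simps)
          show ?thesis by (rule D) (use B(1) in simp)
        qed
        finally show ?thesis .
      qed
      then show "\<exists>M. \<forall>m\<ge>M. \<forall>n\<ge>M. dist (\<Phi> (\<nu>' m)) (\<Phi> (\<nu>' n)) < e" by blast
    qed
    then obtain L where L: "(\<lambda>n. \<Phi> (\<nu>' n)) \<longlonglongrightarrow> L"
      using real_Cauchy_convergent[OF \<open>Cauchy _\<close>] unfolding convergent_def by blast
    have "(THE L. \<forall>\<nu>' :: nat \<Rightarrow> real measure. (\<forall>n. \<nu>' n \<in> finitely_atomic) \<longrightarrow>
        (\<lambda>n. d (\<nu>' n)) \<longlonglongrightarrow> 0 \<longrightarrow> (\<lambda>n. \<Phi> (\<nu>' n)) \<longlonglongrightarrow> L) = L"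
    proof (rule the_equality, intro allI impI)
      fix \<mu> :: "nat \<Rightarrow> real measure" assume \<mu>: "\<forall>n. \<mu> n \<in> finitely_atomic" "(\<lambda>n. d (\<mu> n)) \<longlonglongrightarrow> 0"
      have "(\<lambda>n. B * (d (\<mu> n) + d (\<nu>' n))) \<longlonglongrightarrow> B * (0 + 0)" by (intro tendsto_intros \<mu>(2) d')
      then have lim: "(\<lambda>n. B * (d (\<mu> n) + d (\<nu>' n))) \<longlonglongrightarrow> 0" by simp
      have le: "norm (\<Phi> (\<mu> n) - \<Phi> (\<nu>' n)) \<le> B * (d (\<mu> n) + d (\<nu>' n))" for n
        unfolding real_norm_def by (rule lip[OF spec[OF \<mu>(1)] \<nu>'(1)])
      have "(\<lambda>n. \<Phi> (\<mu> n) - \<Phi> (\<nu>' n)) \<longlonglongrightarrow> 0"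
        by (rule Lim_null_comparison[OF always_eventually[OF allI[OF le]] lim])
      from tendsto_add[OF this L] show "(\<lambda>n. \<Phi> (\<mu> n)) \<longlonglongrightarrow> L" by simp
    next
      fix L' assume "\<forall>\<nu>'. (\<forall>n. \<nu>' n \<in> finitely_atomic) \<longrightarrow> (\<lambda>n. d (\<nu>' n)) \<longlonglongrightarrow> 0 \<longrightarrow> (\<lambda>n. \<Phi> (\<nu>' n)) \<longlonglongrightarrow> L'"
      then have "(\<lambda>n. \<Phi> (\<nu>' n)) \<longlonglongrightarrow> L'" using \<nu>' d' by blast
      then show "L' = L" using L by (rule LIMSEQ_unique)
    qed
    then have "Phi \<beta> \<gamma> \<nu> 0 h = L" using False by (simp add: Phi_def d_def \<Phi>_def)
    then show ?thesis using L by (simp add: \<Phi>_def)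
  qed
qed

lemma parisi_functional_eq:
  "parisi_functional \<beta> \<gamma> h \<mu> = ln 2 + Phi \<beta> \<gamma> \<mu> 0 h - rate_integral (\<lambda>s. cdf01 \<mu> s * s) / 2"
  unfolding parisi_functional_def rate_integral_def by (simp add: ac_simps)

text \<open>An infimum of reals is a lower bound only when the set is bounded below, so the
  hypothesis on \<open>INF\<close> cannot be used without this. The \<open>ln 2\<close> of the
  functional offsets the one in \<open>phi_ge_abs\<close>.\<close>

lemma parisi_functional_bounded_below:
  assumes "\<mu> \<in> finitely_atomic" shows "- \<tau> 1 / 2 \<le> parisi_functional \<beta> \<gamma> h \<mu>"
proof -
  interpret F: parisi_flow \<beta> \<gamma> "cdf01 \<mu>" "atoms \<mu>" by unfold_locales (rule step_function_cdf01[OF assms])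
  have \<mu>: "\<mu> \<in> prob_measures" by (rule finitely_atomicD(1)[OF assms])
  have "\<bar>h\<bar> - ln 2 \<le> Phi \<beta> \<gamma> \<mu> 0 h"
    using F.phi_ge_abs[of 0 h] assms by (simp add: Phi_def Phi_atomic_eq_phi)
  moreover have "rate_integral (\<lambda>s. cdf01 \<mu> s * s) \<le> rate_integral (\<lambda>_. 1)"
    using cdf01_bounds[OF \<mu>]
    by (intro rate_integral_mono unit_bounded_intros unit_bounded_cdf01 \<mu>) (auto intro: mult_le_one)
  ultimately show ?thesis
    unfolding parisi_functional_eq rate_integral_const using abs_ge_zero[of h] by linarith
qed

lemma rate_integral_sum:
  assumes "finite I" "\<And>i. i \<in> I \<Longrightarrow> unit_bounded (f i)"
  shows "unit_bounded (\<lambda>s. \<Sum>i\<in>I. f i s) \<and> rate_integral (\<lambda>s. \<Sum>i\<in>I. f i s) = (\<Sum>i\<in>I. rate_integral (f i))"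
  using assms
proof (induction I rule: finite_induct)
  case (insert i I)
  then show ?case by (simp add: rate_integral_add unit_bounded_add)
qed (simp add: rate_integral_const unit_bounded_const)

section \<open>Tail integrals\<close>

lemma tail_integral_diff:
  assumes "unit_bounded h" "r \<le> r'"
  shows "tail_integral h r - tail_integral h r' = rate_integral (\<lambda>s. indicator {r..<r'} s * h s)"
proof -
  have "tail_integral h r - tail_integral h r' = rate_integral (\<lambda>s. indicator {r..} s * h s - indicator {r'..} s * h s)"
    unfolding tail_integral_def
    by (rule rate_integral_diff[symmetric]) (intro unit_bounded_intros assms; simp)+
  also have "\<dots> = rate_integral (\<lambda>s. indicator {r..<r'} s * h s)"
    using assms by (intro rate_integral_cong) (auto simp: indicator_def)
  finally show ?thesis .
qed

lemma rate_integral_indicator: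
  assumes "0 \<le> r" "r \<le> r'" "r' \<le> 1"
  shows "rate_integral (indicator {r..<r'}) = \<tau> r' - \<tau> r"
proof -
  have "rate_integral (indicator {r..<r'}) = (LINT s:{r..<r'}|lborel. \<rho> s)"
    unfolding rate_integral_def set_lebesgue_integral_def
    by (rule Bochner_Integration.integral_cong[OF refl]) (use assms in \<open>auto simp: indicator_def\<close>)
  then show ?thesis using integral_rate_half_open[OF assms] by simp
qed

lemma tail_integral_abs_le:
  assumes "unit_bounded h" "\<And>s. 0 \<le> s \<Longrightarrow> s \<le> 1 \<Longrightarrow> \<bar>h s\<bar> \<le> B"
  shows "\<bar>tail_integral h r\<bar> \<le> rate_integral (\<lambda>s. \<bar>h s\<bar>)" "rate_integral (\<lambda>s. \<bar>h s\<bar>) \<le> B * \<tau> 1"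
proof -
  have "tail_integral h r \<le> rate_integral (\<lambda>s. \<bar>h s\<bar>)"
    unfolding tail_integral_def
    by (intro rate_integral_mono unit_bounded_intros assms) (auto simp: indicator_def)
  moreover have "rate_integral (\<lambda>s. (-1) * \<bar>h s\<bar>) \<le> tail_integral h r"
    unfolding tail_integral_def
    by (intro rate_integral_mono unit_bounded_intros assms) (auto simp: indicator_def)
  ultimately show "\<bar>tail_integral h r\<bar> \<le> rate_integral (\<lambda>s. \<bar>h s\<bar>)"
    unfolding rate_integral_cmult by (simp add: abs_le_iff)
  show "rate_integral (\<lambda>s. \<bar>h s\<bar>) \<le> B * \<tau> 1"
    using rate_integral_abs_le[OF unit_bounded_abs[OF assms(1)], of B] assms(2) by (simp add: abs_le_iff)
qed

text \<open>If the level of \<open>\<nu>\<close> were larger at \<open>s\<close>, it would stay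
  larger by a fixed amount on an interval to the right, by monotonicity of one level and right
  continuity of the other. As the clock increases there, two tails would differ.\<close>

lemma tail_integral_zero_imp_cdf01_eq:
  assumes \<mu>: "\<mu> \<in> prob_measures" and \<nu>: "\<nu> \<in> prob_measures"
    and zero: "\<And>s. 0 < s \<Longrightarrow> s < 1 \<Longrightarrow> tail_integral (\<lambda>s. cdf01 \<nu> s - cdf01 \<mu> s) s = 0"
    and s: "0 \<le> s" "s < 1"
  shows "cdf01 \<nu> s \<le> cdf01 \<mu> s"
proof (rule ccontr)
  define \<kappa> where "\<kappa> = (cdf01 \<nu> s - cdf01 \<mu> s) / 2"
  assume "\<not> cdf01 \<nu> s \<le> cdf01 \<mu> s"
  then have \<kappa>: "0 < \<kappa>" "cdf01 \<mu> s < cdf01 \<nu> s - \<kappa>" by (auto simp: \<kappa>_def field_simps)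
  have "(\<lambda>n. cdf01 \<mu> (min 1 (s + inverse (real (Suc n))))) \<longlonglongrightarrow> cdf01 \<mu> s"
    using s by (intro cdf01_right_continuous \<mu>) auto
  from order_tendstoD(2)[OF this \<kappa>(2)] obtain n where n: "cdf01 \<mu> (min 1 (s + inverse (real (Suc n)))) < cdf01 \<nu> s - \<kappa>"
    unfolding eventually_sequentially by blast
  define e where "e = min 1 (s + inverse (real (Suc n)))"
  have e: "s < e" "e \<le> 1" using s by (auto simp: e_def)
  \<comment> \<open>Cutting at thirds keeps both points strictly between 0 and 1, where the tails
    are known to vanish, even if \<open>s = 0\<close> or \<open>e = 1\<close>.\<close>
  define r where "r = s + (e - s) / 3"
  define r' where "r' = s + 2 * (e - s) / 3"
  have r: "s < r" "r < r'" "r' < e" using e by (auto simp: r_def r'_def field_simps)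
  define h where "h s = cdf01 \<nu> s - cdf01 \<mu> s" for s
  have ub: "unit_bounded h" unfolding h_def by (intro unit_bounded_intros unit_bounded_cdf01 \<mu> \<nu>)
  have "\<kappa> \<le> h u" if u: "r \<le> u" "u < r'" for u
  proof -
    have "cdf01 \<nu> s \<le> cdf01 \<nu> u" "cdf01 \<mu> u \<le> cdf01 \<mu> e" using u r e by (auto intro!: cdf01_mono \<nu> \<mu>)
    then show ?thesis using n by (simp add: h_def e_def)
  qed
  then have "rate_integral (\<lambda>u. \<kappa> * indicator {r..<r'} u) \<le> rate_integral (\<lambda>u. indicator {r..<r'} u * h u)"
    by (intro rate_integral_mono unit_bounded_intros ub) (auto simp: indicator_def)
  also have "\<dots> = tail_integral h r - tail_integral h r'"
    using r by (intro tail_integral_diff[symmetric] ub) auto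
  also have "\<dots> = 0" using zero[of r] zero[of r'] r e s by (simp add: h_def[abs_def])
  finally have "\<kappa> * (\<tau> r' - \<tau> r) \<le> 0"
    using r e s by (simp add: rate_integral_cmult rate_integral_indicator)
  moreover have "0 < \<tau> r' - \<tau> r" using clock_strict_mono[of r r'] r e s by simp
  ultimately show False using \<kappa> by (simp add: mult_le_0_iff)
qed

text \<open>The first-order condition is linear in the direction, and an atomic measure is an
  average of Dirac measures, so it extends to all directions and cancels the linear part of the
  comparison. What remains is the strict gain. The hypothesis asks for \<open>2 * \<eta>\<close>
  because half is lost in approximating \<open>\<nu>\<close>.\<close>

lemma parisi_functional_lower_bound:
  assumes \<mu>: "\<mu> \<in> finitely_atomic" and \<nu>: "\<nu> \<in> prob_measures"
    and first_order: "\<And>q. 0 \<le> q \<Longrightarrow> q \<le> 1 \<Longrightarrow>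
      0 \<le> rate_integral (\<lambda>s. (indicator {q..} s - cdf01 \<mu> s) * (energy (cdf01 \<mu>) (atoms \<mu>) h s - s))"
    and t: "0 \<le> t" and ab: "0 \<le> a" "a \<le> b" "b < 1"
    and \<eta>: "\<And>s. a \<le> s \<Longrightarrow> s \<le> b \<Longrightarrow> 2 * \<eta> \<le> (tail_integral (\<lambda>s. cdf01 \<nu> s - cdf01 \<mu> s) s)\<^sup>2" "0 \<le> \<eta>"
  shows "parisi_functional \<beta> \<gamma> h \<nu> \<ge> parisi_functional \<beta> \<gamma> h \<mu>
    + t * (\<eta> * (energy (cdf01 \<mu>) (atoms \<mu>) h b - energy (cdf01 \<mu>) (atoms \<mu>) h a))
    - t\<^sup>2 * penalty (cdf01 \<mu>) (atoms \<mu>) h"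
proof -
  define \<alpha> where "\<alpha> = cdf01 \<mu>"
  define S where "S = atoms \<mu>"
  define G where "G = energy \<alpha> S h"
  have step: "step_function \<alpha> S" unfolding \<alpha>_def S_def by (rule step_function_cdf01[OF \<mu>])
  interpret F: parisi_flow \<beta> \<gamma> \<alpha> S by unfold_locales (rule step)
  have ub\<alpha>: "unit_bounded \<alpha>" unfolding \<alpha>_def by (rule unit_bounded_cdf01[OF finitely_atomicD(1)[OF \<mu>]])
  have ubG: "unit_bounded G" unfolding G_def by (rule F.unit_bounded_energy)
  obtain \<nu>' where \<nu>': "\<And>n. \<nu>' n \<in> finitely_atomic"
    "\<And>s. 0 \<le> s \<Longrightarrow> s \<le> 1 \<Longrightarrow> (\<lambda>n. cdf01 (\<nu>' n) s) \<longlonglongrightarrow> cdf01 \<nu> s"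
    using \<nu> by (rule atomic_approximation) blast
  have \<nu>'p: "\<nu>' n \<in> prob_measures" for n by (rule finitely_atomicD(1)[OF \<nu>'(1)])
  define c where "c n = inverse (real (Suc n))" for n
  have c: "0 < c n" "c n \<le> 1" for n by (auto simp: c_def field_simps)
  have c0: "c \<longlonglongrightarrow> 0" unfolding c_def by (rule LIMSEQ_inverse_real_of_nat)
  \<comment> \<open>The raised level is needed for the comparison only; the averaging over Dirac
    measures below uses the unraised \<open>\<nu>' n\<close>.\<close>
  define A where "A n s = max (cdf01 (\<nu>' n) s) (c n)" for n s
  have stepA: "step_function (A n) (atoms (\<nu>' n))" for n
    unfolding A_def using c by (intro step_function_max step_function_cdf01 \<nu>') (auto intro: less_imp_le)
  have ubA: "unit_bounded (A n)" for n unfolding A_def by (intro unit_bounded_max unit_bounded_cdf01 \<nu>'p)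
  have ub\<nu>: "unit_bounded (cdf01 \<nu>)" by (rule unit_bounded_cdf01[OF \<nu>])
  have limA: "(\<lambda>n. A n s) \<longlonglongrightarrow> cdf01 \<nu> s" if "0 \<le> s" "s \<le> 1" for s
  proof -
    have "(\<lambda>n. max (cdf01 (\<nu>' n) s) (c n)) \<longlonglongrightarrow> max (cdf01 \<nu> s) 0" by (intro tendsto_max \<nu>'(2) that c0)
    then show ?thesis using cdf01_bounds(1)[OF \<nu>, of s] by (simp add: A_def max_def)
  qed
  have A01: "0 \<le> A n s" "A n s \<le> 1" for n s using step_functionD(3,4)[OF stepA] by auto
  have \<alpha>01: "0 \<le> \<alpha> s" "\<alpha> s \<le> 1" for s by (auto simp: F.\<alpha>_nonneg F.\<alpha>_le_1)
  have \<nu>01: "0 \<le> cdf01 \<nu> s" "cdf01 \<nu> s \<le> 1" "0 \<le> cdf01 (\<nu>' n) s" "cdf01 (\<nu>' n) s \<le> 1" for n s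
    using cdf01_bounds[OF \<nu>] cdf01_bounds[OF \<nu>'p] by auto
  have Gs: "\<bar>G s\<bar> \<le> 1" "\<bar>G s - s\<bar> \<le> 1" if "0 \<le> s" "s \<le> 1" for s
    using F.energy_bounds[OF that, of h] that by (auto simp: G_def abs_le_iff)
  have lim_rate: "(\<lambda>n. rate_integral (\<lambda>s. (H n s - \<alpha> s) * g s)) \<longlonglongrightarrow> rate_integral (\<lambda>s. (cdf01 \<nu> s - \<alpha> s) * g s)"
    if H: "\<And>n. unit_bounded (H n)" "\<And>n s. 0 \<le> H n s" "\<And>n s. H n s \<le> 1"
      "\<And>s. 0 \<le> s \<Longrightarrow> s \<le> 1 \<Longrightarrow> (\<lambda>n. H n s) \<longlonglongrightarrow> cdf01 \<nu> s"
    and g: "unit_bounded g" "\<And>s. 0 \<le> s \<Longrightarrow> s \<le> 1 \<Longrightarrow> \<bar>g s\<bar> \<le> 1" for H g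
  proof (rule rate_integral_tendsto[where B=1])
    show "\<bar>(H n s - \<alpha> s) * g s\<bar> \<le> 1" if "0 \<le> s" "s \<le> 1" for n s
    proof -
      have "\<bar>H n s - \<alpha> s\<bar> \<le> 1" using H(2,3)[of n s] \<alpha>01[of s] by (simp add: abs_le_iff)
      then show ?thesis using g(2)[OF that] unfolding abs_mult by (intro mult_le_one) auto
    qed
  qed (intro unit_bounded_intros H ub\<alpha> ub\<nu> g tendsto_intros; assumption)+
  have rA: "(\<lambda>n. rate_integral (\<lambda>s. \<bar>A n s - cdf01 \<nu> s\<bar>)) \<longlonglongrightarrow> 0"
  proof -
    have "(\<lambda>n. rate_integral (\<lambda>s. \<bar>A n s - cdf01 \<nu> s\<bar>)) \<longlonglongrightarrow> rate_integral (\<lambda>_. 0)"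
    proof (rule rate_integral_tendsto[where B=1])
      show "\<bar>\<bar>A n s - cdf01 \<nu> s\<bar>\<bar> \<le> 1" for n s using A01[of n s] \<nu>01(1,2)[of s] by (simp add: abs_le_iff)
      show "(\<lambda>n. \<bar>A n s - cdf01 \<nu> s\<bar>) \<longlonglongrightarrow> 0" if "0 \<le> s" "s \<le> 1" for s
        using limA[OF that] by (intro tendsto_rabs_zero) (simp add: LIM_zero)
    qed (intro unit_bounded_intros ubA ub\<nu>)+
    then show ?thesis by (simp add: rate_integral_const)
  qed
  have phiA: "(\<lambda>n. phi (A n) (atoms (\<nu>' n)) 0 h) \<longlonglongrightarrow> Phi \<beta> \<gamma> \<nu> 0 h"
  proof -
    have le: "norm (phi (A n) (atoms (\<nu>' n)) 0 h - Phi_atomic \<beta> \<gamma> (\<nu>' n) 0 h) \<le> c n * \<tau> 1" for n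
    proof -
      have "\<bar>phi (A n) (atoms (\<nu>' n)) 0 h - Phi_atomic \<beta> \<gamma> (\<nu>' n) 0 h\<bar> \<le> rate_integral (\<lambda>s. \<bar>A n s - cdf01 (\<nu>' n) s\<bar>)"
        unfolding Phi_atomic_eq_phi[OF \<nu>'(1)]
        by (intro phi_lipschitz stepA step_function_cdf01 \<nu>' ubA unit_bounded_cdf01 \<nu>'p)
      also have "\<dots> \<le> rate_integral (\<lambda>_. c n)"
        by (intro rate_integral_mono unit_bounded_intros ubA unit_bounded_cdf01 \<nu>'p)
           (use \<nu>01 c in \<open>auto simp: A_def max_def intro: less_imp_le\<close>)
      finally show ?thesis by (simp add: rate_integral_const)
    qed
    have "(\<lambda>n. phi (A n) (atoms (\<nu>' n)) 0 h - Phi_atomic \<beta> \<gamma> (\<nu>' n) 0 h) \<longlonglongrightarrow> 0"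
      by (rule Lim_null_comparison[OF always_eventually[OF allI[OF le]] tendsto_mult_left_zero[OF c0]])
    from tendsto_add[OF this Phi_limit[OF \<nu> \<nu>', of h]] show ?thesis by simp
  qed
  \<comment> \<open>Uniform in \<open>s\<close>: the tails of two levels differ by at most the full
    weighted distance of the levels, and the tails themselves are at most \<open>\<tau> 1\<close>,
    so their squares differ by less than \<open>\<eta>\<close> eventually.\<close>
  have evt: "\<forall>\<^sub>F n in sequentially. \<forall>s\<in>{a..b}. \<eta> \<le> (tail_integral (\<lambda>s. A n s - \<alpha> s) s)\<^sup>2"
  proof (cases "\<eta> = 0")
    case False
    then have "0 < \<eta>" using \<eta>(2) by simp
    have "(\<lambda>n. 2 * \<tau> 1 * rate_integral (\<lambda>s. \<bar>A n s - cdf01 \<nu> s\<bar>)) \<longlonglongrightarrow> 0"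
      using tendsto_mult_right_zero[OF rA] by simp
    from order_tendstoD(2)[OF this \<open>0 < \<eta>\<close>] show ?thesis
    proof eventually_elim
      case (elim n)
      show ?case
      proof
        fix s assume s: "s \<in> {a..b}"
        define T where "T = tail_integral (\<lambda>s. cdf01 \<nu> s - \<alpha> s) s"
        define T' where "T' = tail_integral (\<lambda>s. A n s - \<alpha> s) s"
        have ubs: "unit_bounded (\<lambda>s. cdf01 \<nu> s - \<alpha> s)" "unit_bounded (\<lambda>s. A n s - \<alpha> s)"
          "unit_bounded (\<lambda>s. A n s - cdf01 \<nu> s)"
          by (intro unit_bounded_intros ub\<nu> ub\<alpha> ubA)+
        have "T' - T = tail_integral (\<lambda>s. A n s - cdf01 \<nu> s) s"
          unfolding T_def T'_def tail_integral_def
          by (subst rate_integral_diff[symmetric], (intro unit_bounded_intros ubs; simp)+)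
             (simp add: algebra_simps)
        moreover have b1: "\<bar>cdf01 \<nu> u - \<alpha> u\<bar> \<le> 1" "\<bar>A n u - \<alpha> u\<bar> \<le> 1" "\<bar>A n u - cdf01 \<nu> u\<bar> \<le> 1" for u
          using A01[of n u] \<nu>01(1,2)[of u] \<alpha>01[of u] by (auto simp: abs_le_iff)
        ultimately have d: "\<bar>T - T'\<bar> \<le> rate_integral (\<lambda>s. \<bar>A n s - cdf01 \<nu> s\<bar>)"
          using tail_integral_abs_le(1)[OF ubs(3) b1(3), of s] by (simp only: abs_minus_commute[of T])
        have TT: "\<bar>T\<bar> \<le> \<tau> 1" "\<bar>T'\<bar> \<le> \<tau> 1"
          unfolding T_def T'_def
          using order_trans[OF tail_integral_abs_le(1)[OF ubs(1) b1(1), of s] tail_integral_abs_le(2)[OF ubs(1) b1(1)]]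
            order_trans[OF tail_integral_abs_le(1)[OF ubs(2) b1(2), of s] tail_integral_abs_le(2)[OF ubs(2) b1(2)]]
          by (simp_all only: mult_1)
        have "T\<^sup>2 - T'\<^sup>2 = (T + T') * (T - T')" by (simp add: power2_eq_square algebra_simps)
        also have "\<dots> \<le> \<bar>T + T'\<bar> * \<bar>T - T'\<bar>" by (metis abs_ge_self abs_mult)
        also have "\<dots> \<le> 2 * \<tau> 1 * rate_integral (\<lambda>s. \<bar>A n s - cdf01 \<nu> s\<bar>)"
          using d TT by (intro mult_mono) auto
        finally have "T\<^sup>2 - T'\<^sup>2 \<le> \<eta>" using elim by simp
        moreover have "2 * \<eta> \<le> T\<^sup>2" using \<eta>(1)[of s] s by (simp add: T_def \<alpha>_def)
        ultimately show "\<eta> \<le> T'\<^sup>2" by linarith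
      qed
    qed
  qed simp
  define X where "X = t * (\<eta> * (G b - G a)) - t\<^sup>2 * penalty \<alpha> S h"
  have "\<forall>\<^sub>F n in sequentially. phi \<alpha> S 0 h + rate_integral (\<lambda>s. (A n s - \<alpha> s) * G s) / 2 + X
      \<le> phi (A n) (atoms (\<nu>' n)) 0 h"
    using evt
  proof eventually_elim
    case (elim n)
    have "c n \<le> A n s" for s by (simp add: A_def)
    from phi_lower_bound_positive[OF step stepA ub\<alpha> ubA c(1) this t ab, of \<eta> h] elim
    show ?case by (simp add: X_def G_def)
  qed
  moreover have "(\<lambda>n. phi \<alpha> S 0 h + rate_integral (\<lambda>s. (A n s - \<alpha> s) * G s) / 2 + X)
      \<longlonglongrightarrow> phi \<alpha> S 0 h + rate_integral (\<lambda>s. (cdf01 \<nu> s - \<alpha> s) * G s) / 2 + X"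
    by (intro tendsto_intros lim_rate ubA A01 limA ubG Gs) auto
  ultimately have main: "phi \<alpha> S 0 h + rate_integral (\<lambda>s. (cdf01 \<nu> s - \<alpha> s) * G s) / 2 + X \<le> Phi \<beta> \<gamma> \<nu> 0 h"
    by (intro tendsto_le[OF sequentially_bot phiA])
  have ubGs: "unit_bounded (\<lambda>s. G s - s)" by (intro unit_bounded_intros ubG)
  \<comment> \<open>The level of \<open>\<nu>' n\<close> is the average of the levels of Dirac
    measures at its atoms, with weights summing to 1; the first-order condition is averaged
    accordingly.\<close>
  have "0 \<le> rate_integral (\<lambda>s. (cdf01 (\<nu>' n) s - \<alpha> s) * (G s - s))" for n
  proof -
    note D = finitely_atomicD[OF \<nu>'(1)[of n]]
    define w where "w q = measure (\<nu>' n) {q}" for q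
    have one: "(\<Sum>q\<in>atoms (\<nu>' n). w q) = 1"
      using cdf01_atomic[OF \<nu>'(1)[of n], of 1] cdf01_1[OF D(1)] D(3) by (simp add: w_def subset_iff indicator_def)
    have eq: "(cdf01 (\<nu>' n) s - \<alpha> s) * (G s - s)
        = (\<Sum>q\<in>atoms (\<nu>' n). w q * ((indicator {q..} s - \<alpha> s) * (G s - s)))" if "s \<le> 1" for s
    proof -
      have "(\<Sum>q\<in>atoms (\<nu>' n). w q * ((indicator {q..} s - \<alpha> s) * (G s - s)))
        = ((\<Sum>q\<in>atoms (\<nu>' n). w q * indicator {q..} s) - (\<Sum>q\<in>atoms (\<nu>' n). w q) * \<alpha> s) * (G s - s)"
        unfolding sum_distrib_right left_diff_distrib sum_subtractf[symmetric] by (intro sum.cong) (auto simp: algebra_simps)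
      then show ?thesis using cdf01_atomic[OF \<nu>'(1)[of n] that] one by (simp add: w_def)
    qed
    have "rate_integral (\<lambda>s. (cdf01 (\<nu>' n) s - \<alpha> s) * (G s - s))
        = rate_integral (\<lambda>s. \<Sum>q\<in>atoms (\<nu>' n). w q * ((indicator {q..} s - \<alpha> s) * (G s - s)))"
      by (rule rate_integral_cong) (rule eq)
    also have "\<dots> = (\<Sum>q\<in>atoms (\<nu>' n). rate_integral (\<lambda>s. w q * ((indicator {q..} s - \<alpha> s) * (G s - s))))"
      using D(2) by (intro rate_integral_sum[THEN conjunct2]) (auto intro!: unit_bounded_intros ub\<alpha> ubG)
    also have "\<dots> \<ge> 0"
      unfolding rate_integral_cmult using D(3)
      by (intro sum_nonneg mult_nonneg_nonneg) (auto simp: w_def \<alpha>_def G_def S_def intro!: first_order)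
    finally show ?thesis .
  qed
  then have "0 \<le> rate_integral (\<lambda>s. (cdf01 \<nu> s - \<alpha> s) * (G s - s))"
    by (intro LIMSEQ_le_const[OF lim_rate[of "\<lambda>n. cdf01 (\<nu>' n)" "\<lambda>s. G s - s"]])
       (auto intro!: unit_bounded_cdf01 \<nu>'p \<nu>01 \<nu>' ubGs Gs)
  also have "rate_integral (\<lambda>s. (cdf01 \<nu> s - \<alpha> s) * (G s - s))
      = rate_integral (\<lambda>s. (cdf01 \<nu> s - \<alpha> s) * G s - (cdf01 \<nu> s * s - \<alpha> s * s))"
    by (rule rate_integral_cong) (simp add: algebra_simps)
  also have "\<dots> = rate_integral (\<lambda>s. (cdf01 \<nu> s - \<alpha> s) * G s) - (rate_integral (\<lambda>s. cdf01 \<nu> s * s) - rate_integral (\<lambda>s. \<alpha> s * s))"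
    by (simp add: rate_integral_diff unit_bounded_intros ub\<alpha> ub\<nu> ubG)
  finally have fo: "rate_integral (\<lambda>s. cdf01 \<nu> s * s) - rate_integral (\<lambda>s. \<alpha> s * s) \<le> rate_integral (\<lambda>s. (cdf01 \<nu> s - \<alpha> s) * G s)"
    by simp
  have "Phi \<beta> \<gamma> \<mu> 0 h = phi \<alpha> S 0 h" using \<mu> by (simp add: Phi_def Phi_atomic_eq_phi \<alpha>_def S_def)
  then show ?thesis
    using main fo unfolding parisi_functional_eq \<alpha>_def[symmetric] S_def[symmetric] G_def[symmetric] X_def by linarith
qed

text \<open>The comparison is applied with the mixture as base and \<open>\<mu>\<close> as target,
  because this bounds the value at the mixture from above. Minimality then forces a sign on the
  first-order term at the mixture; it is divided by \<theta>, and the limit moves it to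
  \<open>\<mu>\<close>.\<close>

lemma first_order_condition:
  assumes \<mu>: "\<mu> \<in> finitely_atomic" "card (atoms \<mu>) \<le> k + 1"
    and min: "\<And>\<nu>. \<nu> \<in> atomic_measures (k + 1) \<Longrightarrow> parisi_functional \<beta> \<gamma> h \<mu> \<le> parisi_functional \<beta> \<gamma> h \<nu>"
    and q: "0 \<le> q" "q \<le> 1"
  shows "0 \<le> rate_integral (\<lambda>s. (indicator {q..} s - cdf01 \<mu> s) * (energy (cdf01 \<mu>) (atoms \<mu>) h s - s))"
proof -
  define \<alpha> where "\<alpha> = cdf01 \<mu>"
  \<comment> \<open>One set of break points for all mixtures, as the convergence of the energies
    requires. It has at most one point more than the atoms of \<open>\<mu>\<close>, hence
    \<open>k + 1\<close> in the hypothesis.\<close>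
  define S where "S = insert q (atoms \<mu>)"
  define \<theta> where "\<theta> n = inverse (real (Suc (Suc n)))" for n
  note D = finitely_atomicD[OF \<mu>(1)]
  have S: "finite S" "S \<subseteq> {0..1}" using D q by (auto simp: S_def)
  have step0: "step_function \<alpha> (atoms \<mu>)" unfolding \<alpha>_def by (rule step_function_cdf01[OF \<mu>(1)])
  have stepS: "step_function \<alpha> S" by (rule step_function_mono[OF step0 _ S]) (auto simp: S_def)
  have ub\<alpha>: "unit_bounded \<alpha>" unfolding \<alpha>_def by (rule unit_bounded_cdf01[OF D(1)])
  have \<theta>: "0 < \<theta> n" "\<theta> n < 1" for n by (auto simp: \<theta>_def field_simps)
  have \<theta>0: "\<theta> \<longlonglongrightarrow> 0" unfolding \<theta>_def by (rule LIMSEQ_Suc[OF LIMSEQ_inverse_real_of_nat])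
  have "\<forall>n. \<exists>\<nu>. \<nu> \<in> prob_measures \<and> (\<forall>A. A \<in> sets borel \<longrightarrow> A \<subseteq> {0..1} \<longrightarrow>
      measure \<nu> A = (1 - \<theta> n) * measure \<mu> A + \<theta> n * indicator A q)"
  proof
    fix n
    obtain \<nu> where "\<nu> \<in> prob_measures" "\<And>A. A \<in> sets borel \<Longrightarrow> A \<subseteq> {0..1} \<Longrightarrow>
      measure \<nu> A = (1 - \<theta> n) * measure \<mu> A + \<theta> n * indicator A q"
      by (rule mixture_exists[OF D(1), of q "\<theta> n"]) (use q \<theta> in \<open>auto intro: less_imp_le\<close>)
    then show "\<exists>\<nu>. \<nu> \<in> prob_measures \<and> (\<forall>A. A \<in> sets borel \<longrightarrow> A \<subseteq> {0..1} \<longrightarrow>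
      measure \<nu> A = (1 - \<theta> n) * measure \<mu> A + \<theta> n * indicator A q)" by blast
  qed
  from choice[OF this] obtain \<nu> where mix: "\<forall>n. \<nu> n \<in> prob_measures \<and> (\<forall>A. A \<in> sets borel \<longrightarrow> A \<subseteq> {0..1} \<longrightarrow>
      measure (\<nu> n) A = (1 - \<theta> n) * measure \<mu> A + \<theta> n * indicator A q)" ..
  have \<nu>: "\<nu> n \<in> prob_measures"
    "A \<in> sets borel \<Longrightarrow> A \<subseteq> {0..1} \<Longrightarrow> measure (\<nu> n) A = (1 - \<theta> n) * measure \<mu> A + \<theta> n * indicator A q" for n A
    using spec[OF mix, of n] by auto
  have "measure \<mu> S = 1"
  proof -
    interpret prob_space \<mu> by (rule prob_measuresD(1)[OF D(1)])
    have "S \<in> sets \<mu>" using S by (intro prob_measuresD(3)[OF D(1)] borel_closed finite_imp_closed)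
    then have "measure \<mu> (atoms \<mu>) \<le> measure \<mu> S" by (intro finite_measure_mono) (auto simp: S_def)
    then show ?thesis using D(4) prob_le_1[of S] by simp
  qed
  then have "measure (\<nu> n) S = 1" for n
    using S by (subst \<nu>(2)) (auto simp: S_def intro!: borel_closed finite_imp_closed)
  then have at: "\<nu> n \<in> finitely_atomic" "atoms (\<nu> n) \<subseteq> S" for n
    using atomicI[OF \<nu>(1) S] by auto
  have "card (atoms (\<nu> n)) \<le> k + 1 + 1" for n
  proof -
    have "card (atoms (\<nu> n)) \<le> card S" by (rule card_mono[OF S(1) at(2)])
    also have "\<dots> \<le> Suc (card (atoms \<mu>))" unfolding S_def by (rule card_insert_le_m1) auto
    finally show ?thesis using \<mu>(2) by simp
  qed
  then have ge: "parisi_functional \<beta> \<gamma> h \<mu> \<le> parisi_functional \<beta> \<gamma> h (\<nu> n)" for n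
    using at(1) by (intro min) (simp add: atomic_measures_def)
  define A where "A n = cdf01 (\<nu> n)" for n
  have A: "A n s - \<alpha> s = \<theta> n * (indicator {q..} s - \<alpha> s)" if "0 \<le> s" "s \<le> 1" for n s
    using that q \<nu>(2)[of "{0..s}" n] by (simp add: A_def \<alpha>_def cdf01_def indicator_def algebra_simps)
  have stepA: "step_function (A n) S" for n
    unfolding A_def by (rule step_function_mono[OF step_function_cdf01[OF at(1)] at(2) S])
  have ubA: "unit_bounded (A n)" for n unfolding A_def by (rule unit_bounded_cdf01[OF \<nu>(1)])
  define G where "G n = energy (A n) S h" for n
  have flow: "parisi_flow \<beta> \<gamma> (A n) S" for n by unfold_locales (rule stepA)
  have ubG: "unit_bounded (G n)" for n unfolding G_def by (rule parisi_flow.unit_bounded_energy[OF flow])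
  define f where "f s = indicator {q..} s - \<alpha> s" for s
  have ubf: "unit_bounded f" unfolding f_def by (intro unit_bounded_intros ub\<alpha>) auto
  have nonneg: "0 \<le> rate_integral (\<lambda>s. f s * (G n s - s))" for n
  proof -
    have "phi (A n) S 0 h = phi (A n) (atoms (\<nu> n)) 0 h"
      unfolding A_def by (subst phi_refine[OF step_function_cdf01[OF at(1)] at(2) S]) auto
    then have PA: "Phi \<beta> \<gamma> (\<nu> n) 0 h = phi (A n) S 0 h"
      using at(1)[of n] by (simp add: Phi_def Phi_atomic_eq_phi A_def)
    have P\<mu>: "Phi \<beta> \<gamma> \<mu> 0 h = phi \<alpha> (atoms \<mu>) 0 h"
      using \<mu>(1) by (simp add: Phi_def Phi_atomic_eq_phi \<alpha>_def)
    have "phi \<alpha> (atoms \<mu>) 0 h \<ge> phi (A n) S 0 h + rate_integral (\<lambda>s. (\<alpha> s - A n s) * G n s) / 2"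
      unfolding G_def by (rule phi_lower_bound[OF stepA step0 ubA ub\<alpha>])
    then have "0 \<le> - rate_integral (\<lambda>s. (\<alpha> s - A n s) * G n s) - (rate_integral (\<lambda>s. A n s * s) - rate_integral (\<lambda>s. \<alpha> s * s))"
      using ge[of n] unfolding parisi_functional_eq PA P\<mu> A_def[symmetric] \<alpha>_def[symmetric] by linarith
    also have "\<dots> = rate_integral (\<lambda>s. (-1) * ((\<alpha> s - A n s) * G n s) - (A n s * s - \<alpha> s * s))"
      unfolding rate_integral_cmult[of "-1", symmetric, simplified]
      by (simp add: rate_integral_diff unit_bounded_intros ub\<alpha> ubA ubG)
    also have "\<dots> = rate_integral (\<lambda>s. \<theta> n * (f s * (G n s - s)))"
    proof (rule rate_integral_cong)
      fix s :: real assume s: "0 \<le> s" "s \<le> 1"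
      have "(-1) * ((\<alpha> s - A n s) * G n s) - (A n s * s - \<alpha> s * s) = (A n s - \<alpha> s) * (G n s - s)"
        by (simp add: algebra_simps)
      then show "(-1) * ((\<alpha> s - A n s) * G n s) - (A n s * s - \<alpha> s * s) = \<theta> n * (f s * (G n s - s))"
        unfolding A[OF s] f_def by simp
    qed
    also have "\<dots> = \<theta> n * rate_integral (\<lambda>s. f s * (G n s - s))" by (rule rate_integral_cmult)
    finally show ?thesis using \<theta>(1)[of n] by (simp add: zero_le_mult_iff)
  qed
  have limA: "(\<lambda>n. A n s) \<longlonglongrightarrow> \<alpha> s" if "0 \<le> s" "s < 1" for s
  proof -
    have "(\<lambda>n. \<alpha> s + \<theta> n * (indicator {q..} s - \<alpha> s)) \<longlonglongrightarrow> \<alpha> s + 0 * (indicator {q..} s - \<alpha> s)"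
      by (intro tendsto_intros \<theta>0)
    moreover have "A n s = \<alpha> s + \<theta> n * (indicator {q..} s - \<alpha> s)" for n using A[of s n] that by simp
    ultimately show ?thesis by simp
  qed
  have "(\<lambda>n. rate_integral (\<lambda>s. f s * (G n s - s))) \<longlonglongrightarrow> rate_integral (\<lambda>s. f s * (energy \<alpha> (atoms \<mu>) h s - s))"
  proof (rule rate_integral_tendsto[where B=1])
    show "unit_bounded (\<lambda>s. f s * (energy \<alpha> (atoms \<mu>) h s - s))"
      by (intro unit_bounded_intros ubf parisi_flow.unit_bounded_energy) (unfold_locales, rule step0)
    show "\<bar>f s * (G n s - s)\<bar> \<le> 1" if s: "0 \<le> s" "s \<le> 1" for n s
    proof -
      have "\<bar>f s\<bar> \<le> 1" using step_functionD(3,4)[OF step0, of s] by (auto simp: f_def indicator_def abs_le_iff)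
      moreover have "\<bar>G n s - s\<bar> \<le> 1"
        using parisi_flow.energy_bounds[OF flow s, of n h] s by (auto simp: G_def abs_le_iff)
      ultimately show ?thesis unfolding abs_mult by (intro mult_le_one) auto
    qed
    show "(\<lambda>n. f s * (G n s - s)) \<longlonglongrightarrow> f s * (energy \<alpha> (atoms \<mu>) h s - s)" if s: "0 \<le> s" "s \<le> 1" for s
    proof -
      have "(\<lambda>n. G n s) \<longlonglongrightarrow> energy \<alpha> S h s" unfolding G_def by (rule energy_tendsto[OF stepA stepS limA s])
      also have "energy \<alpha> S h s = energy \<alpha> (atoms \<mu>) h s"
        by (rule energy_refine[OF step0 _ S s]) (auto simp: S_def)
      finally show ?thesis by (intro tendsto_intros)
    qed
  qed (intro unit_bounded_intros ubf ubG)
  then have "0 \<le> rate_integral (\<lambda>s. f s * (energy \<alpha> (atoms \<mu>) h s - s))"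
    by (rule LIMSEQ_le_const) (use nonneg in auto)
  then show ?thesis by (simp add: f_def[abs_def] \<alpha>_def)
qed

text \<open>A nonzero tail integral stays away from zero shortly after \<open>s\<close>, and the
  energy of \<open>\<mu>\<close> increases strictly there. The gain is thus linear in
  \<open>t\<close> with a positive coefficient while the price is quadratic.\<close>

lemma parisi_functional_strict:
  assumes \<mu>: "\<mu> \<in> finitely_atomic" and \<nu>: "\<nu> \<in> prob_measures"
    and first_order: "\<And>q. 0 \<le> q \<Longrightarrow> q \<le> 1 \<Longrightarrow>
      0 \<le> rate_integral (\<lambda>s. (indicator {q..} s - cdf01 \<mu> s) * (energy (cdf01 \<mu>) (atoms \<mu>) h s - s))"
    and s: "0 < s" "s < 1" "tail_integral (\<lambda>s. cdf01 \<nu> s - cdf01 \<mu> s) s \<noteq> 0"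
  shows "parisi_functional \<beta> \<gamma> h \<mu> < parisi_functional \<beta> \<gamma> h \<nu>"
proof -
  define S where "S = atoms \<mu>"
  define \<alpha> where "\<alpha> = cdf01 \<mu>"
  define T where "T = tail_integral (\<lambda>s. cdf01 \<nu> s - \<alpha> s)"
  note D = finitely_atomicD[OF \<mu>]
  interpret F: parisi_flow \<beta> \<gamma> \<alpha> S
    unfolding \<alpha>_def S_def by unfold_locales (rule step_function_cdf01[OF \<mu>])
  have ub: "unit_bounded (\<lambda>s. cdf01 \<nu> s - \<alpha> s)" unfolding \<alpha>_def by (intro unit_bounded_intros unit_bounded_cdf01 \<nu> D)
  obtain B where B: "0 \<le> B" "\<And>s t. 0 \<le> s \<Longrightarrow> s \<le> t \<Longrightarrow> t \<le> 1 \<Longrightarrow> \<tau> t - \<tau> s \<le> B * (t - s)"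
    using clock_lipschitz by blast
  have lip: "\<bar>T r - T r'\<bar> \<le> B * (r' - r)" if r: "0 \<le> r" "r \<le> r'" "r' \<le> 1" for r r'
  proof -
    have le1: "cdf01 \<nu> u - \<alpha> u \<le> 1" "- 1 \<le> cdf01 \<nu> u - \<alpha> u" for u
      using cdf01_bounds[OF \<nu>, of u] F.\<alpha>_nonneg[of u] F.\<alpha>_le_1[of u] by auto
    have eq: "T r - T r' = rate_integral (\<lambda>u. indicator {r..<r'} u * (cdf01 \<nu> u - \<alpha> u))"
      unfolding T_def by (rule tail_integral_diff[OF ub r(2)])
    have "rate_integral (\<lambda>u. indicator {r..<r'} u * (cdf01 \<nu> u - \<alpha> u)) \<le> rate_integral (indicator {r..<r'})"
      using le1 by (intro rate_integral_mono unit_bounded_mult unit_bounded_indicator ub) (auto simp: indicator_def)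
    moreover have "rate_integral (\<lambda>u. (-1) * indicator {r..<r'} u) \<le> rate_integral (\<lambda>u. indicator {r..<r'} u * (cdf01 \<nu> u - \<alpha> u))"
      using le1 by (intro rate_integral_mono unit_bounded_mult unit_bounded_indicator unit_bounded_const ub) (auto simp: indicator_def)
    ultimately have "\<bar>T r - T r'\<bar> \<le> \<tau> r' - \<tau> r"
      unfolding eq rate_integral_cmult rate_integral_indicator[OF r] by (simp add: abs_le_iff)
    then show ?thesis using B(2)[OF r] by simp
  qed
  define \<kappa> where "\<kappa> = \<bar>T s\<bar> / 2"
  have \<kappa>: "0 < \<kappa>" using s(3) by (simp add: \<kappa>_def T_def \<alpha>_def)
  define n where "n = next_jump S 1 s"
  note nj = next_jump[OF F.finite_S s(2), folded n_def]
  \<comment> \<open>The first bound keeps the tail integral at least half as large as at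
    \<open>s\<close>, by its Lipschitz property; the second keeps the window free of jumps and away
    from 1.\<close>
  define e where "e = min (\<kappa> / (B + 1)) ((n - s) / 2)"
  have e: "0 < e" "e < n - s" "B * e \<le> \<kappa>"
  proof -
    show "0 < e" using \<kappa> B nj by (simp add: e_def)
    have "e \<le> (n - s) / 2" unfolding e_def by (rule min.cobounded2)
    then show "e < n - s" using nj by simp
    have "B * e \<le> (B + 1) * (\<kappa> / (B + 1))" using B \<open>0 < e\<close> by (intro mult_mono) (auto simp: e_def)
    then show "B * e \<le> \<kappa>" using B by simp
  qed
  have low: "\<kappa>\<^sup>2 \<le> (T u)\<^sup>2" if u: "s \<le> u" "u \<le> s + e" for u
  proof -
    have "\<bar>T s - T u\<bar> \<le> B * (u - s)" using u s e nj by (intro lip) auto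
    also have "\<dots> \<le> B * e" using u B by (intro mult_left_mono) auto
    finally have "\<bar>T s - T u\<bar> \<le> \<kappa>" using e by simp
    then have "\<kappa> \<le> \<bar>T u\<bar>" unfolding \<kappa>_def by linarith
    then show ?thesis using \<kappa> by (metis abs_le_square_iff abs_of_pos)
  qed
  define \<Gamma> where "\<Gamma> = \<kappa>\<^sup>2 / 2 * (energy \<alpha> S h (s + e) - energy \<alpha> S h s)"
  define p where "p = \<bar>penalty \<alpha> S h\<bar> + 1"
  \<comment> \<open>The maximizer of \<open>t * \<Gamma> - t^2 * p\<close>; half of the linear gain
    survives.\<close>
  define t where "t = \<Gamma> / (2 * p)"
  have "energy \<alpha> S h s < energy \<alpha> S h (s + e)"
    using s e nj by (intro F.energy_strict_mono) (auto simp: disjoint_iff)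
  then have \<Gamma>: "0 < \<Gamma>" using \<kappa> by (simp add: \<Gamma>_def)
  have p: "0 < p" "penalty \<alpha> S h \<le> p" by (auto simp: p_def)
  have t: "0 < t" using \<Gamma> p by (simp add: t_def)
  have "parisi_functional \<beta> \<gamma> h \<mu> + t * \<Gamma> - t\<^sup>2 * penalty \<alpha> S h \<le> parisi_functional \<beta> \<gamma> h \<nu>"
    unfolding \<Gamma>_def \<alpha>_def S_def
  proof (rule parisi_functional_lower_bound[OF \<mu> \<nu> first_order])
    show "2 * (\<kappa>\<^sup>2 / 2) \<le> (tail_integral (\<lambda>s. cdf01 \<nu> s - cdf01 \<mu> s) u)\<^sup>2" if "s \<le> u" "u \<le> s + e" for u
      using low[OF that] by (simp add: T_def \<alpha>_def)
  qed (use t s e nj in auto)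
  moreover have "t\<^sup>2 * penalty \<alpha> S h \<le> t\<^sup>2 * p" using p by (intro mult_left_mono) auto
  moreover have "t\<^sup>2 * p = t * \<Gamma> / 2" using p by (simp add: t_def power2_eq_square)
  moreover have "0 < t * \<Gamma>" using t \<Gamma> by simp
  ultimately show ?thesis by linarith
qed

end

theorem proposition2:
  fixes \<beta> h :: real and \<gamma> :: "nat \<Rightarrow> real" and k :: nat and \<mu>0 :: "real measure"
  assumes "\<beta> > 0"
    and "\<And>p. p \<ge> 2 \<Longrightarrow> \<gamma> p \<ge> 0"
    and "\<exists>p\<ge>2. \<gamma> p \<noteq> 0"
    and "summable (\<lambda>p. 2 ^ p * (\<gamma> p)\<^sup>2)"
    and "is_arg_min (parisi_functional \<beta> \<gamma> h) (\<lambda>\<mu>. \<mu> \<in> atomic_measures k) \<mu>0"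
    and "(INF \<mu>\<in>atomic_measures (k + 1). parisi_functional \<beta> \<gamma> h \<mu>)
           = parisi_functional \<beta> \<gamma> h \<mu>0"
  shows "is_parisi_measure \<beta> \<gamma> h \<mu>0"
proof -
  interpret clock \<beta> \<gamma> by (rule clockI[OF assms(1,3,4)])
  let ?P = "parisi_functional \<beta> \<gamma> h"
  have \<mu>0: "\<mu>0 \<in> finitely_atomic" "card (atoms \<mu>0) \<le> k + 1"
    using assms(5) by (auto simp: is_arg_min_def atomic_measures_def)
  have prob: "\<mu>0 \<in> prob_measures" by (rule finitely_atomicD(1)[OF \<mu>0(1)])
  have "bdd_below (?P ` atomic_measures (k + 1))"
    by (rule bdd_belowI2[of _ "- \<tau> 1 / 2"], rule parisi_functional_bounded_below) (simp add: atomic_measures_def)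
  then have "?P \<mu>0 \<le> ?P \<nu>" if "\<nu> \<in> atomic_measures (k + 1)" for \<nu>
    using cINF_lower[OF _ that] assms(6) by metis
  note first_order = first_order_condition[OF \<mu>0 this]
  \<comment> \<open>With \<open>t = 0\<close> only the first-order part is used, and it already
    gives minimality over all measures.\<close>
  have minimal: "?P \<mu>0 \<le> ?P \<nu>" if "\<nu> \<in> prob_measures" for \<nu>
    using parisi_functional_lower_bound[OF \<mu>0(1) that first_order, of 0 0 0 0] by simp
  have unique: "\<nu> = \<mu>0" if \<nu>: "\<nu> \<in> prob_measures" and le: "?P \<nu> \<le> ?P \<mu>0" for \<nu>
  proof -
    have zero: "tail_integral (\<lambda>s. cdf01 \<nu> s - cdf01 \<mu>0 s) s = 0" if "0 < s" "s < 1" for s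
      using parisi_functional_strict[OF \<mu>0(1) \<nu> first_order that] le by force
    \<comment> \<open>Vanishing tails yield only one inequality between the distribution functions,
      so the roles are exchanged for the other.\<close>
    have zero': "tail_integral (\<lambda>s. cdf01 \<mu>0 s - cdf01 \<nu> s) s = 0" if "0 < s" "s < 1" for s
    proof -
      have "tail_integral (\<lambda>s. cdf01 \<mu>0 s - cdf01 \<nu> s) s = (-1) * tail_integral (\<lambda>s. cdf01 \<nu> s - cdf01 \<mu>0 s) s"
        unfolding tail_integral_def rate_integral_cmult[symmetric]
        by (rule rate_integral_cong) (simp add: algebra_simps)
      then show ?thesis using zero[OF that] by simp
    qed
    show ?thesis
      using tail_integral_zero_imp_cdf01_eq[OF prob \<nu> zero] tail_integral_zero_imp_cdf01_eq[OF \<nu> prob zero']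
      by (intro cdf01_unique prob \<nu> antisym)
  qed
  show ?thesis
    unfolding is_parisi_measure_def is_arg_min_def using prob minimal unique by (auto simp: not_less)
qed

end
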